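(* Let $(\mathbf{B},\mathbf{p})$ be a Brascamp--Lieb datum with $p_j>0$ for all $j$. Then gaussian extremisers for $(\mathbf{B},\mathbf{p})$ exist and are unique (up to scaling $\mathbf{A}\mapsto\lambda\mathbf{A}$, $\lambda>0$) if and only if $(\mathbf{B},\mathbf{p})$ is simple.
   Context: A Euclidean space is a finite-dimensional real Hilbert space with its Lebesgue measure. An $m$-transformation ($m\ge 0$ an integer) is a triple $\mathbf{B}=(H,(H_j)_{1\le j\le m},(B_j)_{1\le j\le m})$ with $H,H_1,\dots,H_m$ Euclidean spaces and $B_j:H\to H_j$ linear. An $m$-exponent is a tuple $\mathbf{p}=(p_j)_{1\le j\le m}$ of non-negative reals. A Brascamp--Lieb datum is a pair $(\mathbf{B},\mathbf{p})$ of an $m$-transformation and an $m$-exponent. A gaussian input is a tuple $\mathbf{A}=(A_j)_{1\le j\le m}$ of positive definite (self-adjoint) transformations $A_j:H_j\to H_j$; $\lambda\mathbf{A}=(\lambda A_j)_{1\le j\le m}$. Define $$\mathrm{BL}_{\mathbf g}(\mathbf{B},\mathbf{p};\mathbf{A})=\left(\frac{\prod_{j=1}^m(\det_{H_j}A_j)^{p_j}}{\det_H(\sum_{j=1}^m p_jB_j^*A_jB_j)}\right)^{1/2}$$ (interpreted as $+\infty$ if the denominator vanishes), and $\mathrm{BL}_{\mathbf g}(\mathbf{B},\mathbf{p})=\sup_{\mathbf{A}}\mathrm{BL}_{\mathbf g}(\mathbf{B},\mathbf{p};\mathbf{A})\in(0,+\infty]$ over all gaussian inputs. A gaussian extremiser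 for $(\mathbf{B},\mathbf{p})$ is a gaussian input $\mathbf{A}$ with $\mathrm{BL}_{\mathbf g}(\mathbf{B},\mathbf{p};\mathbf{A})=\mathrm{BL}_{\mathbf g}(\mathbf{B},\mathbf{p})<\infty$. A critical subspace for $(\mathbf{B},\mathbf{p})$ is a non-zero proper subspace $V$ of $H$ with $\dim(V)=\sum_{j=1}^m p_j\dim(B_jV)$. The datum is simple if it has no critical subspaces.
   Formalization: "Simple" is supplemented by the conditions dim H = sum p_j dim H_j and dim V <= sum p_j dim(B_j V) for all subspaces V of H; without them the claim fails, e.g. H = H_1 = R, B_1 = id, p_1 = 1/2 is simple but has no gaussian extremiser. *)

theory Defs
  imports "HOL-Analysis.Analysis" "Jordan_Normal_Form.Determinant"
begin

text \<open>
  The Euclidean spaces \<open>H\<close> and \<open>Hj 1, \<dots>, Hj m\<close> are linear subspaces, possibly zero, of the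
  ambient Euclidean spaces \<open>'a\<close> and \<open>'b\<close>, with the induced inner product. Every finite family of
  Euclidean spaces embeds isometrically in a common one, so sharing \<open>'b\<close> costs no generality.

  A linear map between subspaces is given by a linear map of the ambient spaces sending the
  first subspace into the second. Such an extension always exists, and every notion below
  depends only on the restriction.
\<close>

definition orthonormal_basis_list :: "'a::euclidean_space set \<Rightarrow> 'a list \<Rightarrow> bool" where
  "orthonormal_basis_list S bs \<longleftrightarrow> length bs = dim S \<and> set bs \<subseteq> S \<and>
     (\<forall>i<length bs. \<forall>k<length bs. inner (bs ! i) (bs ! k) = (if i = k then 1 else 0))"

definition matrix_in :: "'a::euclidean_space list \<Rightarrow> ('a \<Rightarrow> 'a) \<Rightarrow> real mat" where
  "matrix_in bs T = Matrix.mat (length bs) (length bs) (\<lambda>(i, k). inner (bs ! i) (T (bs ! k)))"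

text \<open>The determinant of \<open>T : S \<rightarrow> S\<close>; the choice of the basis is immaterial
  (\<open>det_on_eq\<close> below). It is 1 if \<open>S\<close> is the zero space.\<close>

definition det_on :: "'a::euclidean_space set \<Rightarrow> ('a \<Rightarrow> 'a) \<Rightarrow> real" where
  "det_on S T = Determinant.det (matrix_in (SOME bs. orthonormal_basis_list S bs) T)"

text \<open>The adjoint of the restriction of \<open>B\<close> to \<open>S\<close>; it takes values in \<open>S\<close>, unlike the
  library's \<open>adjoint\<close> of the ambient map.\<close>

definition adjoint_on :: "'a::euclidean_space set \<Rightarrow> ('a \<Rightarrow> 'b::euclidean_space) \<Rightarrow> 'b \<Rightarrow> 'a" where
  "adjoint_on S B y = (THE x. x \<in> S \<and> (\<forall>v\<in>S. inner (B v) y = inner v x))"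

definition transformation ::
  "nat \<Rightarrow> 'a::euclidean_space set \<Rightarrow> (nat \<Rightarrow> 'b::euclidean_space set) \<Rightarrow> (nat \<Rightarrow> 'a \<Rightarrow> 'b) \<Rightarrow> bool" where
  "transformation m H Hj B \<longleftrightarrow> subspace H \<and>
     (\<forall>j\<in>{1..m}. subspace (Hj j) \<and> linear (B j) \<and> B j ` H \<subseteq> Hj j)"

definition exponent :: "nat \<Rightarrow> (nat \<Rightarrow> real) \<Rightarrow> bool" where
  "exponent m p \<longleftrightarrow> (\<forall>j\<in>{1..m}. p j \<ge> 0)"

definition BL_datum ::
  "nat \<Rightarrow> 'a::euclidean_space set \<Rightarrow> (nat \<Rightarrow> 'b::euclidean_space set) \<Rightarrow> (nat \<Rightarrow> 'a \<Rightarrow> 'b) \<Rightarrow> (nat \<Rightarrow> real) \<Rightarrow> bool" where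
  "BL_datum m H Hj B p \<longleftrightarrow> transformation m H Hj B \<and> exponent m p"

definition positive_definite_on :: "'b::euclidean_space set \<Rightarrow> ('b \<Rightarrow> 'b) \<Rightarrow> bool" where
  "positive_definite_on S T \<longleftrightarrow> linear T \<and> T ` S \<subseteq> S \<and>
     (\<forall>x\<in>S. \<forall>y\<in>S. inner (T x) y = inner x (T y)) \<and>
     (\<forall>x\<in>S. x \<noteq> 0 \<longrightarrow> inner (T x) x > 0)"

definition gaussian_input ::
  "nat \<Rightarrow> (nat \<Rightarrow> 'b::euclidean_space set) \<Rightarrow> (nat \<Rightarrow> 'b \<Rightarrow> 'b) \<Rightarrow> bool" where
  "gaussian_input m Hj A \<longleftrightarrow> (\<forall>j\<in>{1..m}. positive_definite_on (Hj j) (A j))"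

definition BLg_op ::
  "nat \<Rightarrow> 'a::euclidean_space set \<Rightarrow> (nat \<Rightarrow> 'a \<Rightarrow> 'b::euclidean_space) \<Rightarrow> (nat \<Rightarrow> real) \<Rightarrow> (nat \<Rightarrow> 'b \<Rightarrow> 'b) \<Rightarrow> 'a \<Rightarrow> 'a" where
  "BLg_op m H B p A x = (\<Sum>j\<in>{1..m}. p j *\<^sub>R adjoint_on H (B j) (A j (B j x)))"

definition BLg_at ::
  "nat \<Rightarrow> 'a::euclidean_space set \<Rightarrow> (nat \<Rightarrow> 'b::euclidean_space set) \<Rightarrow> (nat \<Rightarrow> 'a \<Rightarrow> 'b) \<Rightarrow> (nat \<Rightarrow> real) \<Rightarrow>
   (nat \<Rightarrow> 'b \<Rightarrow> 'b) \<Rightarrow> ereal" where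
  "BLg_at m H Hj B p A =
     (if det_on H (BLg_op m H B p A) = 0 then \<infinity>
      else ereal (sqrt ((\<Prod>j\<in>{1..m}. det_on (Hj j) (A j) powr p j) / det_on H (BLg_op m H B p A))))"

definition BLg ::
  "nat \<Rightarrow> 'a::euclidean_space set \<Rightarrow> (nat \<Rightarrow> 'b::euclidean_space set) \<Rightarrow> (nat \<Rightarrow> 'a \<Rightarrow> 'b) \<Rightarrow> (nat \<Rightarrow> real) \<Rightarrow> ereal" where
  "BLg m H Hj B p = (SUP A\<in>{A. gaussian_input m Hj A}. BLg_at m H Hj B p A)"

definition gaussian_extremiser ::
  "nat \<Rightarrow> 'a::euclidean_space set \<Rightarrow> (nat \<Rightarrow> 'b::euclidean_space set) \<Rightarrow> (nat \<Rightarrow> 'a \<Rightarrow> 'b) \<Rightarrow> (nat \<Rightarrow> real) \<Rightarrow>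
   (nat \<Rightarrow> 'b \<Rightarrow> 'b) \<Rightarrow> bool" where
  "gaussian_extremiser m H Hj B p A \<longleftrightarrow>
     gaussian_input m Hj A \<and> BLg_at m H Hj B p A = BLg m H Hj B p \<and> BLg m H Hj B p < \<infinity>"

definition critical_subspace ::
  "nat \<Rightarrow> 'a::euclidean_space set \<Rightarrow> (nat \<Rightarrow> 'a \<Rightarrow> 'b::euclidean_space) \<Rightarrow> (nat \<Rightarrow> real) \<Rightarrow> 'a set \<Rightarrow> bool" where
  "critical_subspace m H B p V \<longleftrightarrow> subspace V \<and> V \<subseteq> H \<and> V \<noteq> {0} \<and> V \<noteq> H \<and>
     real (dim V) = (\<Sum>j\<in>{1..m}. p j * real (dim (B j ` V)))"

definition simple ::
  "nat \<Rightarrow> 'a::euclidean_space set \<Rightarrow> (nat \<Rightarrow> 'a \<Rightarrow> 'b::euclidean_space) \<Rightarrow> (nat \<Rightarrow> real) \<Rightarrow> bool" where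
  "simple m H B p \<longleftrightarrow> (\<nexists>V. critical_subspace m H B p V)"

text \<open>
  The scaling condition and the dimension condition. They do not follow from the absence of
  critical subspaces: \<open>H = Hj 1 = \<real>\<close>, \<open>m = 1\<close>, \<open>B 1 = id\<close>, \<open>p 1 = 1/2\<close> has no non-zero proper
  subspace at all, but \<open>BLg_at = sqrt 2 * a powr (-1/4)\<close> at the input \<open>a > 0\<close> is unbounded.
\<close>

definition feasible ::
  "nat \<Rightarrow> 'a::euclidean_space set \<Rightarrow> (nat \<Rightarrow> 'b::euclidean_space set) \<Rightarrow> (nat \<Rightarrow> 'a \<Rightarrow> 'b) \<Rightarrow> (nat \<Rightarrow> real) \<Rightarrow> bool" where
  "feasible m H Hj B p \<longleftrightarrow>
     real (dim H) = (\<Sum>j\<in>{1..m}. p j * real (dim (Hj j))) \<and>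
     (\<forall>V. subspace V \<and> V \<subseteq> H \<longrightarrow> real (dim V) \<le> (\<Sum>j\<in>{1..m}. p j * real (dim (B j ` V))))"

lemma orthonormal_basis_list_exists:
  assumes "subspace S"
  shows "\<exists>bs. orthonormal_basis_list S bs"
proof -
  obtain B where B: "B \<subseteq> S" "pairwise real_inner_class.orthogonal B" "\<And>x. x \<in> B \<Longrightarrow> norm x = 1"
    "independent B" "card B = dim S" "span B = S"
    using orthonormal_basis_subspace[OF assms] by blast
  obtain bs where bs: "set bs = B" "distinct bs"
    using finite_distinct_list[OF independent_imp_finite[OF B(4)]] by blast
  have "inner (bs ! i) (bs ! k) = (if i = k then 1 else 0)"
    if "i < length bs" "k < length bs" for i k
    using that B(2,3) bs
    by (auto simp: pairwise_def real_inner_class.orthogonal_def nth_eq_iff_index_eq dot_square_norm)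
  moreover have "length bs = dim S"
    using bs B(5) distinct_card by fastforce
  ultimately show ?thesis
    using bs B(1) by (auto simp: orthonormal_basis_list_def)
qed

lemma orthonormal_basis_list_expand:
  assumes S: "subspace S" and bs: "orthonormal_basis_list S bs" and x: "x \<in> S"
  shows "(\<Sum>i<length bs. inner (bs ! i) x *\<^sub>R bs ! i) = x"
proof -
  have nn: "inner (bs ! i) (bs ! k) = (if i = k then 1 else 0)"
    if "i < length bs" "k < length bs" for i k
    using that bs by (auto simp: orthonormal_basis_list_def)
  have d: "distinct bs"
    unfolding distinct_conv_nth
  proof (intro allI impI)
    fix i k assume "i < length bs" "k < length bs" "i \<noteq> k"
    then show "bs ! i \<noteq> bs ! k" using nn[of i k] nn[of i i] by auto
  qed
  have po: "pairwise real_inner_class.orthogonal (set bs)"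
    unfolding pairwise_def real_inner_class.orthogonal_def using nn by (fastforce simp: in_set_conv_nth)
  have n1: "norm b = 1" if "b \<in> set bs" for b
    using that nn by (auto simp: in_set_conv_nth norm_eq_1)
  have ind: "independent (set bs)"
    using pairwise_orthogonal_independent[OF po] n1 by fastforce
  have "S \<subseteq> span (set bs)"
    using bs card_eq_dim[of "set bs" S] distinct_card[OF d] ind
    by (auto simp: orthonormal_basis_list_def)
  then have "(\<Sum>b\<in>set bs. inner x b *\<^sub>R b) = x"
    using orthonormal_basis_expand[OF po n1] x by blast
  moreover have "(\<Sum>b\<in>set bs. inner x b *\<^sub>R b) = (\<Sum>i<length bs. inner x (bs ! i) *\<^sub>R bs ! i)"
    by (rule sum.reindex_bij_betw[symmetric]) (rule bij_betw_nth[OF d]; simp)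
  ultimately show ?thesis by (simp add: inner_commute)
qed

lemma det_on_eq:
  assumes S: "subspace S" and T: "linear T" "T ` S \<subseteq> S" and bs: "orthonormal_basis_list S bs"
  shows "det_on S T = Determinant.det (matrix_in bs T)"
proof -
  define cs where "cs = (SOME cs. orthonormal_basis_list S cs)"
  have cs: "orthonormal_basis_list S cs"
    unfolding cs_def using someI_ex[OF orthonormal_basis_list_exists[OF S]] .
  define n where "n = dim S"
  have len: "length bs = n" "length cs = n"
    using bs cs by (auto simp: orthonormal_basis_list_def n_def)
  have mem: "bs ! i \<in> S" "cs ! i \<in> S" if "i < n" for i
  proof -
    have "set bs \<subseteq> S" "set cs \<subseteq> S" using bs cs by (simp_all add: orthonormal_basis_list_def)
    then show "bs ! i \<in> S" "cs ! i \<in> S" using that len nth_mem[of i bs] nth_mem[of i cs] by auto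
  qed
  define Q where "Q = Matrix.mat n n (\<lambda>(i, k). inner (bs ! i) (cs ! k))"
  have parseval: "(\<Sum>i<n. inner (bs ! i) x * inner (bs ! i) y) = inner x y" if "x \<in> S" for x y
  proof -
    have "inner x y = inner (\<Sum>i<n. inner (bs ! i) x *\<^sub>R bs ! i) y"
      using orthonormal_basis_list_expand[OF S bs that] len by simp
    then show ?thesis by (simp add: inner_sum_left)
  qed
  have parseval': "(\<Sum>i<n. inner (cs ! i) x * inner (cs ! i) y) = inner x y" if "x \<in> S" for x y
  proof -
    have "inner x y = inner (\<Sum>i<n. inner (cs ! i) x *\<^sub>R cs ! i) y"
      using orthonormal_basis_list_expand[OF S cs that] len by simp
    then show ?thesis by (simp add: inner_sum_left)
  qed
  have carr: "Q \<in> carrier_mat n n" "matrix_in bs T \<in> carrier_mat n n" "matrix_in cs T \<in> carrier_mat n n"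
    by (auto simp: Q_def matrix_in_def len)
  have QQ: "transpose_mat Q * Q = 1\<^sub>m n"
  proof (rule eq_matI)
    fix i k assume *: "i < dim_row (1\<^sub>m n)" "k < dim_col (1\<^sub>m n)"
    have "(transpose_mat Q * Q) $$ (i, k) = (\<Sum>j<n. inner (bs ! j) (cs ! i) * inner (bs ! j) (cs ! k))"
      using * by (simp add: Q_def scalar_prod_def lessThan_atLeast0)
    also have "\<dots> = inner (cs ! i) (cs ! k)"
      using * mem by (intro parseval) auto
    also have "\<dots> = 1\<^sub>m n $$ (i, k)"
      using * cs len by (auto simp: orthonormal_basis_list_def)
    finally show "(transpose_mat Q * Q) $$ (i, k) = 1\<^sub>m n $$ (i, k)" .
  qed (auto simp: Q_def)
  have comm: "matrix_in bs T * Q = Q * matrix_in cs T"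
  proof (rule eq_matI)
    fix i k assume *: "i < dim_row (Q * matrix_in cs T)" "k < dim_col (Q * matrix_in cs T)"
    then have ik: "i < n" "k < n" by (auto simp: Q_def matrix_in_def len)
    have Tc: "T (cs ! k) \<in> S" using T(2) mem(2)[OF ik(2)] by blast
    have "T (cs ! k) = T (\<Sum>j<n. inner (bs ! j) (cs ! k) *\<^sub>R bs ! j)"
      using orthonormal_basis_list_expand[OF S bs mem(2)[OF ik(2)]] len by simp
    also have "\<dots> = (\<Sum>j<n. inner (bs ! j) (cs ! k) *\<^sub>R T (bs ! j))"
      using T(1) by (simp add: linear_sum linear_cmul)
    finally have 1: "inner (bs ! i) (T (cs ! k))
        = (\<Sum>j<n. inner (bs ! i) (T (bs ! j)) * inner (bs ! j) (cs ! k))"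
      by (simp add: inner_sum_right mult.commute)
    have 2: "(\<Sum>j<n. inner (bs ! i) (cs ! j) * inner (cs ! j) (T (cs ! k))) = inner (bs ! i) (T (cs ! k))"
      using parseval'[OF mem(1)[OF ik(1)], of "T (cs ! k)"] by (simp add: inner_commute)
    show "(matrix_in bs T * Q) $$ (i, k) = (Q * matrix_in cs T) $$ (i, k)"
      using ik 1 2 by (simp add: Q_def matrix_in_def len scalar_prod_def lessThan_atLeast0)
  qed (auto simp: Q_def matrix_in_def len)
  have "Determinant.det (transpose_mat Q) * Determinant.det Q = 1"
    using det_mult[of "transpose_mat Q" n Q] QQ carr by simp
  then have "Determinant.det Q \<noteq> 0" by auto
  moreover have "Determinant.det (matrix_in bs T) * Determinant.det Q
      = Determinant.det Q * Determinant.det (matrix_in cs T)"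
    using arg_cong[OF comm, of Determinant.det]
    by (simp only: det_mult[OF carr(2) carr(1)] det_mult[OF carr(1) carr(3)])
  ultimately have "Determinant.det (matrix_in cs T) = Determinant.det (matrix_in bs T)"
    by (metis mult.commute mult_cancel_left)
  then show ?thesis
    unfolding det_on_def cs_def .
qed

lemma adjoint_on:
  assumes S: "subspace S" and B: "linear B"
  shows "adjoint_on S B y \<in> S" "\<And>v. v \<in> S \<Longrightarrow> inner (B v) y = inner v (adjoint_on S B y)"
proof -
  obtain bs where bs: "orthonormal_basis_list S bs"
    using orthonormal_basis_list_exists[OF S] by blast
  define x where "x = (\<Sum>i<length bs. inner (B (bs ! i)) y *\<^sub>R bs ! i)"
  have "x \<in> S"
    using bs S unfolding x_def
    by (intro subspace_sum subspace_scale) (auto simp: orthonormal_basis_list_def)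
  moreover have "inner (B v) y = inner v x" if "v \<in> S" for v
  proof -
    have "B v = B (\<Sum>i<length bs. inner (bs ! i) v *\<^sub>R bs ! i)"
      using orthonormal_basis_list_expand[OF S bs that] by simp
    also have "\<dots> = (\<Sum>i<length bs. inner (bs ! i) v *\<^sub>R B (bs ! i))"
      using B by (simp add: linear_sum linear_cmul)
    finally show ?thesis
      by (simp add: x_def inner_sum_left inner_sum_right inner_commute mult.commute)
  qed
  moreover have "z = x" if "z \<in> S" "\<forall>v\<in>S. inner (B v) y = inner v z" for z
  proof -
    have zx: "z - x \<in> S" using S that(1) \<open>x \<in> S\<close> by (simp add: subspace_diff)
    then have "inner (z - x) z = inner (z - x) x"
      using that(2) calculation(2) by metis
    then have "inner (z - x) (z - x) = 0" by (simp add: inner_diff_right)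
    then show ?thesis by simp
  qed
  ultimately have "\<exists>!x. x \<in> S \<and> (\<forall>v\<in>S. inner (B v) y = inner v x)" by blast
  from theI'[OF this]
  have "adjoint_on S B y \<in> S \<and> (\<forall>v\<in>S. inner (B v) y = inner v (adjoint_on S B y))"
    unfolding adjoint_on_def .
  then show "adjoint_on S B y \<in> S"
    "\<And>v. v \<in> S \<Longrightarrow> inner (B v) y = inner v (adjoint_on S B y)"
    by blast+
qed

end

theory Submission
  imports Defs
begin

text \<open>
  For a gaussian input \<open>A\<close> put \<open>M A = \<Sum>j. p j B\<^sub>j\<^sup>* A\<^sub>j B\<^sub>j\<close> and let \<open>ratio A\<close> be the square of the
  gaussian Brascamp--Lieb expression at \<open>A\<close>. An extremiser is an input that maximises \<open>ratio\<close>,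
  provided that \<open>M A'\<close> is non-degenerate for every input \<open>A'\<close> (\<open>extremiser_iff\<close>).

  First-order condition. Perturbing one \<open>A\<^sub>j\<close> of an extremiser by the rank-one form
  \<open>t (A\<^sub>j f)\<otimes>(A\<^sub>j f)\<close> multiplies both determinants by explicit factors. Since \<open>t = 0\<close> is a maximum,
  \<open>A\<^sub>j\<^sup>-\<^sup>1 = B\<^sub>j (M A)\<^sup>-\<^sup>1 B\<^sub>j\<^sup>*\<close> on \<open>Hj j\<close>. It is used in coordinates: if \<open>E\<close> is an \<open>M A\<close>-orthonormal
  basis of \<open>H\<close>, then \<open>\<Sum>e\<in>E. \<langle>A\<^sub>j f, B\<^sub>j e\<rangle>\<^sup>2 = \<langle>A\<^sub>j f, f\<rangle>\<close> (\<open>extremiser_isotropic\<close>). Expanding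
  \<open>dim V\<close> as the \<open>M A\<close>-trace over a basis adapted to a subspace \<open>V\<close> gives an exact formula for
  \<open>(\<Sum>j. p j dim (B\<^sub>j V)) - dim V\<close> as a weighted sum of squares (\<open>defect_formula\<close>). Feasibility follows
  at once. If \<open>V\<close> is critical the squares vanish, that is, \<open>B\<^sub>j\<close> maps the \<open>M A\<close>-complement of \<open>V\<close> into the
  \<open>A\<^sub>j\<close>-complement of \<open>B\<^sub>j V\<close>. Everything then splits, and doubling every \<open>A\<^sub>j\<close> on \<open>B\<^sub>j V\<close> only gives a
  second, non-proportional extremiser (\<open>critical_imp_not_unique\<close>).

  Uniqueness. Given two extremisers, diagonalise the forms \<open>M A\<close>, \<open>M A'\<close> simultaneously, with
  eigenvalues \<open>\<mu>\<close>, and likewise \<open>A\<^sub>j\<close>, \<open>A'\<^sub>j\<close>, with eigenvalues \<open>\<nu>\<close>. Each \<open>\<mu>\<close> is a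
  weighted mean of the \<open>\<nu>\<close>, and by the first-order condition the weights of a \<open>\<nu>\<close> belonging to \<open>A'\<^sub>j\<close> add up
  to \<open>p j\<close>, so Jensen's inequality for the logarithm gives \<open>ratio A' \<le> ratio A\<close>. Equality forces \<open>B\<^sub>j\<close> to map eigenvectors for \<open>\<mu>\<close> to eigenvectors for \<open>\<nu> = \<mu>\<close>, so
  the defect formula makes each eigenspace of the pair \<open>M A\<close>, \<open>M A'\<close> critical, unless it is all of \<open>H\<close>
  (\<open>simple_imp_proportional\<close>).

  Existence. Take a maximising sequence, rescaled so that the largest eigenvalue of \<open>M A\<close> is \<open>1\<close>.
  Along a subsequence the entries of the \<open>A\<^sub>j\<close> and the eigenbases of \<open>M A\<close> converge. For
  the limit basis \<open>f\<close>, ordered by increasing eigenvalues \<open>\<mu>\<close>, choose greedily for every \<open>j\<close> a set \<open>I\<^sub>j\<close> of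
  indices such that the vectors \<open>B\<^sub>j f\<^sub>i\<close> with \<open>i \<in> I\<^sub>j\<close> are a basis of \<open>Hj j\<close>. As
  \<open>\<langle>A\<^sub>j B\<^sub>j e\<^sub>i, B\<^sub>j e\<^sub>i\<rangle> \<le> \<mu>\<^sub>i / p j\<close> for the eigenvectors \<open>e\<^sub>i\<close> of \<open>M A\<close>, the determinant of \<open>A\<^sub>j\<close> is bounded
  by a multiple of \<open>\<Prod>i\<in>I\<^sub>j. \<mu>\<^sub>i\<close>. The flag spanned by \<open>f\<close> satisfies the dimension
  condition strictly at every intermediate step, because the datum is simple, so summation by parts
  turns these bounds into \<open>ratio A \<le> K \<mu>\<^sub>0 powr s\<close> with \<open>s > 0\<close> (\<open>normalised_ratio_bound\<close>). A maximising sequence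
  therefore cannot degenerate, and its limit is an extremiser (\<open>feasible_simple_imp_extremiser\<close>).
\<close>

section \<open>Forms on a subspace and simultaneous diagonalisation\<close>

lemma eq_in_subspaceI:
  assumes "subspace S" "x \<in> S" "y \<in> S" "\<And>v. v \<in> S \<Longrightarrow> inner x v = inner y v"
  shows "x = y"
proof -
  have "x - y \<in> S" using assms by (simp add: subspace_diff)
  then have "inner (x - y) (x - y) = 0" using assms(4)[of "x - y"] by (simp add: inner_diff_left)
  then show ?thesis by simp
qed

text \<open>
  An operator \<open>T\<close> is viewed as the bilinear form \<open>\<langle>T x, y\<rangle>\<close>. Unlike self-adjointness, symmetry of the
  form does not ask \<open>T\<close> to preserve \<open>S\<close>, so it is inherited by smaller subspaces.
\<close>

definition symmetric_form :: "'a::euclidean_space set \<Rightarrow> ('a \<Rightarrow> 'a) \<Rightarrow> bool" where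
  "symmetric_form S T \<longleftrightarrow> linear T \<and> (\<forall>x\<in>S. \<forall>y\<in>S. inner (T x) y = inner x (T y))"

definition positive_form :: "'a::euclidean_space set \<Rightarrow> ('a \<Rightarrow> 'a) \<Rightarrow> bool" where
  "positive_form S T \<longleftrightarrow> symmetric_form S T \<and> (\<forall>x\<in>S. x \<noteq> 0 \<longrightarrow> inner (T x) x > 0)"

text \<open>
  A basis of \<open>S\<close> that is orthonormal for the form of \<open>P\<close>. It is a set rather than a list, so that
  adapted bases are unions and eigenvalues are functions on the basis.
\<close>

definition basis_wrt :: "('a::euclidean_space \<Rightarrow> 'a) \<Rightarrow> 'a set \<Rightarrow> 'a set \<Rightarrow> bool" where
  "basis_wrt P S E \<longleftrightarrow> finite E \<and> E \<subseteq> S \<and> card E = dim S \<and>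
     (\<forall>x\<in>E. \<forall>y\<in>E. inner (P x) y = (if x = y then 1 else 0))"

lemma symmetric_formD:
  assumes "symmetric_form S T"
  shows "linear T" "\<And>x y. x \<in> S \<Longrightarrow> y \<in> S \<Longrightarrow> inner (T x) y = inner (T y) x"
  using assms by (auto simp: symmetric_form_def inner_commute)

lemma symmetric_form_mono: "symmetric_form S T \<Longrightarrow> V \<subseteq> S \<Longrightarrow> symmetric_form V T"
  by (auto simp: symmetric_form_def)

lemma positive_form_mono: "positive_form S T \<Longrightarrow> V \<subseteq> S \<Longrightarrow> positive_form V T"
  by (auto simp: positive_form_def symmetric_form_def)

lemma positive_formD:
  assumes "positive_form S T"
  shows "symmetric_form S T" "linear T" "\<And>x y. x \<in> S \<Longrightarrow> y \<in> S \<Longrightarrow> inner (T x) y = inner (T y) x"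
    "\<And>x. x \<in> S \<Longrightarrow> x \<noteq> 0 \<Longrightarrow> inner (T x) x > 0" "\<And>x. x \<in> S \<Longrightarrow> inner (T x) x \<ge> 0"
proof -
  show "symmetric_form S T" using assms by (simp add: positive_form_def)
  then show "linear T" "\<And>x y. x \<in> S \<Longrightarrow> y \<in> S \<Longrightarrow> inner (T x) y = inner (T y) x"
    using symmetric_formD by blast+
  show 1: "\<And>x. x \<in> S \<Longrightarrow> x \<noteq> 0 \<Longrightarrow> inner (T x) x > 0" using assms by (simp add: positive_form_def)
  show "inner (T x) x \<ge> 0" if "x \<in> S" for x
    using 1[OF that] by (cases "x = 0") auto
qed

lemma positive_form_inner: "positive_form S (\<lambda>x. x)"
  by (auto simp: positive_form_def symmetric_form_def linear_ident)

lemma form_Cauchy_Schwarz: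
  assumes S: "subspace S" and T: "symmetric_form S T" and nn: "\<And>x. x \<in> S \<Longrightarrow> inner (T x) x \<ge> 0"
    and x: "x \<in> S" and y: "y \<in> S"
  shows "(inner (T x) y)\<^sup>2 \<le> inner (T x) x * inner (T y) y"
proof -
  note lin = symmetric_formD(1)[OF T]
  define a b c where "a = inner (T x) x" and "b = inner (T x) y" and "c = inner (T y) y"
  have q: "0 \<le> a + 2 * t * b + t\<^sup>2 * c" for t
  proof -
    have "x + t *\<^sub>R y \<in> S" using S x y by (simp add: subspace_add subspace_scale)
    then have "0 \<le> inner (T (x + t *\<^sub>R y)) (x + t *\<^sub>R y)" by (rule nn)
    also have "\<dots> = a + 2 * t * b + t\<^sup>2 * c"
      using symmetric_formD(2)[OF T x y]
      by (simp add: lin linear_add linear_cmul a_def b_def c_def power2_eq_square algebra_simps)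
    finally show ?thesis .
  qed
  have c0: "c \<ge> 0" using nn[OF y] by (simp add: c_def)
  have "b\<^sup>2 \<le> a * c"
  proof (cases "c = 0")
    case True
    have "b = 0"
    proof (rule ccontr)
      assume "b \<noteq> 0"
      then show False using q[of "- (a + 1) / (2 * b)"] True by (simp add: field_simps)
    qed
    then show ?thesis using True by simp
  next
    case False
    then have "c > 0" using c0 by simp
    have "0 \<le> a + 2 * (- b / c) * b + (- b / c)\<^sup>2 * c" by (rule q)
    also have "\<dots> = (a * c - b\<^sup>2) / c" using \<open>c > 0\<close> by (simp add: field_simps power2_eq_square)
    finally show ?thesis using \<open>c > 0\<close> by (simp add: field_simps zero_le_divide_iff)
  qed
  then show ?thesis by (simp add: a_def b_def c_def)
qed

lemma orthonormal_independent:
  assumes P: "linear P" and fin: "finite E"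
    and on: "\<And>x y. x \<in> E \<Longrightarrow> y \<in> E \<Longrightarrow> inner (P x) y = (if x = y then 1 else 0)"
  shows "independent E"
proof
  assume "dependent E"
  then obtain u v where v: "v \<in> E" "u v \<noteq> 0" and u: "(\<Sum>w\<in>E. u w *\<^sub>R w) = 0"
    using dependent_finite[OF fin] by auto
  have "0 = inner (P v) (\<Sum>w\<in>E. u w *\<^sub>R w)" using u by simp
  also have "\<dots> = (\<Sum>w\<in>E. u w * (if v = w then 1 else 0))"
    using on v by (simp add: inner_sum_right)
  also have "\<dots> = u v" using fin v by (simp add: if_distrib cong: if_cong)
  finally show False using v by simp
qed

lemma basis_wrtD:
  assumes S: "subspace S" and P: "positive_form S P" and E: "basis_wrt P S E"
  shows "finite E" "E \<subseteq> S" "card E = dim S" "\<And>e. e \<in> E \<Longrightarrow> e \<in> S"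
    "\<And>x y. x \<in> E \<Longrightarrow> y \<in> E \<Longrightarrow> inner (P x) y = (if x = y then 1 else 0)"
    "independent E" "span E = S"
    "\<And>x. x \<in> S \<Longrightarrow> (\<Sum>e\<in>E. inner (P x) e *\<^sub>R e) = x"
proof -
  show fin: "finite E" and sub: "E \<subseteq> S" and cd: "card E = dim S" "\<And>e. e \<in> E \<Longrightarrow> e \<in> S"
    and on: "\<And>x y. x \<in> E \<Longrightarrow> y \<in> E \<Longrightarrow> inner (P x) y = (if x = y then 1 else 0)"
    using E by (auto simp: basis_wrt_def)
  show ind: "independent E"
    using orthonormal_independent[OF positive_formD(2)[OF P] fin] on by blast
  then have "S \<subseteq> span E" using card_eq_dim[OF sub cd(1) fin] by blast
  then show sp: "span E = S" using span_minimal[OF sub S] by blast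
  show "(\<Sum>e\<in>E. inner (P x) e *\<^sub>R e) = x" if "x \<in> S" for x
  proof -
    have "x \<in> span E" using that sp by simp
    then obtain c where c: "x = (\<Sum>e\<in>E. c e *\<^sub>R e)" using span_finite[OF fin] by auto
    have "inner (P x) e = c e" if e: "e \<in> E" for e
    proof -
      have "inner (P x) e = (\<Sum>f\<in>E. c f * inner (P f) e)"
        using c positive_formD(2)[OF P] by (simp add: linear_sum linear_cmul inner_sum_left)
      also have "\<dots> = (\<Sum>f\<in>E. if f = e then c f else 0)"
        using on e by (intro sum.cong) auto
      also have "\<dots> = c e" using fin e by simp
      finally show ?thesis .
    qed
    then show ?thesis using c by simp
  qed
qed

lemma basis_wrtI:
  assumes P: "linear P" and fin: "finite E" and sub: "E \<subseteq> S" and sp: "S \<subseteq> span E"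
    and on: "\<And>x y. x \<in> E \<Longrightarrow> y \<in> E \<Longrightarrow> inner (P x) y = (if x = y then 1 else 0)"
  shows "basis_wrt P S E"
proof -
  have "independent E" using orthonormal_independent[OF P fin] on by blast
  then have "card E = dim S" using basis_card_eq_dim[OF sub sp] by blast
  then show ?thesis using fin sub on by (auto simp: basis_wrt_def)
qed

lemma Parseval_wrt:
  assumes S: "subspace S" and P: "positive_form S P" and E: "basis_wrt P S E"
    and x: "x \<in> S" and T: "linear T"
  shows "inner (T x) y = (\<Sum>e\<in>E. inner (P x) e * inner (T e) y)"
proof -
  have "inner (T x) y = inner (T (\<Sum>e\<in>E. inner (P x) e *\<^sub>R e)) y"
    using basis_wrtD(8)[OF S P E x] by simp
  also have "\<dots> = (\<Sum>e\<in>E. inner (P x) e * inner (T e) y)"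
    using T by (simp add: linear_sum linear_cmul inner_sum_left)
  finally show ?thesis .
qed

text \<open>
  A vector \<open>u\<close> maximising the Rayleigh quotient \<open>\<langle>T x, x\<rangle> / \<langle>P x, x\<rangle>\<close>, with maximum \<open>l\<close>, makes \<open>l P - T\<close>
  non-negative with value \<open>0\<close> at \<open>u\<close>. By Cauchy--Schwarz \<open>u\<close> lies in the radical of \<open>l P - T\<close>, so
  the \<open>P\<close>-complement of \<open>u\<close> is also a \<open>T\<close>-complement, and induction on the dimension applies.
\<close>

lemma simultaneous_diagonalisation:
  assumes "subspace S" "positive_form S P" "symmetric_form S T"
  shows "\<exists>E. basis_wrt P S E \<and> (\<forall>x\<in>E. \<forall>y\<in>E. x \<noteq> y \<longrightarrow> inner (T x) y = 0)"
  using assms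
proof (induction "dim S" arbitrary: S)
  case 0
  then have "S = {0}" using subspace_0 by fastforce
  then show ?case by (intro exI[of _ "{}"]) (auto simp: basis_wrt_def)
next
  case (Suc n)
  note S = \<open>subspace S\<close> and P = \<open>positive_form S P\<close> and T = \<open>symmetric_form S T\<close>
  note linP = positive_formD(2)[OF P] and linT = symmetric_formD(1)[OF T]
  have contP: "continuous_on X P" and contT: "continuous_on X T" for X
    using linP linT by (simp_all add: linear_continuous_on linear_linear)
  define K where "K = sphere 0 1 \<inter> S"
  have comp: "compact K" unfolding K_def by (intro compact_Int_closed compact_sphere closed_subspace S)
  obtain z where z: "z \<in> S" "z \<noteq> 0" using Suc(2) S
    by (metis dim_eq_0 nat.distinct(1) subsetI singleton_iff)
  then have "(1 / norm z) *\<^sub>R z \<in> K" using S by (simp add: K_def subspace_scale)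
  then have ne: "K \<noteq> {}" by blast
  have Kpos: "inner (P x) x > 0" if "x \<in> K" for x
  proof -
    have "x \<noteq> 0" "x \<in> S" using that by (auto simp: K_def)
    then show ?thesis using positive_formD(4)[OF P] by blast
  qed
  then have cont: "continuous_on K (\<lambda>x. inner (T x) x / inner (P x) x)"
    by (intro continuous_intros contP contT) fastforce
  obtain u0 where u0: "u0 \<in> K"
    and max: "\<And>x. x \<in> K \<Longrightarrow> inner (T x) x / inner (P x) x \<le> inner (T u0) u0 / inner (P u0) u0"
    using continuous_attains_sup[OF comp ne cont] by blast
  define l where "l = inner (T u0) u0 / inner (P u0) u0"
  define u where "u = (1 / sqrt (inner (P u0) u0)) *\<^sub>R u0"
  have uS: "u \<in> S" using u0 S by (simp add: u_def K_def subspace_scale)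
  have Pu: "inner (P u) u = 1" using Kpos[OF u0]
    by (simp add: u_def linP linear_cmul)
  have Tu: "inner (T u) u = l" using Kpos[OF u0]
    by (simp add: u_def linT linear_cmul l_def)
  define R where "R = (\<lambda>x. l *\<^sub>R P x - T x)"
  have R: "symmetric_form S R"
    using T positive_formD(1)[OF P] unfolding symmetric_form_def R_def
    by (auto simp: inner_diff_left inner_diff_right linear_compose_sub linear_compose_scale_right)
  have Rnn: "inner (R x) x \<ge> 0" if x: "x \<in> S" for x
  proof (cases "x = 0")
    case True then show ?thesis by simp
  next
    case False
    define y where "y = (1 / norm x) *\<^sub>R x"
    have "y \<in> K" using x False S by (simp add: y_def K_def subspace_scale)
    from max[OF this] have "inner (T x) x / inner (P x) x \<le> l" using False
      by (simp add: y_def linP linT linear_cmul l_def)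
    then show ?thesis using positive_formD(4)[OF P x False]
      by (simp add: R_def inner_diff_left field_simps)
  qed
  have Ru: "inner (R u) u = 0" by (simp add: R_def inner_diff_left Pu Tu)
  have Tu0: "inner (T u) v = 0" if "v \<in> S" "inner (P u) v = 0" for v
  proof -
    have "(inner (R u) v)\<^sup>2 \<le> inner (R u) u * inner (R v) v"
      by (rule form_Cauchy_Schwarz[OF S R Rnn uS that(1)])
    then have "inner (R u) v = 0" using Ru by simp
    then show ?thesis using that(2) by (simp add: R_def inner_diff_left)
  qed
  define S' where "S' = {v \<in> S. inner (P u) v = 0}"
  have S': "subspace S'"
    using S by (auto simp: S'_def subspace_def inner_add_right)
  have "S' \<subseteq> S" by (auto simp: S'_def)
  have split: "x - inner (P u) x *\<^sub>R u \<in> S'" if "x \<in> S" for x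
    using that S uS Pu by (auto simp: S'_def inner_diff_right subspace_diff subspace_scale)
  have "S \<subseteq> span (insert u S')"
  proof
    fix x assume "x \<in> S"
    then have "x - inner (P u) x *\<^sub>R u \<in> span S'" using split span_base by blast
    then show "x \<in> span (insert u S')" by (auto simp: span_breakdown_eq)
  qed
  moreover have "span (insert u S') \<subseteq> S"
    using uS S by (intro span_minimal) (auto simp: S'_def)
  ultimately have "dim S = dim (insert u S')" by (metis dim_span subset_antisym)
  moreover have "u \<notin> span S'" using Pu S' by (auto simp: span_eq_iff[THEN iffD2] S'_def)
  ultimately have "n = dim S'" using Suc(2) by (simp add: dim_insert)
  from Suc(1)[OF this S' positive_form_mono[OF P \<open>S' \<subseteq> S\<close>] symmetric_form_mono[OF T \<open>S' \<subseteq> S\<close>]]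
  obtain E where E: "basis_wrt P S' E" and ET: "\<And>x y. x \<in> E \<Longrightarrow> y \<in> E \<Longrightarrow> x \<noteq> y \<Longrightarrow> inner (T x) y = 0"
    by blast
  note ED = basis_wrtD[OF S' positive_form_mono[OF P \<open>S' \<subseteq> S\<close>] E]
  have Eu: "inner (P u) e = 0" "inner (P e) u = 0" "inner (T u) e = 0" "inner (T e) u = 0" "e \<noteq> u"
    if "e \<in> E" for e
  proof -
    have e: "e \<in> S" "inner (P u) e = 0" using ED(4)[OF that] by (auto simp: S'_def)
    show "inner (P u) e = 0" "inner (P e) u = 0" "inner (T u) e = 0" "inner (T e) u = 0" "e \<noteq> u"
      using e Tu0[OF e] positive_formD(3)[OF P e(1) uS] symmetric_formD(2)[OF T e(1) uS] Pu by auto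
  qed
  have "basis_wrt P S (insert u E)"
  proof (rule basis_wrtI[OF linP])
    show "finite (insert u E)" using ED(1) by simp
    show "insert u E \<subseteq> S" using ED(2) uS \<open>S' \<subseteq> S\<close> by blast
    show "S \<subseteq> span (insert u E)"
    proof
      fix x assume "x \<in> S"
      then have "x - inner (P u) x *\<^sub>R u \<in> span E" using split ED(7) by blast
      then show "x \<in> span (insert u E)" by (auto simp: span_breakdown_eq)
    qed
    show "inner (P x) y = (if x = y then 1 else 0)" if "x \<in> insert u E" "y \<in> insert u E" for x y
      using that Eu Pu ED(5) by auto
  qed
  then show ?case using ET Eu by (intro exI[of _ "insert u E"]) auto
qed

lemma basis_wrt_exists:
  assumes "subspace S" "positive_form S P"
  shows "\<exists>E. basis_wrt P S E"
  using simultaneous_diagonalisation[OF assms positive_formD(1)[OF assms(2)]] by blast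

lemma basis_wrt_extend:
  assumes S: "subspace S" and P: "positive_form S P" and V: "subspace V" "V \<subseteq> S"
    and E: "basis_wrt P V E"
  shows "\<exists>E'. basis_wrt P S (E \<union> E') \<and> E \<inter> E' = {}"
proof -
  note ED = basis_wrtD[OF V(1) positive_form_mono[OF P V(2)] E]
  note linP = positive_formD(2)[OF P]
  define V' where "V' = {x\<in>S. \<forall>e\<in>E. inner (P e) x = 0}"
  have V': "subspace V'" "V' \<subseteq> S" using S by (auto simp: V'_def subspace_def inner_add_right)
  obtain E' where E': "basis_wrt P V' E'" using basis_wrt_exists[OF V'(1) positive_form_mono[OF P V'(2)]] by blast
  note ED' = basis_wrtD[OF V'(1) positive_form_mono[OF P V'(2)] E']
  have cross: "inner (P e) f = 0" "inner (P f) e = 0" if "e \<in> E" "f \<in> E'" for e f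
  proof -
    have f: "f \<in> S" "inner (P e) f = 0" using ED'(4)[OF that(2)] that(1) by (auto simp: V'_def)
    moreover have "e \<in> S" using ED(4)[OF that(1)] V(2) by blast
    ultimately show "inner (P e) f = 0" "inner (P f) e = 0" using positive_formD(3)[OF P] by metis+
  qed
  have disj: "E \<inter> E' = {}" using cross(1) ED(5) by fastforce
  have "basis_wrt P S (E \<union> E')"
  proof (rule basis_wrtI[OF linP])
    show "finite (E \<union> E')" using ED(1) ED'(1) by simp
    show "E \<union> E' \<subseteq> S" using ED(2) ED'(2) V V' by blast
    show "inner (P x) y = (if x = y then 1 else 0)" if "x \<in> E \<union> E'" "y \<in> E \<union> E'" for x y
      using that ED(5) ED'(5) cross disj by auto
    show "S \<subseteq> span (E \<union> E')"
    proof
      fix x assume x: "x \<in> S"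
      define z where "z = (\<Sum>e\<in>E. inner (P e) x *\<^sub>R e)"
      have zE: "z \<in> span E" unfolding z_def by (intro span_sum span_scale span_base)
      then have "z \<in> V" using ED(7) by simp
      have "inner (P e) (x - z) = 0" if "e \<in> E" for e
      proof -
        have "inner (P e) z = (\<Sum>f\<in>E. inner (P f) x * (if e = f then 1 else 0))"
          using that ED(5) by (simp add: z_def inner_sum_right)
        also have "\<dots> = inner (P e) x" using that ED(1) by (simp add: if_distrib cong: if_cong)
        finally show ?thesis by (simp add: inner_diff_right)
      qed
      then have "x - z \<in> V'" using x S V(2) \<open>z \<in> V\<close> by (auto simp: V'_def intro: subspace_diff)
      then have "x - z \<in> span E'" using ED'(7) by simp
      then have "z + (x - z) \<in> span (E \<union> E')"
        using zE by (intro span_add) (auto intro: subsetD[OF span_mono])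
      then show "x \<in> span (E \<union> E')" by simp
    qed
  qed
  then show ?thesis using disj by blast
qed

section \<open>Determinants of forms\<close>

lemma det_on_cong:
  assumes S: "subspace S" and eq: "\<And>x. x \<in> S \<Longrightarrow> T x = T' x"
  shows "det_on S T = det_on S T'"
proof -
  define bs where "bs = (SOME bs. orthonormal_basis_list S bs)"
  have "orthonormal_basis_list S bs"
    unfolding bs_def using someI_ex[OF orthonormal_basis_list_exists[OF S]] .
  then have "bs ! i \<in> S" if "i < length bs" for i
    using that nth_mem by (fastforce simp: orthonormal_basis_list_def)
  then have "matrix_in bs T = matrix_in bs T'"
    using eq by (intro eq_matI) (auto simp: matrix_in_def)
  then show ?thesis by (simp add: det_on_def bs_def)
qed

text \<open>
  A common shape for \<open>det_on\<close> (\<open>x\<close> an orthonormal basis, \<open>y\<close> its image) and for the determinant of a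
  change of basis.
\<close>

definition gram :: "nat \<Rightarrow> (nat \<Rightarrow> 'a::real_inner) \<Rightarrow> (nat \<Rightarrow> 'a) \<Rightarrow> real" where
  "gram n x y = Determinant.det (Matrix.mat n n (\<lambda>(i, k). inner (x i) (y k)))"

lemma gram_Leibniz:
  "gram n x y = (\<Sum>\<pi> | \<pi> permutes {0..<n}. signof \<pi> * (\<Prod>i = 0..<n. inner (x i) (y (\<pi> i))))"
proof -
  have "(\<Prod>i = 0..<n. Matrix.mat n n (\<lambda>(i, k). inner (x i) (y k)) $$ (i, \<pi> i))
      = (\<Prod>i = 0..<n. inner (x i) (y (\<pi> i)))" if "\<pi> permutes {0..<n}" for \<pi>
    using permutes_in_image[OF that] by (intro prod.cong) auto
  then show ?thesis unfolding gram_def by (subst det_def'[of _ n]) auto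
qed

lemma gram_orthogonal:
  assumes "\<And>i k. i < n \<Longrightarrow> k < n \<Longrightarrow> i \<noteq> k \<Longrightarrow> inner (x i) (y k) = 0"
  shows "gram n x y = (\<Prod>i<n. inner (x i) (y i))"
proof -
  define A where "A = Matrix.mat n n (\<lambda>(i, k). inner (x i) (y k))"
  have "upper_triangular A" using assms by (auto simp: A_def upper_triangular_def)
  moreover have "A \<in> carrier_mat n n" by (simp add: A_def)
  ultimately have "Determinant.det A = prod_list (diag_mat A)" by (rule det_upper_triangular)
  also have "\<dots> = (\<Prod>i<n. inner (x i) (y i))"
    by (simp add: diag_mat_def A_def prod.list_conv_set_nth lessThan_atLeast0)
  finally show ?thesis by (simp add: gram_def A_def)
qed

text \<open>
  The matrix of the form in an arbitrary family \<open>es\<close> is \<open>C\<^sup>T D C\<close>, where \<open>D\<close> is its matrix in an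
  orthonormal basis and \<open>C\<close> holds the coordinates of the family.
\<close>

lemma det_on_gram:
  assumes S: "subspace S" and T: "linear T" "T ` S \<subseteq> S"
    and bs: "orthonormal_basis_list S bs" and es: "\<And>i. i < dim S \<Longrightarrow> es i \<in> S"
  shows "gram (dim S) es (\<lambda>k. T (es k)) = det_on S T * (gram (dim S) (nth bs) es)\<^sup>2"
proof -
  define n where "n = dim S"
  have len: "length bs = n" using bs by (simp add: orthonormal_basis_list_def n_def)
  define C where "C = Matrix.mat n n (\<lambda>(i, k). inner (bs ! i) (es k))"
  define D where "D = matrix_in bs T"
  have carr: "C \<in> carrier_mat n n" "D \<in> carrier_mat n n"
    by (auto simp: C_def D_def matrix_in_def len)
  have expand: "inner x y = (\<Sum>j<n. inner (bs ! j) x * inner (bs ! j) y)" if "x \<in> S" for x y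
  proof -
    have "inner x y = inner (\<Sum>i<n. inner (bs ! i) x *\<^sub>R bs ! i) y"
      using orthonormal_basis_list_expand[OF S bs that] len by simp
    then show ?thesis by (simp add: inner_sum_left)
  qed
  have DC: "(D * C) $$ (i, k) = inner (bs ! i) (T (es k))" if "i < n" "k < n" for i k
  proof -
    have "T (es k) = T (\<Sum>j<n. inner (bs ! j) (es k) *\<^sub>R bs ! j)"
      using orthonormal_basis_list_expand[OF S bs es[of k]] len that by (simp add: n_def)
    also have "\<dots> = (\<Sum>j<n. inner (bs ! j) (es k) *\<^sub>R T (bs ! j))"
      using T(1) by (simp add: linear_sum linear_cmul)
    finally show ?thesis using that
      by (simp add: C_def D_def matrix_in_def len scalar_prod_def lessThan_atLeast0 inner_sum_right mult.commute)
  qed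
  have "Matrix.mat n n (\<lambda>(i, k). inner (es i) (T (es k))) = transpose_mat C * (D * C)"
  proof (rule eq_matI)
    fix i k assume "i < dim_row (transpose_mat C * (D * C))" "k < dim_col (transpose_mat C * (D * C))"
    then have ik: "i < n" "k < n" by (auto simp: C_def)
    have "(transpose_mat C * (D * C)) $$ (i, k) = (\<Sum>j<n. inner (bs ! j) (es i) * (D * C) $$ (j, k))"
      using ik carr by (simp add: C_def scalar_prod_def lessThan_atLeast0)
    also have "\<dots> = (\<Sum>j<n. inner (bs ! j) (es i) * inner (bs ! j) (T (es k)))"
      using ik DC by (intro sum.cong) auto
    also have "\<dots> = inner (es i) (T (es k))"
      using ik es by (intro expand[symmetric]) (simp add: n_def)
    finally show "Matrix.mat n n (\<lambda>(i, k). inner (es i) (T (es k))) $$ (i, k)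
      = (transpose_mat C * (D * C)) $$ (i, k)" using ik by simp
  qed (auto simp: C_def)
  then have "gram n es (\<lambda>k. T (es k)) = Determinant.det (transpose_mat C * (D * C))"
    by (simp add: gram_def)
  also have "\<dots> = Determinant.det C * (Determinant.det D * Determinant.det C)"
    using carr det_mult[of "transpose_mat C" n "D * C"] det_mult[of D n C] det_transpose[of C n] by simp
  also have "\<dots> = det_on S T * (gram n (nth bs) es)\<^sup>2"
    using det_on_eq[OF S T bs] by (simp add: C_def D_def gram_def power2_eq_square)
  finally show ?thesis by (simp add: n_def)
qed

text \<open>
  Computed in the basis \<open>E\<close>, both determinants acquire the same squared change-of-basis factor, and
  the matrix of \<open>P\<close> becomes the identity.
\<close>

lemma det_on_diagonal:
  assumes S: "subspace S" and P: "positive_form S P" "P ` S \<subseteq> S"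
    and T: "linear T" "T ` S \<subseteq> S" and E: "basis_wrt P S E"
    and diag: "\<And>x y. x \<in> E \<Longrightarrow> y \<in> E \<Longrightarrow> x \<noteq> y \<Longrightarrow> inner (T x) y = 0"
  shows "det_on S T = det_on S P * (\<Prod>e\<in>E. inner (T e) e)"
proof -
  note ED = basis_wrtD[OF S P(1) E]
  obtain bs where bs: "orthonormal_basis_list S bs" using orthonormal_basis_list_exists[OF S] by blast
  obtain es where es: "set es = E" "distinct es" using finite_distinct_list[OF ED(1)] by blast
  have len: "length es = dim S" using es ED(3) distinct_card by fastforce
  have mem: "es ! i \<in> E" if "i < dim S" for i using that es len nth_mem by auto
  have "gram (dim S) (nth es) (\<lambda>k. Q (es ! k)) = (\<Prod>e\<in>E. inner (Q e) e)"
    if "\<And>x y. x \<in> E \<Longrightarrow> y \<in> E \<Longrightarrow> x \<noteq> y \<Longrightarrow> inner (Q x) y = 0" for Q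
  proof -
    have "gram (dim S) (nth es) (\<lambda>k. Q (es ! k)) = (\<Prod>i<dim S. inner (es ! i) (Q (es ! i)))"
      using that mem es(2) len by (intro gram_orthogonal) (auto simp: inner_commute nth_eq_iff_index_eq)
    also have "\<dots> = (\<Prod>e\<in>E. inner e (Q e))"
      using es len bij_betw_nth[OF es(2), of "{..<dim S}" E]
      by (intro prod.reindex_bij_betw) auto
    finally show ?thesis by (simp add: inner_commute)
  qed
  from this[of T] this[of P] have
    "gram (dim S) (nth es) (\<lambda>k. T (es ! k)) = (\<Prod>e\<in>E. inner (T e) e)"
    "gram (dim S) (nth es) (\<lambda>k. P (es ! k)) = 1"
    using diag ED(5) by simp_all
  moreover have "gram (dim S) (nth es) (\<lambda>k. Q (es ! k)) = det_on S Q * (gram (dim S) (nth bs) (nth es))\<^sup>2"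
    if "linear Q" "Q ` S \<subseteq> S" for Q
    using det_on_gram[OF S that bs, of "nth es"] mem ED(4) by blast
  ultimately have
    "(\<Prod>e\<in>E. inner (T e) e) = det_on S T * (gram (dim S) (nth bs) (nth es))\<^sup>2"
    "1 = det_on S P * (gram (dim S) (nth bs) (nth es))\<^sup>2"
    using T P positive_formD(2)[OF P(1)] by metis+
  then show ?thesis by (metis (no_types, lifting) mult.assoc mult.commute mult.right_neutral)
qed

lemma det_on_id: "subspace S \<Longrightarrow> det_on S (\<lambda>x. x) = 1"
proof -
  assume S: "subspace S"
  obtain bs where bs: "orthonormal_basis_list S bs" using orthonormal_basis_list_exists[OF S] by blast
  have "matrix_in bs (\<lambda>x. x) = 1\<^sub>m (length bs)"
    using bs by (intro eq_matI) (auto simp: matrix_in_def orthonormal_basis_list_def)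
  then show ?thesis using det_on_eq[OF S linear_ident _ bs] by simp
qed

lemma det_on_nonneg_form:
  assumes S: "subspace S" and T: "symmetric_form S T" "T ` S \<subseteq> S"
    and nn: "\<And>x. x \<in> S \<Longrightarrow> inner (T x) x \<ge> 0"
  shows "det_on S T \<ge> 0" "det_on S T \<noteq> 0 \<longleftrightarrow> positive_form S T"
proof -
  obtain E where E: "basis_wrt (\<lambda>x. x) S E"
    and ET: "\<And>x y. x \<in> E \<Longrightarrow> y \<in> E \<Longrightarrow> x \<noteq> y \<Longrightarrow> inner (T x) y = 0"
    using simultaneous_diagonalisation[OF S positive_form_inner T(1)] by blast
  note ED = basis_wrtD[OF S positive_form_inner E]
  have det: "det_on S T = (\<Prod>e\<in>E. inner (T e) e)"
    using det_on_diagonal[OF S positive_form_inner _ symmetric_formD(1)[OF T(1)] T(2) E ET]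
    by (simp add: det_on_id[OF S])
  show "det_on S T \<ge> 0" unfolding det using nn ED(4) by (intro prod_nonneg) auto
  show "det_on S T \<noteq> 0 \<longleftrightarrow> positive_form S T"
  proof
    assume "positive_form S T"
    moreover have "e \<noteq> 0" if "e \<in> E" for e using ED(5)[OF that that] by auto
    ultimately have "inner (T e) e \<noteq> 0" if "e \<in> E" for e
      using positive_formD(4) ED(4) that by (metis order_less_irrefl)
    then show "det_on S T \<noteq> 0" using ED(1) by (simp add: det)
  next
    assume "det_on S T \<noteq> 0"
    then have pos: "inner (T e) e > 0" if "e \<in> E" for e
      using that nn[OF ED(4)[OF that]] ED(1) by (auto simp: det less_le)
    have "inner (T x) x > 0" if x: "x \<in> S" "x \<noteq> 0" for x
    proof -
      have "inner (T x) x = (\<Sum>e\<in>E. inner x e * inner (T e) x)"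
        using Parseval_wrt[OF S positive_form_inner E x(1) symmetric_formD(1)[OF T(1)]] .
      also have "\<dots> = (\<Sum>e\<in>E. inner (T e) e * (inner x e)\<^sup>2)"
      proof (intro sum.cong refl)
        fix e assume e: "e \<in> E"
        have "inner (T e) x = inner (T x) e" using symmetric_formD(2)[OF T(1)] x ED(4)[OF e] by blast
        also have "\<dots> = (\<Sum>f\<in>E. inner x f * inner (T f) e)"
          using Parseval_wrt[OF S positive_form_inner E x(1) symmetric_formD(1)[OF T(1)]] .
        also have "\<dots> = (\<Sum>f\<in>E. if f = e then inner x e * inner (T e) e else 0)"
          using ET e by (intro sum.cong) auto
        also have "\<dots> = inner x e * inner (T e) e" using ED(1) e by simp
        finally show "inner x e * inner (T e) x = inner (T e) e * (inner x e)\<^sup>2"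
          by (simp add: power2_eq_square)
      qed
      finally have eq: "inner (T x) x = (\<Sum>e\<in>E. inner (T e) e * (inner x e)\<^sup>2)" .
      have "\<exists>e\<in>E. inner x e \<noteq> 0"
      proof (rule ccontr)
        assume "\<not> ?thesis"
        then show False using ED(8)[OF x(1)] x(2) by simp
      qed
      then obtain e where e: "e \<in> E" "inner x e \<noteq> 0" by blast
      then have "0 < inner (T e) e * (inner x e)\<^sup>2" using pos by simp
      then show ?thesis unfolding eq using ED(1) e pos
        by (intro sum_pos2[of _ e]) (auto simp: less_imp_le)
    qed
    then show "positive_form S T" using T by (simp add: positive_form_def)
  qed
qed

lemma det_on_pos:
  assumes S: "subspace S" and T: "positive_form S T" "T ` S \<subseteq> S"
  shows "det_on S T > 0"
  using det_on_nonneg_form[OF S positive_formD(1)[OF T(1)] T(2) positive_formD(5)[OF T(1)]] T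
  by fastforce

text \<open>
  The matrix determinant lemma. In a basis diagonalising \<open>P\<close> and \<open>w \<otimes> w\<close> at once, \<open>w\<close> is orthogonal to all
  but at most one basis vector, so at most one factor of the determinant differs from \<open>1\<close>; the sum of squares is
  the same for every \<open>P\<close>-orthonormal basis, being the squared norm of \<open>w\<close> dual to \<open>P\<close>.
\<close>

lemma det_on_rank_one:
  assumes S: "subspace S" and P: "positive_form S P" "P ` S \<subseteq> S"
    and E: "basis_wrt P S E" and w: "w \<in> S"
  shows "det_on S (\<lambda>x. P x + (t * inner w x) *\<^sub>R w) = det_on S P * (1 + t * (\<Sum>e\<in>E. (inner w e)\<^sup>2))"
proof -
  note linP = positive_formD(2)[OF P(1)] and ED = basis_wrtD[OF S P(1) E]
  define R where "R = (\<lambda>x. inner w x *\<^sub>R w)"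
  have R: "symmetric_form S R"
    by (auto simp: symmetric_form_def R_def inner_commute inner_add_right scaleR_left_distrib intro!: linearI)
  obtain F where F: "basis_wrt P S F" and FR: "\<And>x y. x \<in> F \<Longrightarrow> y \<in> F \<Longrightarrow> x \<noteq> y \<Longrightarrow> inner (R x) y = 0"
    using simultaneous_diagonalisation[OF S P(1) R] by blast
  note FD = basis_wrtD[OF S P(1) F]
  \<comment> \<open>the vector representing \<open>w\<close> in the inner product of \<open>P\<close>\<close>
  define z where "z = (\<Sum>e\<in>E. inner w e *\<^sub>R e)"
  have zS: "z \<in> S" unfolding z_def using S ED(4) by (intro subspace_sum subspace_scale) auto
  have z: "inner (P z) x = inner w x" if x: "x \<in> S" for x
  proof -
    have "inner (P z) x = (\<Sum>e\<in>E. inner w e * inner (P x) e)"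
      unfolding z_def using linP positive_formD(3)[OF P(1) _ x] ED(4)
      by (simp add: linear_sum linear_cmul inner_sum_left)
    also have "\<dots> = inner w (\<Sum>e\<in>E. inner (P x) e *\<^sub>R e)"
      by (simp add: inner_sum_right mult.commute)
    also have "\<dots> = inner w x" using ED(8)[OF x] by simp
    finally show ?thesis .
  qed
  have "(\<Sum>e\<in>E. (inner w e)\<^sup>2) = inner w z"
    by (simp add: z_def inner_sum_right power2_eq_square)
  also have "\<dots> = inner (P z) z" using z[OF zS] by simp
  also have "\<dots> = (\<Sum>e\<in>F. inner (P z) e * inner (P e) z)"
    by (rule Parseval_wrt[OF S P(1) F zS linP])
  also have "\<dots> = (\<Sum>e\<in>F. (inner w e)\<^sup>2)"
    using FD(4) z positive_formD(3)[OF P(1) _ zS] by (simp add: power2_eq_square)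
  finally have sums: "(\<Sum>e\<in>E. (inner w e)\<^sup>2) = (\<Sum>e\<in>F. (inner w e)\<^sup>2)" .
  have FR': "inner w x * inner w y = 0" if "x \<in> F" "y \<in> F" "x \<noteq> y" for x y
    using FR[OF that] by (simp add: R_def)
  have "det_on S (\<lambda>x. P x + (t * inner w x) *\<^sub>R w)
      = det_on S P * (\<Prod>e\<in>F. inner (P e + (t * inner w e) *\<^sub>R w) e)"
  proof (rule det_on_diagonal[OF S P _ _ F])
    show "linear (\<lambda>x. P x + (t * inner w x) *\<^sub>R w)"
      using linP by (auto simp: linear_add linear_cmul inner_add_right algebra_simps intro!: linearI)
    show "(\<lambda>x. P x + (t * inner w x) *\<^sub>R w) ` S \<subseteq> S"
      using P(2) w S by (auto intro!: subspace_add subspace_scale)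
    show "inner (P x + (t * inner w x) *\<^sub>R w) y = 0" if "x \<in> F" "y \<in> F" "x \<noteq> y" for x y
      using FR'[OF that] FD(5) that by (simp add: inner_add_left)
  qed
  also have "(\<Prod>e\<in>F. inner (P e + (t * inner w e) *\<^sub>R w) e) = (\<Prod>e\<in>F. 1 + t * (inner w e)\<^sup>2)"
    using FD(5) by (intro prod.cong) (auto simp: inner_add_left power2_eq_square)
  also have "\<dots> = 1 + t * (\<Sum>e\<in>F. (inner w e)\<^sup>2)"
  proof (cases "\<exists>e0\<in>F. inner w e0 \<noteq> 0")
    case True
    then obtain e0 where e0: "e0 \<in> F" "inner w e0 \<noteq> 0" by blast
    then have 0: "inner w e = 0" if "e \<in> F - {e0}" for e using FR'[of e e0] that by auto
    show ?thesis using prod.remove[OF FD(1) e0(1), of "\<lambda>e. 1 + t * (inner w e)\<^sup>2"]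
      sum.remove[OF FD(1) e0(1), of "\<lambda>e. (inner w e)\<^sup>2"] 0 by simp
  next
    case False
    then show ?thesis by simp
  qed
  finally show ?thesis using sums by simp
qed

lemma det_on_scale:
  assumes S: "subspace S" and T: "linear T" "T ` S \<subseteq> S"
  shows "det_on S (\<lambda>x. c *\<^sub>R T x) = c ^ dim S * det_on S T"
proof -
  obtain bs where bs: "orthonormal_basis_list S bs" using orthonormal_basis_list_exists[OF S] by blast
  have "matrix_in bs (\<lambda>x. c *\<^sub>R T x) = c \<cdot>\<^sub>m matrix_in bs T"
    by (intro eq_matI) (auto simp: matrix_in_def)
  moreover have "linear (\<lambda>x. c *\<^sub>R T x)" "(\<lambda>x. c *\<^sub>R T x) ` S \<subseteq> S"
    using T S by (auto intro: subspace_scale linear_compose_scale_right)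
  moreover have "dim_col (matrix_in bs T) = dim S"
    using bs by (simp add: matrix_in_def orthonormal_basis_list_def)
  ultimately show ?thesis
    using det_on_eq[OF S T bs] det_on_eq[OF S _ _ bs, of "\<lambda>x. c *\<^sub>R T x"] by (simp add: det_smult)
qed

text \<open>
  Doubling the form \<open>P\<close> on the span of \<open>G\<close> while keeping it on the \<open>P\<close>-complement, spanned by \<open>G'\<close>.
\<close>

lemma double_form:
  assumes S: "subspace S" and P: "positive_form S P" "P ` S \<subseteq> S"
    and GG: "basis_wrt P S (G \<union> G')" "G \<inter> G' = {}"
  defines "T \<equiv> \<lambda>x. P x + (\<Sum>g\<in>G. inner (P g) x *\<^sub>R P g)"
  shows "positive_form S T" "T ` S \<subseteq> S"
    "g \<in> G \<Longrightarrow> T g = 2 *\<^sub>R P g" "g \<in> G' \<Longrightarrow> T g = P g"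
    "det_on S T = det_on S P * 2 ^ card G"
proof -
  note ED = basis_wrtD[OF S P(1) GG(1)] and linP = positive_formD(2)[OF P(1)]
  have finG: "finite G" "finite G'" using ED(1) by auto
  have form: "inner (T x) y = inner (P x) y + (\<Sum>g\<in>G. inner (P g) x * inner (P g) y)" for x y
    by (simp add: T_def inner_add_left inner_sum_left)
  have linT: "linear T"
    unfolding T_def
    by (intro linear_compose_add linP linear_compose_sum ballI linearI)
      (simp_all add: inner_add_right scaleR_left_distrib)
  show im: "T ` S \<subseteq> S"
  proof
    fix y assume "y \<in> T ` S"
    then obtain x where x: "x \<in> S" "y = T x" by blast
    have "P g \<in> S" if "g \<in> G" for g using that ED(4) P(2) by blast
    then show "y \<in> S" unfolding x(2) T_def using x(1) P(2) S
      by (intro subspace_add subspace_sum subspace_scale) auto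
  qed
  show "positive_form S T"
    unfolding positive_form_def symmetric_form_def
  proof (intro conjI linT ballI impI)
    fix x y assume "x \<in> S" "y \<in> S"
    then have "inner (T x) y = inner (T y) x"
      using positive_formD(3)[OF P(1)] by (simp add: form mult.commute)
    then show "inner (T x) y = inner x (T y)" by (simp add: inner_commute)
  next
    fix x assume "x \<in> S" "x \<noteq> 0"
    then have "inner (P x) x > 0" by (rule positive_formD(4)[OF P(1)])
    moreover have "(\<Sum>g\<in>G. inner (P g) x * inner (P g) x) \<ge> 0" by (intro sum_nonneg) simp
    ultimately show "inner (T x) x > 0" by (simp add: form)
  qed
  have coef: "(\<Sum>h\<in>G. inner (P h) g *\<^sub>R P h) = (if g \<in> G then P g else 0)" if "g \<in> G \<union> G'" for g
  proof -
    have "(\<Sum>h\<in>G. inner (P h) g *\<^sub>R P h) = (\<Sum>h\<in>G. if h = g then P g else 0)"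
      using ED(5) that by (intro sum.cong) auto
    then show ?thesis using finG by simp
  qed
  show T1: "T g = 2 *\<^sub>R P g" if "g \<in> G" for g
    using coef[of g] that by (simp add: T_def scaleR_2)
  show T2: "T g = P g" if "g \<in> G'" for g
    using coef[of g] that GG(2) by (auto simp: T_def)
  have "det_on S T = det_on S P * (\<Prod>e\<in>G \<union> G'. inner (T e) e)"
    by (rule det_on_diagonal[OF S P linT im GG(1)]) (use T1 T2 ED(5) in auto)
  also have "(\<Prod>e\<in>G \<union> G'. inner (T e) e) = (\<Prod>e\<in>G. inner (T e) e) * (\<Prod>e\<in>G'. inner (T e) e)"
    by (rule prod.union_disjoint[OF finG GG(2)])
  also have "(\<Prod>e\<in>G. inner (T e) e) = 2 ^ card G"
    using T1 ED(5) by simp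
  also have "(\<Prod>e\<in>G'. inner (T e) e) = 1"
    using T2 ED(5) by simp
  finally show "det_on S T = det_on S P * 2 ^ card G" by simp
qed

lemma tendsto_gram:
  assumes "\<And>i k. i < n \<Longrightarrow> k < n \<Longrightarrow> ((\<lambda>t. inner (x t i) (y t k)) \<longlongrightarrow> inner (x' i) (y' k)) F"
  shows "((\<lambda>t. gram n (x t) (y t)) \<longlongrightarrow> gram n x' y') F"
  unfolding gram_Leibniz
proof (intro tendsto_sum tendsto_mult tendsto_const tendsto_prod)
  fix \<pi> i assume "\<pi> \<in> {\<pi>. \<pi> permutes {0..<n}}" "i \<in> {0..<n}"
  then have "i < n" "\<pi> i < n" using permutes_in_image[of \<pi> "{0..<n}" i] by auto
  then show "((\<lambda>t. inner (x t i) (y t (\<pi> i))) \<longlongrightarrow> inner (x' i) (y' (\<pi> i))) F" by (rule assms)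
qed

lemma det_on_eq_gram:
  assumes "subspace S" "linear T" "T ` S \<subseteq> S" "orthonormal_basis_list S bs"
  shows "det_on S T = gram (dim S) (nth bs) (\<lambda>k. T (bs ! k))"
  using det_on_eq[OF assms] assms(4) by (simp add: gram_def matrix_in_def orthonormal_basis_list_def)

lemma tendsto_det_on:
  assumes S: "subspace S" and T: "\<And>t. linear (T t)" "\<And>t. T t ` S \<subseteq> S" and T': "linear T'" "T' ` S \<subseteq> S"
    and lim: "\<And>x y. x \<in> S \<Longrightarrow> y \<in> S \<Longrightarrow> ((\<lambda>t. inner (T t x) y) \<longlongrightarrow> inner (T' x) y) F"
  shows "((\<lambda>t. det_on S (T t)) \<longlongrightarrow> det_on S T') F"
proof -
  obtain bs where bs: "orthonormal_basis_list S bs" using orthonormal_basis_list_exists[OF S] by blast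
  have mem: "bs ! i \<in> S" if "i < dim S" for i
    using that bs nth_mem[of i bs] by (auto simp: orthonormal_basis_list_def)
  show ?thesis
    unfolding det_on_eq_gram[OF S T bs] det_on_eq_gram[OF S T' bs]
    using lim mem by (intro tendsto_gram) (simp add: inner_commute)
qed

text \<open>
  A crude form of Hadamard's inequality: by Cauchy--Schwarz every term of the Leibniz expansion is at most
  the product of the diagonal entries. The factor \<open>fact n\<close> is harmless in compactness arguments.
\<close>

lemma gram_le_diagonal:
  assumes S: "subspace S" and T: "symmetric_form S T" and nn: "\<And>x. x \<in> S \<Longrightarrow> inner (T x) x \<ge> 0"
    and es: "\<And>i. i < n \<Longrightarrow> es i \<in> S"
  shows "gram n es (\<lambda>k. T (es k)) \<le> fact n * (\<Prod>i<n. inner (T (es i)) (es i))"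
proof -
  define q where "q = (\<lambda>i. inner (T (es i)) (es i))"
  have q: "q i \<ge> 0" if "i < n" for i using nn es that by (simp add: q_def)
  have "gram n es (\<lambda>k. T (es k))
      \<le> (\<Sum>\<pi> | \<pi> permutes {0..<n}. \<bar>signof \<pi> * (\<Prod>i = 0..<n. inner (es i) (T (es (\<pi> i))))\<bar>)"
    unfolding gram_Leibniz by (intro sum_mono) (rule abs_ge_self)
  also have "\<dots> \<le> (\<Sum>\<pi> | \<pi> permutes {0..<n}. \<Prod>i<n. q i)"
  proof (rule sum_mono)
    fix \<pi> assume "\<pi> \<in> {\<pi>. \<pi> permutes {0..<n}}"
    then have \<pi>: "\<pi> permutes {0..<n}" by simp
    then have pin: "\<pi> i < n" if "i < n" for i using permutes_in_image[OF \<pi>, of i] that by simp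
    have "\<bar>signof \<pi> * (\<Prod>i = 0..<n. inner (es i) (T (es (\<pi> i))))\<bar> = (\<Prod>i = 0..<n. \<bar>inner (es i) (T (es (\<pi> i)))\<bar>)"
      by (simp add: abs_mult abs_prod sign_def)
    also have "\<dots> \<le> (\<Prod>i = 0..<n. sqrt (q i) * sqrt (q (\<pi> i)))"
    proof (rule prod_mono)
      fix i assume "i \<in> {0..<n}"
      then have i: "es i \<in> S" "es (\<pi> i) \<in> S" using es pin by auto
      have "inner (es i) (T (es (\<pi> i))) = inner (T (es i)) (es (\<pi> i))"
        using T i by (simp add: symmetric_form_def)
      moreover have "(inner (T (es i)) (es (\<pi> i)))\<^sup>2 \<le> q i * q (\<pi> i)"
        unfolding q_def by (rule form_Cauchy_Schwarz[OF S T nn i])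
      ultimately show "0 \<le> \<bar>inner (es i) (T (es (\<pi> i)))\<bar> \<and>
          \<bar>inner (es i) (T (es (\<pi> i)))\<bar> \<le> sqrt (q i) * sqrt (q (\<pi> i))"
        by (simp add: real_sqrt_mult[symmetric] real_le_rsqrt)
    qed
    also have "\<dots> = (\<Prod>i = 0..<n. sqrt (q i)) * (\<Prod>i = 0..<n. sqrt (q (\<pi> i)))"
      by (rule prod.distrib)
    also have "(\<Prod>i = 0..<n. sqrt (q (\<pi> i))) = (\<Prod>i = 0..<n. sqrt (q i))"
      using prod.permute[OF \<pi>, of "\<lambda>i. sqrt (q i)"] by (simp add: comp_def)
    also have "(\<Prod>i = 0..<n. sqrt (q i)) * (\<Prod>i = 0..<n. sqrt (q i)) = (\<Prod>i<n. q i)"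
      unfolding prod.distrib[symmetric] using q by (intro prod.cong) auto
    finally show "\<bar>signof \<pi> * (\<Prod>i = 0..<n. inner (es i) (T (es (\<pi> i))))\<bar> \<le> (\<Prod>i<n. q i)" .
  qed
  also have "\<dots> = fact n * (\<Prod>i<n. q i)"
    using card_permutations[of "{0..<n}" n] by simp
  finally show ?thesis by (simp add: q_def)
qed

lemma gram_basis_nonzero:
  fixes y :: "nat \<Rightarrow> 'a::euclidean_space"
  assumes S: "subspace S" and bs: "orthonormal_basis_list S bs" and y: "\<And>i. i < dim S \<Longrightarrow> y i \<in> S"
    and inj: "inj_on y {..<dim S}" and ind: "independent (y ` {..<dim S})"
  shows "gram (dim S) (nth bs) y \<noteq> 0"
proof
  define d where "d = dim S"
  define C where "C = Matrix.mat d d (\<lambda>(i, k). inner (bs ! i) (y k))"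
  have C: "C \<in> carrier_mat d d" by (simp add: C_def)
  assume "gram (dim S) (nth bs) y = 0"
  then have "Determinant.det C = 0" by (simp add: gram_def C_def d_def)
  then obtain v where v: "v \<in> carrier_vec d" "v \<noteq> 0\<^sub>v d" "C *\<^sub>v v = 0\<^sub>v d"
    using det_0_iff_vec_prod_zero[OF C] by blast
  define z where "z = (\<Sum>k<d. vec_index v k *\<^sub>R y k)"
  have zS: "z \<in> S" unfolding z_def using y S by (intro subspace_sum subspace_scale) (auto simp: d_def)
  have "inner (bs ! i) z = 0" if i: "i < d" for i
  proof -
    have "inner (bs ! i) z = vec_index (C *\<^sub>v v) i"
      using i v(1) by (simp add: z_def inner_sum_right C_def scalar_prod_def lessThan_atLeast0 mult.commute)
    then show ?thesis using v(3) i by simp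
  qed
  then have "z = 0"
    using orthonormal_basis_list_expand[OF S bs zS] bs by (simp add: orthonormal_basis_list_def d_def)
  have "vec_index v k = 0" if k: "k < d" for k
  proof -
    define u where "u = (\<lambda>w. vec_index v (the_inv_into {..<d} y w))"
    have uy: "u (y k) = vec_index v k" if "k < d" for k
      using that inj by (simp add: u_def the_inv_into_f_f d_def)
    have "(\<Sum>w\<in>y ` {..<d}. u w *\<^sub>R w) = (\<Sum>k<d. u (y k) *\<^sub>R y k)"
      using inj by (simp add: sum.reindex d_def)
    also have "\<dots> = z" using uy by (simp add: z_def)
    finally have "u (y k) = 0"
      using \<open>z = 0\<close> k ind by (intro independentD[of "y ` {..<d}" "y ` {..<d}" u]) (auto simp: d_def)
    then show ?thesis using uy[OF k] by simp
  qed
  then have "v = 0\<^sub>v d" using v(1) by (intro eq_vecI) auto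
  then show False using v(2) by simp
qed

section \<open>Flags, Abel summation and subsequences\<close>

text \<open>
  The indices at which the span of an initial segment grows. They select a basis out of \<open>x\<close> that is
  compatible with the whole flag of initial segments.
\<close>

definition greedy :: "(nat \<Rightarrow> 'a::euclidean_space) \<Rightarrow> nat \<Rightarrow> nat set" where
  "greedy x n = {i. i < n \<and> x i \<notin> span (x ` {..<i})}"

lemma greedy:
  "independent (x ` greedy x n)" "inj_on x (greedy x n)" "card (greedy x n) = dim (x ` {..<n})"
proof -
  have *: "independent (x ` greedy x n) \<and> inj_on x (greedy x n) \<and> span (x ` greedy x n) = span (x ` {..<n})"
  proof (induction n)
    case 0
    then show ?case by (simp add: greedy_def independent_empty)
  next
    case (Suc n)
    have im: "x ` {..<Suc n} = insert (x n) (x ` {..<n})" by (auto simp: lessThan_Suc)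
    show ?case
    proof (cases "x n \<in> span (x ` {..<n})")
      case True
      then have "greedy x (Suc n) = greedy x n" by (auto simp: greedy_def less_Suc_eq)
      then show ?thesis using Suc True by (simp add: im span_redundant)
    next
      case False
      then have g: "greedy x (Suc n) = insert n (greedy x n)" by (auto simp: greedy_def less_Suc_eq)
      have n: "x n \<notin> span (x ` greedy x n)" using False Suc by simp
      then have nim: "x n \<notin> x ` greedy x n" using span_base[of "x n" "x ` greedy x n"] by argo
      have "n \<notin> greedy x n" by (simp add: greedy_def)
      with nim have "inj_on x (greedy x (Suc n))" using Suc by (simp add: g)
      moreover have "independent (x ` greedy x (Suc n))"
        using Suc n by (simp add: g independent_insert nim)
      moreover have "span (x ` greedy x (Suc n)) = span (x ` {..<Suc n})"
        using Suc by (simp add: im g span_insert)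
      ultimately show ?thesis by blast
    qed
  qed
  then show "independent (x ` greedy x n)" "inj_on x (greedy x n)" by auto
  have "dim (x ` {..<n}) = dim (x ` greedy x n)" using * dim_span by metis
  also have "\<dots> = card (x ` greedy x n)" using * dim_eq_card_independent by blast
  also have "\<dots> = card (greedy x n)" using * card_image by blast
  finally show "card (greedy x n) = dim (x ` {..<n})" by simp
qed

text \<open>
  With \<open>\<sigma> k = (\<Sum>i<k. a i) - k\<close>, summation by parts writes the logarithm of the product as
  \<open>\<Sum>k. \<sigma> k (ln \<mu>\<^sub>k\<^sub>-\<^sub>1 - ln \<mu>\<^sub>k)\<close>; every difference is non-positive and they telescope to \<open>ln \<mu>\<^sub>0\<close>. Hence \<open>s\<close> may
  be any positive lower bound of the \<open>\<sigma> k\<close>; it does not depend on \<open>\<mu>\<close>.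
\<close>

lemma Abel_summation_bound:
  fixes a :: "nat \<Rightarrow> real"
  assumes n: "n > 0" and pos: "\<And>k. 0 < k \<Longrightarrow> k < n \<Longrightarrow> real k < (\<Sum>i<k. a i)"
    and total: "(\<Sum>i<n. a i) = real n"
  shows "\<exists>s>0. \<forall>\<mu>. 0 < \<mu> 0 \<longrightarrow> (\<forall>i k. i \<le> k \<longrightarrow> k < n \<longrightarrow> \<mu> i \<le> \<mu> k) \<longrightarrow> \<mu> (n - 1) = 1 \<longrightarrow>
    (\<Prod>i<n. \<mu> i powr (a i - 1)) \<le> \<mu> 0 powr s"
proof -
  define \<sigma> where "\<sigma> = (\<lambda>k. \<Sum>i<k. a i - 1)"
  \<comment> \<open>The element \<open>1\<close> keeps the set non-empty when \<open>n = 1\<close>.\<close>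
  define s where "s = Min (insert 1 (\<sigma> ` {0<..<n}))"
  have \<sigma>pos: "\<sigma> k > 0" if "0 < k" "k < n" for k
    using pos[OF that] by (simp add: \<sigma>_def sum_subtractf)
  then have s0: "s > 0" by (auto simp: s_def)
  have s\<sigma>: "s \<le> \<sigma> k" if "0 < k" "k < n" for k using that by (auto simp: s_def)
  obtain N where N: "n = Suc N" using n by (cases n) auto
  have "(\<Prod>i<n. \<mu> i powr (a i - 1)) \<le> \<mu> 0 powr s"
    if \<mu>: "0 < \<mu> 0" "\<forall>i k. i \<le> k \<longrightarrow> k < n \<longrightarrow> \<mu> i \<le> \<mu> k" "\<mu> (n - 1) = 1" for \<mu>
  proof -
    have \<mu>0: "\<mu> i > 0" if "i < n" for i using \<mu>(1,2) that by (meson le0 less_le_trans)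
    define L where "L = (\<lambda>i. ln (\<mu> i))"
    have Lmono: "L i \<le> L (Suc i)" if "i < N" for i
      using \<mu>(2) \<mu>0[of i] \<mu>0[of "Suc i"] that by (simp add: L_def N)
    have Abel: "(\<Sum>i<Suc k. (a i - 1) * L i) = \<sigma> (Suc k) * L k + (\<Sum>i<k. \<sigma> (Suc i) * (L i - L (Suc i)))" for k
      by (induction k) (simp_all add: \<sigma>_def algebra_simps)
    have "\<sigma> n = 0" using total by (simp add: \<sigma>_def sum_subtractf)
    then have "(\<Sum>i<n. (a i - 1) * L i) = (\<Sum>i<N. \<sigma> (Suc i) * (L i - L (Suc i)))"
      using Abel[of N] by (simp add: N)
    also have "\<dots> \<le> (\<Sum>i<N. s * (L i - L (Suc i)))"
      using s\<sigma> Lmono by (intro sum_mono mult_right_mono_neg) (auto simp: N)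
    also have "\<dots> = s * (L 0 - L N)"
      by (simp add: sum_distrib_left[symmetric] sum_lessThan_telescope')
    also have "L N = 0" using \<mu>(3) by (simp add: L_def N)
    finally have le: "(\<Sum>i<n. (a i - 1) * L i) \<le> s * L 0" by simp
    have "(\<Prod>i<n. \<mu> i powr (a i - 1)) = exp (\<Sum>i<n. (a i - 1) * L i)"
    proof -
      have "\<mu> i powr (a i - 1) = exp ((a i - 1) * L i)" if "i < n" for i
        using \<mu>0[OF that] by (simp add: powr_def L_def)
      then show ?thesis by (simp add: exp_sum)
    qed
    also have "\<dots> \<le> \<mu> 0 powr s" using le \<mu>(1) by (simp add: powr_def L_def)
    finally show ?thesis .
  qed
  then show ?thesis using s0 by blast
qed

lemma bounded_family_subsequence:
  fixes X :: "'j \<Rightarrow> nat \<Rightarrow> 'c::heine_borel"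
  assumes "finite J" "\<And>j. j \<in> J \<Longrightarrow> bounded (range (X j))"
  shows "\<exists>r l. strict_mono (r :: nat \<Rightarrow> nat) \<and> (\<forall>j\<in>J. (\<lambda>k. X j (r k)) \<longlonglongrightarrow> l j)"
  using assms
proof (induction J)
  case empty
  show ?case by (intro exI[of _ id]) (simp add: strict_mono_def)
next
  case (insert j J)
  then obtain r l where r: "strict_mono r" "\<forall>j\<in>J. (\<lambda>k. X j (r k)) \<longlonglongrightarrow> l j" by blast
  have "bounded (range (\<lambda>k. X j (r k)))"
    by (rule bounded_subset[OF insert(4)[of j]]) auto
  then obtain y q where q: "strict_mono q" "((\<lambda>k. X j (r k)) \<circ> q) \<longlonglongrightarrow> y"
    using bounded_imp_convergent_subsequence by blast
  have "(\<lambda>k. X i (r (q k))) \<longlonglongrightarrow> (l(j := y)) i" if "i \<in> insert j J" for i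
  proof (cases "i = j")
    case True
    then show ?thesis using q(2) by (simp add: comp_def)
  next
    case False
    then have "((\<lambda>k. X i (r k)) \<circ> q) \<longlonglongrightarrow> l i" using r(2) that q(1) by (intro LIMSEQ_subseq_LIMSEQ) auto
    then show ?thesis using False by (simp add: comp_def)
  qed
  moreover have "strict_mono (\<lambda>k. r (q k))" using strict_mono_o[OF r(1) q(1)] by (simp add: comp_def)
  ultimately show ?case by blast
qed

section \<open>Gaussian inputs of a datum\<close>

locale positive_datum =
  fixes m :: nat
    and H :: "'a::euclidean_space set"
    and Hj :: "nat \<Rightarrow> 'b::euclidean_space set"
    and B :: "nat \<Rightarrow> 'a \<Rightarrow> 'b"
    and p :: "nat \<Rightarrow> real"
  assumes datum: "BL_datum m H Hj B p"
    and exponent_pos: "\<forall>j\<in>{1..m}. p j > 0"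
begin

abbreviation M :: "(nat \<Rightarrow> 'b \<Rightarrow> 'b) \<Rightarrow> 'a \<Rightarrow> 'a" where
  "M A \<equiv> BLg_op m H B p A"

definition ratio :: "(nat \<Rightarrow> 'b \<Rightarrow> 'b) \<Rightarrow> real" where
  "ratio A = (\<Prod>j\<in>{1..m}. det_on (Hj j) (A j) powr p j) / det_on H (M A)"

lemma subspace_H: "subspace H"
  using datum by (simp add: BL_datum_def transformation_def)

lemma datumD:
  assumes "j \<in> {1..m}"
  shows "subspace (Hj j)" "linear (B j)" "\<And>x. x \<in> H \<Longrightarrow> B j x \<in> Hj j" "p j > 0"
proof -
  have "subspace (Hj j) \<and> linear (B j) \<and> B j ` H \<subseteq> Hj j"
    using assms datum by (simp add: BL_datum_def transformation_def)
  then show "subspace (Hj j)" "linear (B j)" "\<And>x. x \<in> H \<Longrightarrow> B j x \<in> Hj j" by blast+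
  show "p j > 0" using assms exponent_pos by blast
qed

lemma inputD:
  assumes "gaussian_input m Hj A" "j \<in> {1..m}"
  shows "positive_form (Hj j) (A j)" "A j ` Hj j \<subseteq> Hj j" "linear (A j)" "det_on (Hj j) (A j) > 0"
proof -
  show 1: "positive_form (Hj j) (A j)" "A j ` Hj j \<subseteq> Hj j" "linear (A j)"
    using assms(1)[unfolded gaussian_input_def, rule_format, OF assms(2)]
    unfolding positive_definite_on_def positive_form_def symmetric_form_def by blast+
  show "det_on (Hj j) (A j) > 0" using det_on_pos[OF datumD(1)[OF assms(2)] 1(1,2)] .
qed

lemma inputI:
  assumes "\<And>j. j \<in> {1..m} \<Longrightarrow> positive_form (Hj j) (A j)" "\<And>j. j \<in> {1..m} \<Longrightarrow> A j ` Hj j \<subseteq> Hj j"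
  shows "gaussian_input m Hj A"
  using assms unfolding gaussian_input_def positive_definite_on_def positive_form_def symmetric_form_def
  by blast

lemma M_in_H: "M A x \<in> H"
  unfolding BLg_op_def using subspace_H datumD(2)
  by (intro subspace_sum subspace_scale adjoint_on(1)) auto

lemma M_image: "M A ` H \<subseteq> H"
  using M_in_H by blast

lemma inner_M:
  assumes "y \<in> H"
  shows "inner (M A x) y = (\<Sum>j\<in>{1..m}. p j * inner (A j (B j x)) (B j y))"
proof -
  have "inner (M A x) y = (\<Sum>j\<in>{1..m}. p j * inner (adjoint_on H (B j) (A j (B j x))) y)"
    by (simp add: BLg_op_def inner_sum_left)
  also have "\<dots> = (\<Sum>j\<in>{1..m}. p j * inner (A j (B j x)) (B j y))"
  proof (rule sum.cong[OF refl])
    fix j assume "j \<in> {1..m}"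
    then have "inner (B j y) (A j (B j x)) = inner y (adjoint_on H (B j) (A j (B j x)))"
      by (intro adjoint_on(2)[OF subspace_H datumD(2) assms])
    then show "p j * inner (adjoint_on H (B j) (A j (B j x))) y = p j * inner (A j (B j x)) (B j y)"
      by (metis inner_commute)
  qed
  finally show ?thesis .
qed

lemma M_symmetric:
  assumes A: "gaussian_input m Hj A"
  shows "symmetric_form H (M A)"
  unfolding symmetric_form_def
proof (intro conjI ballI)
  show "linear (M A)"
  proof (rule linearI)
    show "M A (x + y) = M A x + M A y" for x y
      using subspace_H M_in_H inputD(3)[OF A] datumD(2)
      by (intro eq_in_subspaceI[OF subspace_H])
        (auto simp: subspace_add inner_M inner_add_left linear_add distrib_left sum.distrib)
    show "M A (c *\<^sub>R x) = c *\<^sub>R M A x" for c x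
      using subspace_H M_in_H inputD(3)[OF A] datumD(2)
      by (intro eq_in_subspaceI[OF subspace_H])
        (auto simp: subspace_scale inner_M linear_cmul sum_distrib_left algebra_simps intro!: sum.cong)
  qed
  show "inner (M A x) y = inner x (M A y)" if "x \<in> H" "y \<in> H" for x y
  proof -
    have "inner (M A x) y = inner (M A y) x"
      unfolding inner_M[OF that(1)] inner_M[OF that(2)]
      using positive_formD(3)[OF inputD(1)[OF A] datumD(3)[OF _ that(1)] datumD(3)[OF _ that(2)]]
      by (intro sum.cong) auto
    then show ?thesis by (simp add: inner_commute)
  qed
qed

lemma M_nonneg:
  assumes A: "gaussian_input m Hj A" and x: "x \<in> H"
  shows "inner (M A x) x \<ge> 0"
  unfolding inner_M[OF x]
proof (rule sum_nonneg)
  fix j assume j: "j \<in> {1..m}"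
  show "0 \<le> p j * inner (A j (B j x)) (B j x)"
    using positive_formD(5)[OF inputD(1)[OF A j] datumD(3)[OF j x]] datumD(4)[OF j] by simp
qed

lemma det_M:
  assumes A: "gaussian_input m Hj A"
  shows "det_on H (M A) \<ge> 0" "det_on H (M A) > 0 \<longleftrightarrow> positive_form H (M A)"
  using det_on_nonneg_form[OF subspace_H M_symmetric[OF A] M_image M_nonneg[OF A]] by auto

lemma ratio_pos:
  assumes "gaussian_input m Hj A" "det_on H (M A) > 0"
  shows "ratio A > 0"
  unfolding ratio_def using assms inputD(4)[OF assms(1)] by (intro divide_pos_pos prod_pos) fastforce+

text \<open>
  Removes extended reals from the problem: a single degenerate \<open>M A'\<close> already makes the supremum infinite.
\<close>

lemma extremiser_iff:
  "gaussian_extremiser m H Hj B p A \<longleftrightarrow> gaussian_input m Hj A \<and>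
     (\<forall>A'. gaussian_input m Hj A' \<longrightarrow> 0 < det_on H (M A') \<and> ratio A' \<le> ratio A)"
proof -
  have at: "BLg_at m H Hj B p A = (if det_on H (M A) = 0 then \<infinity> else ereal (sqrt (ratio A)))" for A
    by (simp add: BLg_at_def ratio_def)
  show ?thesis
  proof (intro iffI conjI allI impI)
    assume ex: "gaussian_extremiser m H Hj B p A"
    then show A: "gaussian_input m Hj A" by (simp add: gaussian_extremiser_def)
    fix A' assume A': "gaussian_input m Hj A'"
    then have le: "BLg_at m H Hj B p A' \<le> BLg_at m H Hj B p A"
      and fin: "BLg_at m H Hj B p A < \<infinity>"
      using ex by (auto simp: gaussian_extremiser_def BLg_def intro: SUP_upper)
    have 0: "det_on H (M A) \<noteq> 0" using fin by (auto simp: at)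
    have 1: "det_on H (M A') \<noteq> 0" using le fin by (auto simp: at split: if_splits)
    then show "det_on H (M A') > 0" using det_M(1)[OF A'] by simp
    show "ratio A' \<le> ratio A" using le 0 1 by (simp add: at)
  next
    assume *: "gaussian_input m Hj A \<and>
      (\<forall>A'. gaussian_input m Hj A' \<longrightarrow> 0 < det_on H (M A') \<and> ratio A' \<le> ratio A)"
    then have at': "BLg_at m H Hj B p A' = ereal (sqrt (ratio A'))" if "gaussian_input m Hj A'" for A'
      using that by (auto simp: at)
    have "BLg m H Hj B p = BLg_at m H Hj B p A"
      unfolding BLg_def using * at' by (intro antisym SUP_least SUP_upper) auto
    then show "gaussian_extremiser m H Hj B p A"
      using * at' by (simp add: gaussian_extremiser_def)
  qed
qed

section \<open>The first-order condition for extremisers\<close>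

lemma M_rank_one:
  fixes w :: 'b
  assumes A: "gaussian_input m Hj A" and j: "j \<in> {1..m}" and x: "x \<in> H"
  defines "u \<equiv> adjoint_on H (B j) w"
  shows "M (A(j := \<lambda>y. A j y + (t * inner w y) *\<^sub>R w)) x = M A x + (t * p j * inner u x) *\<^sub>R u"
proof (rule eq_in_subspaceI[OF subspace_H M_in_H])
  have u: "u \<in> H" "\<And>v. v \<in> H \<Longrightarrow> inner (B j v) w = inner v u"
    unfolding u_def using adjoint_on[OF subspace_H datumD(2)[OF j]] by auto
  show "M A x + (t * p j * inner u x) *\<^sub>R u \<in> H"
    using u(1) M_in_H subspace_H by (simp add: subspace_add subspace_scale)
  fix v assume v: "v \<in> H"
  have "inner (M (A(j := \<lambda>y. A j y + (t * inner w y) *\<^sub>R w)) x) v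
      = (\<Sum>i\<in>{1..m}. p i * inner (A i (B i x)) (B i v)
          + (if i = j then p j * (t * inner w (B j x)) * inner w (B j v) else 0))"
    unfolding inner_M[OF v] by (intro sum.cong) (auto simp: inner_add_left algebra_simps)
  also have "\<dots> = inner (M A x) v + p j * (t * inner w (B j x)) * inner w (B j v)"
    using j by (simp add: sum.distrib inner_M[OF v])
  also have "\<dots> = inner (M A x + (t * p j * inner u x) *\<^sub>R u) v"
    using u(2)[OF x] u(2)[OF v] by (simp add: inner_add_left inner_add_right inner_commute)
  finally show "inner (M (A(j := \<lambda>y. A j y + (t * inner w y) *\<^sub>R w)) x) v
    = inner (M A x + (t * p j * inner u x) *\<^sub>R u) v" .
qed

text \<open>
  For \<open>\<langle>A\<^sub>j f, f\<rangle> = 1\<close>, adding \<open>t (A\<^sub>j f)\<otimes>(A\<^sub>j f)\<close> to \<open>A\<^sub>j\<close> multiplies \<open>det A\<^sub>j\<close> by \<open>1 + t\<close> and \<open>det (M A)\<close> by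
  \<open>1 + t p\<^sub>j Q\<close>, where \<open>Q\<close> is the sum of squares in question. So \<open>1 + t p\<^sub>j Q - (1 + t) powr p\<^sub>j\<close> has a minimum
  at \<open>t = 0\<close>, and its derivative \<open>p\<^sub>j Q - p\<^sub>j\<close> vanishes there.
\<close>

lemma extremiser_isotropic:
  assumes ex: "gaussian_extremiser m H Hj B p A" and E: "basis_wrt (M A) H E"
    and j: "j \<in> {1..m}" and f: "f \<in> Hj j"
  shows "(\<Sum>e\<in>E. (inner (A j f) (B j e))\<^sup>2) = inner (A j f) f"
proof -
  have A: "gaussian_input m Hj A"
    and max: "\<And>A'. gaussian_input m Hj A' \<Longrightarrow> 0 < det_on H (M A') \<and> ratio A' \<le> ratio A"
    using ex by (auto simp: extremiser_iff)
  note D = datumD[OF j] and I = inputD[OF A j]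
  have detM: "det_on H (M A) > 0" using max[OF A] by simp
  then have PM: "positive_form H (M A)" using det_M[OF A] by blast
  have unit: "(\<Sum>e\<in>E. (inner (A j f) (B j e))\<^sup>2) = 1" if f: "f \<in> Hj j" "inner (A j f) f = 1" for f
  proof -
    define w where "w = A j f"
    define u where "u = adjoint_on H (B j) w"
    define Q where "Q = (\<Sum>e\<in>E. (inner w (B j e))\<^sup>2)"
    have w: "w \<in> Hj j" using I(2) f by (auto simp: w_def)
    have u: "u \<in> H" "\<And>v. v \<in> H \<Longrightarrow> inner (B j v) w = inner v u"
      unfolding u_def using adjoint_on[OF subspace_H D(2)] by auto
    have ineq: "(1 + t) powr p j \<le> 1 + t * p j * Q" if t: "t > -1" for t
    proof -
      define A' where "A' = A(j := \<lambda>y. A j y + (t * inner w y) *\<^sub>R w)"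
      have A'j: "A' j = (\<lambda>y. A j y + (t * inner w y) *\<^sub>R w)" by (simp add: A'_def)
      have lin: "linear (A' j)"
        using I(3) unfolding A'j by (auto simp: linear_add linear_cmul inner_add_right algebra_simps intro!: linearI)
      have pos: "positive_form (Hj j) (A' j)"
        unfolding positive_form_def symmetric_form_def
      proof (intro conjI ballI impI lin)
        show "inner (A' j x) y = inner x (A' j y)" if "x \<in> Hj j" "y \<in> Hj j" for x y
          using that positive_formD(3)[OF I(1)] by (simp add: A'j inner_add_left inner_add_right inner_commute)
        show "inner (A' j x) x > 0" if x: "x \<in> Hj j" "x \<noteq> 0" for x
        proof -
          have "(inner (A j f) x)\<^sup>2 \<le> inner (A j f) f * inner (A j x) x"
            by (rule form_Cauchy_Schwarz[OF D(1) positive_formD(1)[OF I(1)] positive_formD(5)[OF I(1)] f(1) x(1)])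
          then have le: "(inner w x)\<^sup>2 \<le> inner (A j x) x" using f by (simp add: w_def)
          have gt: "inner (A j x) x > 0" using positive_formD(4)[OF I(1) x] .
          have eq: "inner (A' j x) x = inner (A j x) x + t * (inner w x)\<^sup>2"
            by (simp add: A'j inner_add_left power2_eq_square)
          show ?thesis
          proof (cases "t \<ge> 0")
            case True then show ?thesis using gt eq by (simp add: add_pos_nonneg)
          next
            case False
            then have "t * inner (A j x) x \<le> t * (inner w x)\<^sup>2" using le by (intro mult_left_mono_neg) auto
            moreover have "0 < (1 + t) * inner (A j x) x" using gt t by simp
            ultimately show ?thesis unfolding eq by (simp add: algebra_simps)
          qed
        qed
      qed
      have A': "gaussian_input m Hj A'"
      proof (rule inputI)
        fix i assume i: "i \<in> {1..m}"
        show "positive_form (Hj i) (A' i)"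
          using pos inputD(1)[OF A i] by (cases "i = j") (auto simp: A'_def)
        show "A' i ` Hj i \<subseteq> Hj i"
        proof (cases "i = j")
          case True
          then show ?thesis using I(2) w D(1) by (auto simp: A'j intro!: subspace_add subspace_scale)
        next
          case False
          then show ?thesis using inputD(2)[OF A i] by (simp add: A'_def)
        qed
      qed
      have "\<exists>G. basis_wrt (A j) (Hj j) G" using basis_wrt_exists[OF D(1) I(1)] .
      then obtain G where G: "basis_wrt (A j) (Hj j) G" by blast
      have "(\<Sum>g\<in>G. (inner w g)\<^sup>2) = (\<Sum>g\<in>G. inner (A j f) g * inner (A j g) f)"
        using positive_formD(3)[OF I(1) f(1)] basis_wrtD(4)[OF D(1) I(1) G]
        by (intro sum.cong) (auto simp: w_def power2_eq_square)
      also have "\<dots> = 1"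
        using Parseval_wrt[OF D(1) I(1) G f(1) I(3), of f] f(2) by simp
      finally have dj: "det_on (Hj j) (A' j) = det_on (Hj j) (A j) * (1 + t)"
        using det_on_rank_one[OF D(1) I(1,2) G w, of t] by (simp add: A'j)
      have "det_on H (M A') = det_on H (\<lambda>x. M A x + (t * p j * inner u x) *\<^sub>R u)"
        using M_rank_one[OF A j] by (intro det_on_cong[OF subspace_H]) (simp add: A'_def u_def)
      also have "\<dots> = det_on H (M A) * (1 + t * p j * (\<Sum>e\<in>E. (inner u e)\<^sup>2))"
        by (rule det_on_rank_one[OF subspace_H PM M_image E u(1)])
      also have "(\<Sum>e\<in>E. (inner u e)\<^sup>2) = Q"
        unfolding Q_def using u(2) basis_wrtD(4)[OF subspace_H PM E]
        by (intro sum.cong) (auto simp: inner_commute)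
      finally have dM: "det_on H (M A') = det_on H (M A) * (1 + t * p j * Q)" .
      have pQ: "1 + t * p j * Q > 0" using max[OF A'] dM detM by (simp add: zero_less_mult_iff)
      define C where "C = (\<Prod>i\<in>{1..m} - {j}. det_on (Hj i) (A i) powr p i)"
      have C: "C > 0" unfolding C_def using inputD(4)[OF A] by (intro prod_pos) fastforce
      have "(\<Prod>i\<in>{1..m} - {j}. det_on (Hj i) (A' i) powr p i) = C"
        unfolding C_def by (intro prod.cong) (auto simp: A'_def)
      then have "ratio A' = (det_on (Hj j) (A j) powr p j * (1 + t) powr p j * C)
          / (det_on H (M A) * (1 + t * p j * Q))"
        unfolding ratio_def dM using prod.remove[of "{1..m}" j "\<lambda>i. det_on (Hj i) (A' i) powr p i"] j dj I(4) t
        by (simp add: powr_mult)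
      moreover have "ratio A = (det_on (Hj j) (A j) powr p j * C) / det_on H (M A)"
        unfolding ratio_def C_def using prod.remove[of "{1..m}" j "\<lambda>i. det_on (Hj i) (A i) powr p i"] j by simp
      ultimately have "ratio A' = ratio A * ((1 + t) powr p j / (1 + t * p j * Q))" by simp
      then have "ratio A * ((1 + t) powr p j / (1 + t * p j * Q)) \<le> ratio A * 1" using max[OF A'] by simp
      then have "(1 + t) powr p j / (1 + t * p j * Q) \<le> 1"
        using ratio_pos[OF A detM] by (simp only: mult_le_cancel_left_pos)
      then show ?thesis using pQ by simp
    qed
    have "((\<lambda>t. 1 + t * p j * Q - (1 + t) powr p j) has_real_derivative p j * Q - p j) (at 0)"
      by (auto intro!: derivative_eq_intros)
    then have "p j * Q - p j = 0"
      by (rule DERIV_local_min[of _ _ _ 1]) (use ineq in auto)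
    then show ?thesis using D(4) by (simp add: Q_def w_def)
  qed
  show ?thesis
  proof (cases "f = 0")
    case True then show ?thesis using linear_0[OF I(3)] by simp
  next
    case False
    define c where "c = inner (A j f) f"
    have c: "c > 0" using positive_formD(4)[OF I(1) f False] by (simp add: c_def)
    have "(\<Sum>e\<in>E. (inner (A j ((1 / sqrt c) *\<^sub>R f)) (B j e))\<^sup>2) = 1"
      using f D(1) c by (intro unit) (auto simp: subspace_scale I(3) linear_cmul c_def[symmetric])
    then have "(\<Sum>e\<in>E. (inner (A j f) (B j e))\<^sup>2 / c) = 1"
      using c by (simp add: I(3) linear_cmul power_divide)
    then show ?thesis using c by (simp add: sum_divide_distrib[symmetric] c_def)
  qed
qed

text \<open>
  After a linear change of variables taking the forms \<open>M A\<close> and \<open>A\<^sub>j\<close> to the standard inner products, this says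
  that the datum is geometric, \<open>B\<^sub>j B\<^sub>j\<^sup>* = id\<close> and \<open>\<Sum>j. p j B\<^sub>j\<^sup>* B\<^sub>j = id\<close>.
\<close>

definition isotropic :: "(nat \<Rightarrow> 'b \<Rightarrow> 'b) \<Rightarrow> 'a set \<Rightarrow> bool" where
  "isotropic A E \<longleftrightarrow> gaussian_input m Hj A \<and> positive_form H (M A) \<and> basis_wrt (M A) H E \<and>
     (\<forall>j\<in>{1..m}. \<forall>f\<in>Hj j. (\<Sum>e\<in>E. (inner (A j f) (B j e))\<^sup>2) = inner (A j f) f)"

lemma extremiser_M_positive:
  assumes "gaussian_extremiser m H Hj B p A" "gaussian_input m Hj A'"
  shows "positive_form H (M A')"
  using assms det_M(2) by (auto simp: extremiser_iff)

lemma extremiser_imp_isotropic: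
  assumes "gaussian_extremiser m H Hj B p A" "basis_wrt (M A) H E"
  shows "isotropic A E"
proof -
  have A: "gaussian_input m Hj A" using assms by (simp add: extremiser_iff)
  then show ?thesis using extremiser_M_positive[OF assms(1) A] assms(2) extremiser_isotropic[OF assms]
    by (simp add: isotropic_def)
qed

text \<open>
  Both sides evaluate the sum of \<open>p j \<langle>A\<^sub>j g, B\<^sub>j e\<rangle>\<^sup>2\<close> over all \<open>j\<close>, \<open>g \<in> G j\<close> and \<open>e \<in> E1 \<union> E2\<close>. Isotropy gives
  \<open>1\<close> for each fixed \<open>g\<close>. For each fixed \<open>e \<in> E1\<close> Parseval gives \<open>\<langle>M A e, e\<rangle> = 1\<close>, because \<open>B\<^sub>j e \<in> W j\<close>.
\<close>

lemma defect_formula: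
  assumes iso: "isotropic A (E1 \<union> E2)" and disj: "E1 \<inter> E2 = {}"
    and V: "subspace V" "V \<subseteq> H" "basis_wrt (M A) V E1"
    and W: "\<And>j. j \<in> {1..m} \<Longrightarrow> subspace (W j)" "\<And>j. j \<in> {1..m} \<Longrightarrow> B j ` V \<subseteq> W j"
      "\<And>j. j \<in> {1..m} \<Longrightarrow> W j \<subseteq> Hj j"
    and G: "\<And>j. j \<in> {1..m} \<Longrightarrow> basis_wrt (A j) (W j) (G j)"
  shows "real (dim V) + (\<Sum>j\<in>{1..m}. p j * (\<Sum>g\<in>G j. \<Sum>e\<in>E2. (inner (A j g) (B j e))\<^sup>2))
    = (\<Sum>j\<in>{1..m}. p j * real (dim (W j)))"
proof -
  have A: "gaussian_input m Hj A" and PM: "positive_form H (M A)" and E: "basis_wrt (M A) H (E1 \<union> E2)"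
    and norm: "\<And>j f. j \<in> {1..m} \<Longrightarrow> f \<in> Hj j \<Longrightarrow>
      (\<Sum>e\<in>E1 \<union> E2. (inner (A j f) (B j e))\<^sup>2) = inner (A j f) f"
    using iso by (auto simp: isotropic_def)
  note ED = basis_wrtD[OF subspace_H PM E] and VD = basis_wrtD[OF V(1) positive_form_mono[OF PM V(2)] V(3)]
  have fin: "finite E1" "finite E2" using ED(1) by auto
  have PW: "positive_form (W j) (A j)" if "j \<in> {1..m}" for j
    using positive_form_mono[OF inputD(1)[OF A that] W(3)[OF that]] .
  have row: "inner (A j (B j e)) (B j e) = (\<Sum>g\<in>G j. (inner (A j g) (B j e))\<^sup>2)"
    if j: "j \<in> {1..m}" and e: "e \<in> E1" for j e
  proof -
    have Be: "B j e \<in> W j" using W(2)[OF j] VD(4)[OF e] by blast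
    have "inner (A j (B j e)) (B j e) = (\<Sum>g\<in>G j. inner (A j (B j e)) g * inner (A j g) (B j e))"
      by (rule Parseval_wrt[OF W(1)[OF j] PW[OF j] G[OF j] Be inputD(3)[OF A j]])
    also have "\<dots> = (\<Sum>g\<in>G j. (inner (A j g) (B j e))\<^sup>2)"
      using positive_formD(3)[OF PW[OF j] Be] basis_wrtD(4)[OF W(1)[OF j] PW[OF j] G[OF j]]
      by (intro sum.cong) (auto simp: power2_eq_square)
    finally show ?thesis .
  qed
  have col: "(\<Sum>g\<in>G j. \<Sum>e\<in>E1. (inner (A j g) (B j e))\<^sup>2) + (\<Sum>g\<in>G j. \<Sum>e\<in>E2. (inner (A j g) (B j e))\<^sup>2)
      = real (dim (W j))" if j: "j \<in> {1..m}" for j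
  proof -
    note GD = basis_wrtD[OF W(1)[OF j] PW[OF j] G[OF j]]
    have "(\<Sum>e\<in>E1. (inner (A j g) (B j e))\<^sup>2) + (\<Sum>e\<in>E2. (inner (A j g) (B j e))\<^sup>2) = 1"
      if g: "g \<in> G j" for g
    proof -
      have "g \<in> Hj j" using GD(4)[OF g] W(3)[OF j] by blast
      then show ?thesis using norm[OF j] GD(5)[OF g g]
        sum.union_disjoint[OF fin disj, of "\<lambda>e. (inner (A j g) (B j e))\<^sup>2"] by simp
    qed
    then have "(\<Sum>g\<in>G j. (\<Sum>e\<in>E1. (inner (A j g) (B j e))\<^sup>2) + (\<Sum>e\<in>E2. (inner (A j g) (B j e))\<^sup>2))
        = real (card (G j))" by simp
    then show ?thesis using GD(3) by (simp add: sum.distrib)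
  qed
  have "real (dim V) = (\<Sum>e\<in>E1. inner (M A e) e)" using VD(3,5) by simp
  also have "\<dots> = (\<Sum>e\<in>E1. \<Sum>j\<in>{1..m}. p j * inner (A j (B j e)) (B j e))"
    using VD(4) V(2) by (intro sum.cong refl inner_M) blast
  also have "\<dots> = (\<Sum>j\<in>{1..m}. \<Sum>e\<in>E1. p j * inner (A j (B j e)) (B j e))" by (rule sum.swap)
  also have "\<dots> = (\<Sum>j\<in>{1..m}. p j * (\<Sum>g\<in>G j. \<Sum>e\<in>E1. (inner (A j g) (B j e))\<^sup>2))"
  proof (rule sum.cong[OF refl])
    fix j assume j: "j \<in> {1..m}"
    have "(\<Sum>e\<in>E1. inner (A j (B j e)) (B j e)) = (\<Sum>e\<in>E1. \<Sum>g\<in>G j. (inner (A j g) (B j e))\<^sup>2)"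
      using row[OF j] by (intro sum.cong) auto
    also have "\<dots> = (\<Sum>g\<in>G j. \<Sum>e\<in>E1. (inner (A j g) (B j e))\<^sup>2)" by (rule sum.swap)
    finally show "(\<Sum>e\<in>E1. p j * inner (A j (B j e)) (B j e))
        = p j * (\<Sum>g\<in>G j. \<Sum>e\<in>E1. (inner (A j g) (B j e))\<^sup>2)"
      by (simp add: sum_distrib_left[symmetric])
  qed
  finally show ?thesis
    using col by (simp add: sum.distrib[symmetric] distrib_left[symmetric])
qed

lemma image_basis:
  assumes A: "gaussian_input m Hj A" and V: "subspace V" "V \<subseteq> H" and j: "j \<in> {1..m}"
  shows "subspace (B j ` V)" "B j ` V \<subseteq> Hj j" "\<exists>G. basis_wrt (A j) (B j ` V) G"
proof -
  show 1: "subspace (B j ` V)" using linear_subspace_image[OF datumD(2)[OF j] V(1)] .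
  show 2: "B j ` V \<subseteq> Hj j" using datumD(3)[OF j] V(2) by blast
  show "\<exists>G. basis_wrt (A j) (B j ` V) G"
    using basis_wrt_exists[OF 1 positive_form_mono[OF inputD(1)[OF A j] 2]] .
qed

lemma extremiser_imp_feasible:
  assumes ex: "gaussian_extremiser m H Hj B p A"
  shows "feasible m H Hj B p"
  unfolding feasible_def
proof (intro conjI allI impI)
  have A: "gaussian_input m Hj A" using ex by (simp add: extremiser_iff)
  note PM = extremiser_M_positive[OF ex A]
  obtain E where E: "basis_wrt (M A) H E" using basis_wrt_exists[OF subspace_H PM] by blast
  have "\<forall>j\<in>{1..m}. \<exists>G. basis_wrt (A j) (Hj j) G"
    using basis_wrt_exists[OF datumD(1) inputD(1)[OF A]] by blast
  then obtain G where G: "\<And>j. j \<in> {1..m} \<Longrightarrow> basis_wrt (A j) (Hj j) (G j)" by metis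
  have "real (dim H) + (\<Sum>j\<in>{1..m}. p j * (\<Sum>g\<in>G j. \<Sum>e\<in>{}. (inner (A j g) (B j e))\<^sup>2))
    = (\<Sum>j\<in>{1..m}. p j * real (dim (Hj j)))"
    by (rule defect_formula[of A E "{}" H Hj G])
      (use E G subspace_H datumD(1,3) extremiser_imp_isotropic[OF ex E] in auto)
  then show "real (dim H) = (\<Sum>j\<in>{1..m}. p j * real (dim (Hj j)))" by simp
  fix V assume V: "subspace V \<and> V \<subseteq> H"
  obtain E1 where E1: "basis_wrt (M A) V E1"
    using basis_wrt_exists[of V, OF _ positive_form_mono[OF PM]] V by blast
  obtain E2 where E2: "basis_wrt (M A) H (E1 \<union> E2)" "E1 \<inter> E2 = {}"
    using basis_wrt_extend[OF subspace_H PM _ _ E1] V by blast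
  have "\<forall>j\<in>{1..m}. \<exists>G. basis_wrt (A j) (B j ` V) G" using image_basis(3)[OF A] V by blast
  then obtain G where G: "\<And>j. j \<in> {1..m} \<Longrightarrow> basis_wrt (A j) (B j ` V) (G j)" by metis
  have "real (dim V) + (\<Sum>j\<in>{1..m}. p j * (\<Sum>g\<in>G j. \<Sum>e\<in>E2. (inner (A j g) (B j e))\<^sup>2))
    = (\<Sum>j\<in>{1..m}. p j * real (dim (B j ` V)))"
    by (rule defect_formula[OF extremiser_imp_isotropic[OF ex E2(1)] E2(2) _ _ E1 _ _ _ G])
      (use V image_basis[OF A] in blast)+
  moreover have "(\<Sum>j\<in>{1..m}. p j * (\<Sum>g\<in>G j. \<Sum>e\<in>E2. (inner (A j g) (B j e))\<^sup>2)) \<ge> 0"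
    by (intro sum_nonneg mult_nonneg_nonneg) (use datumD(4) less_imp_le in auto)
  ultimately show "real (dim V) \<le> (\<Sum>j\<in>{1..m}. p j * real (dim (B j ` V)))" by linarith
qed

section \<open>A critical subspace destroys uniqueness\<close>

text \<open>
  The defect formula makes \<open>B\<^sub>j\<close> send the \<open>M A\<close>-complement of \<open>V\<close> into the \<open>A\<^sub>j\<close>-complement of \<open>B\<^sub>j V\<close>. Hence doubling
  each \<open>A\<^sub>j\<close> on \<open>B\<^sub>j V\<close> doubles \<open>M A\<close> exactly on \<open>V\<close>, and \<open>ratio\<close> changes by the factor
  \<open>2 powr ((\<Sum>j. p j dim (B\<^sub>j V)) - dim V) = 1\<close>. The new extremiser is not proportional to the old one, since
  criticality and \<open>0 < dim V < dim H\<close> make some \<open>B\<^sub>j V\<close> non-zero and some \<open>B\<^sub>k V\<close> a proper subspace of \<open>Hj k\<close>.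
\<close>

lemma critical_imp_not_unique:
  assumes ex: "gaussian_extremiser m H Hj B p A" and crit: "critical_subspace m H B p V"
  shows "\<exists>A'. gaussian_extremiser m H Hj B p A' \<and>
    \<not> (\<exists>c>0. \<forall>j\<in>{1..m}. \<forall>x\<in>Hj j. A' j x = c *\<^sub>R A j x)"
proof -
  have A: "gaussian_input m Hj A" using ex by (simp add: extremiser_iff)
  note PM = extremiser_M_positive[OF ex A]
  have V: "subspace V" "V \<subseteq> H" "V \<noteq> {0}" "V \<noteq> H"
    and dimV: "real (dim V) = (\<Sum>j\<in>{1..m}. p j * real (dim (B j ` V)))"
    using crit by (auto simp: critical_subspace_def)
  obtain E1 where E1: "basis_wrt (M A) V E1"
    using basis_wrt_exists[of V, OF _ positive_form_mono[OF PM]] V by blast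
  obtain E2 where E2: "basis_wrt (M A) H (E1 \<union> E2)" "E1 \<inter> E2 = {}"
    using basis_wrt_extend[OF subspace_H PM _ _ E1] V by blast
  note VD = basis_wrtD[OF V(1) positive_form_mono[OF PM V(2)] E1] and ED = basis_wrtD[OF subspace_H PM E2(1)]
  have fin: "finite E1" "finite E2" using ED(1) by auto
  have "\<forall>j\<in>{1..m}. \<exists>G. basis_wrt (A j) (B j ` V) G" using image_basis(3)[OF A V(1,2)] by blast
  then obtain G where G: "\<And>j. j \<in> {1..m} \<Longrightarrow> basis_wrt (A j) (B j ` V) (G j)" by metis
  have "\<forall>j\<in>{1..m}. \<exists>G'. basis_wrt (A j) (Hj j) (G j \<union> G') \<and> G j \<inter> G' = {}"
    using basis_wrt_extend[OF datumD(1) inputD(1)[OF A] image_basis(1,2)[OF A V(1,2)] G] by blast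
  then obtain G' where G': "\<And>j. j \<in> {1..m} \<Longrightarrow> basis_wrt (A j) (Hj j) (G j \<union> G' j)"
    "\<And>j. j \<in> {1..m} \<Longrightarrow> G j \<inter> G' j = {}" by metis
  have PV: "positive_form (B j ` V) (A j)" if "j \<in> {1..m}" for j
    using positive_form_mono[OF inputD(1)[OF A that] image_basis(2)[OF A V(1,2) that]] .
  have GD: "card (G j) = dim (B j ` V)" "G j \<subseteq> B j ` V" "finite (G j)" if "j \<in> {1..m}" for j
    using basis_wrtD(1-3)[OF image_basis(1)[OF A V(1,2) that] PV[OF that] G[OF that]] by auto
  have "real (dim V) + (\<Sum>j\<in>{1..m}. p j * (\<Sum>g\<in>G j. \<Sum>e\<in>E2. (inner (A j g) (B j e))\<^sup>2))
    = (\<Sum>j\<in>{1..m}. p j * real (dim (B j ` V)))"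
    by (rule defect_formula[OF extremiser_imp_isotropic[OF ex E2(1)] E2(2) V(1,2) E1 _ _ _ G])
      (use image_basis[OF A V(1,2)] in blast)+
  then have 0: "(\<Sum>j\<in>{1..m}. p j * (\<Sum>g\<in>G j. \<Sum>e\<in>E2. (inner (A j g) (B j e))\<^sup>2)) = 0"
    using dimV by simp
  have orth: "inner (A j g) (B j e) = 0" if j: "j \<in> {1..m}" and g: "g \<in> G j" and e: "e \<in> E2" for j g e
  proof -
    have "0 \<le> p i * (\<Sum>g\<in>G i. \<Sum>e\<in>E2. (inner (A i g) (B i e))\<^sup>2)" if "i \<in> {1..m}" for i
      using datumD(4)[OF that] by (intro mult_nonneg_nonneg sum_nonneg) auto
    then have "p j * (\<Sum>g\<in>G j. \<Sum>e\<in>E2. (inner (A j g) (B j e))\<^sup>2) = 0"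
      using sum_nonneg_0[OF finite_atLeastAtMost _ 0 j] by blast
    then have "(\<Sum>g\<in>G j. \<Sum>e\<in>E2. (inner (A j g) (B j e))\<^sup>2) = 0" using datumD(4)[OF j] by simp
    then have "(\<Sum>e\<in>E2. (inner (A j g) (B j e))\<^sup>2) = 0"
      using g GD(3)[OF j] by (subst (asm) sum_nonneg_eq_0_iff) (auto intro: sum_nonneg)
    then have "(inner (A j g) (B j e))\<^sup>2 = 0"
      using e fin by (subst (asm) sum_nonneg_eq_0_iff) auto
    then show ?thesis by simp
  qed
  define A' where "A' = (\<lambda>j x. A j x + (\<Sum>g\<in>G j. inner (A j g) x *\<^sub>R A j g))"
  have dbl: "positive_form (Hj j) (A' j)" "A' j ` Hj j \<subseteq> Hj j"
      "det_on (Hj j) (A' j) = det_on (Hj j) (A j) * 2 ^ card (G j)"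
      "\<And>g. g \<in> G j \<Longrightarrow> A' j g = 2 *\<^sub>R A j g" "\<And>g. g \<in> G' j \<Longrightarrow> A' j g = A j g"
    if j: "j \<in> {1..m}" for j
    using double_form[OF datumD(1)[OF j] inputD(1,2)[OF A j] G'[OF j]] unfolding A'_def by blast+
  have A': "gaussian_input m Hj A'"
    using dbl(1,2) by (rule inputI)
  have MA': "inner (M A' x) y = inner (M A x) y +
      (\<Sum>j\<in>{1..m}. p j * (\<Sum>g\<in>G j. inner (A j g) (B j x) * inner (A j g) (B j y)))" if "y \<in> H" for x y
  proof -
    have "inner (M A' x) y = (\<Sum>j\<in>{1..m}. p j * inner (A' j (B j x)) (B j y))" by (rule inner_M[OF that])
    also have "\<dots> = (\<Sum>j\<in>{1..m}. p j * inner (A j (B j x)) (B j y)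
      + p j * (\<Sum>g\<in>G j. inner (A j g) (B j x) * inner (A j g) (B j y)))"
      by (intro sum.cong refl) (simp add: A'_def inner_add_left inner_sum_left distrib_left)
    finally show ?thesis by (simp add: sum.distrib inner_M[OF that])
  qed
  have M2: "inner (M A' x) y = inner (M A x) y" if "x \<in> E1 \<union> E2" "y \<in> E1 \<union> E2" "x \<in> E2 \<or> y \<in> E2" for x y
  proof -
    have "(\<Sum>g\<in>G j. inner (A j g) (B j x) * inner (A j g) (B j y)) = 0" if "j \<in> {1..m}" for j
      using orth[OF that] \<open>x \<in> E2 \<or> y \<in> E2\<close> by (intro sum.neutral) auto
    then show ?thesis using MA'[OF ED(4)[OF that(2)]] by simp
  qed
  have M1: "inner (M A' x) y = 2 * inner (M A x) y" if xy: "x \<in> E1" "y \<in> E1" for x y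
  proof -
    have "(\<Sum>g\<in>G j. inner (A j g) (B j x) * inner (A j g) (B j y)) = inner (A j (B j x)) (B j y)"
      if j: "j \<in> {1..m}" for j
    proof -
      have Bx: "B j x \<in> B j ` V" using VD(4)[OF xy(1)] by blast
      have "inner (A j (B j x)) (B j y) = (\<Sum>g\<in>G j. inner (A j (B j x)) g * inner (A j g) (B j y))"
        by (rule Parseval_wrt[OF image_basis(1)[OF A V(1,2) j] PV[OF j] G[OF j] Bx inputD(3)[OF A j]])
      also have "\<dots> = (\<Sum>g\<in>G j. inner (A j g) (B j x) * inner (A j g) (B j y))"
        using positive_formD(3)[OF PV[OF j] Bx] GD(2)[OF j] by (intro sum.cong) auto
      finally show ?thesis by simp
    qed
    then show ?thesis using MA'[of y x] inner_M[of y A x] ED(4) xy by simp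
  qed
  have "det_on H (M A') = det_on H (M A) * (\<Prod>e\<in>E1 \<union> E2. inner (M A' e) e)"
  proof (rule det_on_diagonal[OF subspace_H PM M_image symmetric_formD(1)[OF M_symmetric[OF A']] M_image E2(1)])
    show "inner (M A' x) y = 0" if "x \<in> E1 \<union> E2" "y \<in> E1 \<union> E2" "x \<noteq> y" for x y
      using that M1[of x y] M2[of x y] ED(5)[OF that(1,2)] by auto
  qed
  also have "(\<Prod>e\<in>E1 \<union> E2. inner (M A' e) e) = (\<Prod>e\<in>E1. inner (M A' e) e) * (\<Prod>e\<in>E2. inner (M A' e) e)"
    by (rule prod.union_disjoint[OF fin E2(2)])
  also have "(\<Prod>e\<in>E1. inner (M A' e) e) = 2 ^ dim V" using M1 VD(3,5) by simp
  also have "(\<Prod>e\<in>E2. inner (M A' e) e) = 1" using M2 ED(5) by simp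
  finally have detM': "det_on H (M A') = det_on H (M A) * 2 powr real (dim V)" by (simp add: powr_realpow)
  have "det_on (Hj j) (A' j) powr p j = det_on (Hj j) (A j) powr p j * 2 powr (p j * real (dim (B j ` V)))"
    if j: "j \<in> {1..m}" for j
  proof -
    have "det_on (Hj j) (A' j) = det_on (Hj j) (A j) * 2 powr real (dim (B j ` V))"
      using dbl(3)[OF j] GD(1)[OF j] by (simp add: powr_realpow)
    then show ?thesis using inputD(4)[OF A j] by (simp add: powr_mult powr_powr mult.commute)
  qed
  then have "(\<Prod>j\<in>{1..m}. det_on (Hj j) (A' j) powr p j)
      = (\<Prod>j\<in>{1..m}. det_on (Hj j) (A j) powr p j * 2 powr (p j * real (dim (B j ` V))))"
    by (intro prod.cong) auto
  also have "\<dots> = (\<Prod>j\<in>{1..m}. det_on (Hj j) (A j) powr p j) * 2 powr real (dim V)"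
    unfolding dimV by (simp add: prod.distrib powr_sum)
  finally have "ratio A' = ratio A" by (simp add: ratio_def detM')
  then have ex': "gaussian_extremiser m H Hj B p A'"
    using ex A' by (simp add: extremiser_iff)
  have "\<not> (\<exists>c>0. \<forall>j\<in>{1..m}. \<forall>x\<in>Hj j. A' j x = c *\<^sub>R A j x)"
  proof
    assume "\<exists>c>0. \<forall>j\<in>{1..m}. \<forall>x\<in>Hj j. A' j x = c *\<^sub>R A j x"
    then obtain c where c: "\<And>j x. j \<in> {1..m} \<Longrightarrow> x \<in> Hj j \<Longrightarrow> A' j x = c *\<^sub>R A j x" by blast
    have GH: "g \<in> Hj j" "A j g \<noteq> 0" if "j \<in> {1..m}" "g \<in> G j \<union> G' j" for j g
      using basis_wrtD(4,5)[OF datumD(1)[OF that(1)] inputD(1)[OF A that(1)] G'(1)[OF that(1)]] that(2)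
      by fastforce+
    have "dim V \<noteq> 0" using V(1,3) subspace_0 by (auto simp: dim_eq_0)
    have "\<exists>j\<in>{1..m}. dim (B j ` V) \<noteq> 0"
    proof (rule ccontr)
      assume "\<not> ?thesis"
      then have "(\<Sum>j\<in>{1..m}. p j * real (dim (B j ` V))) = 0" by (intro sum.neutral) simp
      then show False using dimV \<open>dim V \<noteq> 0\<close> by linarith
    qed
    then obtain j where j: "j \<in> {1..m}" "dim (B j ` V) \<noteq> 0" by blast
    then have "card (G j) \<noteq> 0" using GD(1)[OF j(1)] by simp
    then have "G j \<noteq> {}" by (intro notI) simp
    then obtain g where g: "g \<in> G j" by blast
    have "A' j g = 2 *\<^sub>R A j g" by (rule dbl(4)[OF j(1) g])
    then have "c = 2" using c[OF j(1) GH(1)[OF j(1)]] GH(2)[OF j(1)] g by auto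
    have "dim V < dim H"
      using V subspace_H by (metis dim_subset dim_eq_span le_neq_implies_less span_eq_iff subset_antisym order_refl)
    moreover have "real (dim H) = (\<Sum>j\<in>{1..m}. p j * real (dim (Hj j)))"
      using extremiser_imp_feasible[OF ex] by (simp add: feasible_def)
    ultimately have "\<exists>j\<in>{1..m}. dim (B j ` V) \<noteq> dim (Hj j)"
      using dimV by (metis (mono_tags, lifting) less_irrefl of_nat_eq_iff sum.cong)
    then obtain k where k: "k \<in> {1..m}" "dim (B k ` V) \<noteq> dim (Hj k)" by blast
    have "G' k \<noteq> {}"
      using k GD(1)[OF k(1)] G'(1)[OF k(1)] by (auto simp: basis_wrt_def)
    then obtain h where h: "h \<in> G' k" by blast
    have "A' k h = A k h" by (rule dbl(5)[OF k(1) h])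
    then have "(c - 1) *\<^sub>R A k h = 0" using c[OF k(1) GH(1)[OF k(1)], of h] h by (simp add: scaleR_diff_left)
    then have "c = 1" using GH(2)[OF k(1), of h] h by simp
    then show False using \<open>c = 2\<close> by simp
  qed
  then show ?thesis using ex' by blast
qed

section \<open>Uniqueness for simple data\<close>

text \<open>
  With weights \<open>p j w j g e\<close>, where \<open>w j g e = \<langle>A\<^sub>j g, B\<^sub>j e\<rangle>\<^sup>2\<close>, every \<open>\<mu> e\<close> is a mean of the \<open>\<nu> j g\<close>. Jensen's
  inequality is used through \<open>ln x \<le> x - 1\<close> at \<open>x = \<nu> j g / \<mu> e\<close>: the weighted sum of the non-negative gaps
  \<open>x - 1 - ln x\<close> is \<open>0\<close> by the first-order condition for \<open>A\<close> and the equality of the two ratios, so \<open>\<nu> j g = \<mu> e\<close> wherever the weight is non-zero.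
\<close>

lemma simple_imp_proportional:
  assumes ex: "gaussian_extremiser m H Hj B p A" and ex': "gaussian_extremiser m H Hj B p A'"
    and simple: "simple m H B p"
  shows "\<exists>c>0. \<forall>j\<in>{1..m}. \<forall>x\<in>Hj j. A' j x = c *\<^sub>R A j x"
proof -
  have A: "gaussian_input m Hj A" and A': "gaussian_input m Hj A'"
    using ex ex' by (simp_all add: extremiser_iff)
  note PM = extremiser_M_positive[OF ex A] and PM' = extremiser_M_positive[OF ex A']
  note symM' = M_symmetric[OF A']
  obtain E where E: "basis_wrt (M A) H E"
    and ME: "\<And>x y. x \<in> E \<Longrightarrow> y \<in> E \<Longrightarrow> x \<noteq> y \<Longrightarrow> inner (M A' x) y = 0"
    using simultaneous_diagonalisation[OF subspace_H PM symM'] by blast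
  note ED = basis_wrtD[OF subspace_H PM E]
  have iso: "isotropic A E" by (rule extremiser_imp_isotropic[OF ex E])
  then have norm: "\<And>j f. j \<in> {1..m} \<Longrightarrow> f \<in> Hj j \<Longrightarrow>
      (\<Sum>e\<in>E. (inner (A j f) (B j e))\<^sup>2) = inner (A j f) f"
    by (auto simp: isotropic_def)
  have "\<forall>j\<in>{1..m}. \<exists>G. basis_wrt (A j) (Hj j) G \<and> (\<forall>x\<in>G. \<forall>y\<in>G. x \<noteq> y \<longrightarrow> inner (A' j x) y = 0)"
    using simultaneous_diagonalisation[OF datumD(1) inputD(1)[OF A] positive_formD(1)[OF inputD(1)[OF A']]]
    by blast
  then obtain G where G: "\<And>j. j \<in> {1..m} \<Longrightarrow> basis_wrt (A j) (Hj j) (G j)"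
    and GA': "\<And>j x y. j \<in> {1..m} \<Longrightarrow> x \<in> G j \<Longrightarrow> y \<in> G j \<Longrightarrow> x \<noteq> y \<Longrightarrow> inner (A' j x) y = 0"
    by metis
  note GD = basis_wrtD[OF datumD(1) inputD(1)[OF A] G]
  have finG: "finite (G j)" and GHj: "\<And>g. g \<in> G j \<Longrightarrow> g \<in> Hj j"
    and Gon: "\<And>x y. x \<in> G j \<Longrightarrow> y \<in> G j \<Longrightarrow> inner (A j x) y = (if x = y then 1 else 0)"
    and Gex: "\<And>x. x \<in> Hj j \<Longrightarrow> (\<Sum>g\<in>G j. inner (A j x) g *\<^sub>R g) = x"
    if "j \<in> {1..m}" for j
    using GD(1,4,5,8) that by blast+
  define \<mu> where "\<mu> = (\<lambda>e. inner (M A' e) e)"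
  define \<nu> where "\<nu> = (\<lambda>j g. inner (A' j g) g)"
  define w where "w = (\<lambda>j g e. (inner (A j g) (B j e))\<^sup>2)"
  have e0: "e \<noteq> 0" if "e \<in> E" for e using ED(5)[OF that that] by auto
  have \<mu>: "\<mu> e > 0" if "e \<in> E" for e
    using positive_formD(4)[OF PM' ED(4)[OF that] e0[OF that]] by (simp add: \<mu>_def)
  have \<nu>: "\<nu> j g > 0" if j: "j \<in> {1..m}" and "g \<in> G j" for j g
  proof -
    have "g \<noteq> 0" using Gon[OF j, of g g] that by auto
    then show ?thesis using positive_formD(4)[OF inputD(1)[OF A' j] GHj[OF that]] by (simp add: \<nu>_def)
  qed
  have expand: "inner (A j x) y = (\<Sum>g\<in>G j. inner (A j g) x * inner (A j g) y)"
    "inner (A' j x) y = (\<Sum>g\<in>G j. \<nu> j g * (inner (A j g) x * inner (A j g) y))"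
    if j: "j \<in> {1..m}" and x: "x \<in> Hj j" and y: "y \<in> Hj j" for j x y
  proof -
    note sym = positive_formD(3)[OF inputD(1)[OF A j]] and sym' = positive_formD(3)[OF inputD(1)[OF A' j]]
    have "inner (A j x) y = (\<Sum>g\<in>G j. inner (A j x) g * inner (A j g) y)"
      by (rule Parseval_wrt[OF datumD(1)[OF j] inputD(1)[OF A j] G[OF j] x inputD(3)[OF A j]])
    then show "inner (A j x) y = (\<Sum>g\<in>G j. inner (A j g) x * inner (A j g) y)"
      using sym[OF x GHj[OF j]] by simp
    have "inner (A' j x) y = (\<Sum>g\<in>G j. inner (A j x) g * inner (A' j g) y)"
      by (rule Parseval_wrt[OF datumD(1)[OF j] inputD(1)[OF A j] G[OF j] x inputD(3)[OF A' j]])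
    also have "\<dots> = (\<Sum>g\<in>G j. \<nu> j g * (inner (A j g) x * inner (A j g) y))"
    proof (rule sum.cong[OF refl])
      fix g assume g: "g \<in> G j"
      have "inner (A' j g) y = inner (A' j y) g" using sym' y GHj[OF j g] by simp
      also have "\<dots> = (\<Sum>h\<in>G j. inner (A j y) h * inner (A' j h) g)"
        by (rule Parseval_wrt[OF datumD(1)[OF j] inputD(1)[OF A j] G[OF j] y inputD(3)[OF A' j]])
      also have "\<dots> = (\<Sum>h\<in>G j. if h = g then inner (A j y) g * \<nu> j g else 0)"
        using GA'[OF j] g by (intro sum.cong) (auto simp: \<nu>_def)
      also have "\<dots> = inner (A j y) g * \<nu> j g" using finG[OF j] g by simp
      finally show "inner (A j x) g * inner (A' j g) y = \<nu> j g * (inner (A j g) x * inner (A j g) y)"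
        using sym[OF x GHj[OF j g]] sym[OF y GHj[OF j g]] by simp
    qed
    finally show "inner (A' j x) y = (\<Sum>g\<in>G j. \<nu> j g * (inner (A j g) x * inner (A j g) y))" .
  qed
  have BH: "B j e \<in> Hj j" if "j \<in> {1..m}" "e \<in> E" for j e using datumD(3) ED(4) that by blast
  have w1: "(\<Sum>e\<in>E. w j g e) = 1" if "j \<in> {1..m}" "g \<in> G j" for j g
    using norm[OF that(1) GHj[OF that]] Gon[OF that(1) that(2) that(2)] by (simp add: w_def)
  have wM: "(\<Sum>j\<in>{1..m}. p j * (\<Sum>g\<in>G j. w j g e)) = 1" if e: "e \<in> E" for e
  proof -
    have "1 = inner (M A e) e" using ED(5)[OF e e] by simp
    also have "\<dots> = (\<Sum>j\<in>{1..m}. p j * (\<Sum>g\<in>G j. w j g e))"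
      unfolding inner_M[OF ED(4)[OF e]] using expand(1)[OF _ BH BH] e
      by (intro sum.cong refl) (simp add: w_def power2_eq_square)
    finally show ?thesis by simp
  qed
  have wM': "(\<Sum>j\<in>{1..m}. p j * (\<Sum>g\<in>G j. \<nu> j g * w j g e)) = \<mu> e" if e: "e \<in> E" for e
    unfolding \<mu>_def inner_M[OF ED(4)[OF e]] using expand(2)[OF _ BH BH] e
    by (intro sum.cong refl) (simp add: w_def power2_eq_square)
  have detM': "det_on H (M A') = det_on H (M A) * (\<Prod>e\<in>E. \<mu> e)"
    unfolding \<mu>_def
    by (rule det_on_diagonal[OF subspace_H PM M_image symmetric_formD(1)[OF symM'] M_image E ME])
  have detA': "det_on (Hj j) (A' j) = det_on (Hj j) (A j) * (\<Prod>g\<in>G j. \<nu> j g)" if j: "j \<in> {1..m}" for j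
    unfolding \<nu>_def
    by (rule det_on_diagonal[OF datumD(1)[OF j] inputD(1,2)[OF A j] inputD(3,2)[OF A' j] G[OF j] GA'[OF j]])
  have logs: "(\<Sum>j\<in>{1..m}. p j * (\<Sum>g\<in>G j. ln (\<nu> j g))) = (\<Sum>e\<in>E. ln (\<mu> e))"
  proof -
    have eq: "ratio A' = ratio A"
      using ex ex' by (auto simp: extremiser_iff intro: antisym)
    have dM: "det_on H (M A) > 0" using ex A by (simp add: extremiser_iff)
    have pow: "det_on (Hj j) (A' j) powr p j
        = det_on (Hj j) (A j) powr p j * exp (p j * (\<Sum>g\<in>G j. ln (\<nu> j g)))" if j: "j \<in> {1..m}" for j
    proof -
      have pos: "(\<Prod>g\<in>G j. \<nu> j g) > 0" using \<nu>[OF j] by (rule prod_pos)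
      have "\<nu> j g \<noteq> 0" if "g \<in> G j" for g using \<nu>[OF j that] by simp
      then have "ln (\<Prod>g\<in>G j. \<nu> j g) = (\<Sum>g\<in>G j. ln (\<nu> j g))" using finG[OF j] by (intro ln_prod)
      then have "(\<Prod>g\<in>G j. \<nu> j g) powr p j = exp (p j * (\<Sum>g\<in>G j. ln (\<nu> j g)))"
        using pos by (simp add: powr_def)
      then show ?thesis using pos inputD(4)[OF A j] by (simp add: detA'[OF j] powr_mult)
    qed
    define C where "C = (\<Prod>j\<in>{1..m}. det_on (Hj j) (A j) powr p j)"
    have C: "C > 0" unfolding C_def using inputD(4)[OF A] by (intro prod_pos) fastforce
    have "(\<Prod>j\<in>{1..m}. det_on (Hj j) (A' j) powr p j)
        = C * exp (\<Sum>j\<in>{1..m}. p j * (\<Sum>g\<in>G j. ln (\<nu> j g)))"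
      using pow by (simp add: C_def prod.distrib exp_sum)
    moreover have "(\<Prod>e\<in>E. \<mu> e) = exp (\<Sum>e\<in>E. ln (\<mu> e))"
      using ED(1) \<mu> by (simp add: exp_sum)
    ultimately have "ratio A' = ratio A
        * (exp (\<Sum>j\<in>{1..m}. p j * (\<Sum>g\<in>G j. ln (\<nu> j g))) / exp (\<Sum>e\<in>E. ln (\<mu> e)))"
      by (simp add: ratio_def detM' C_def)
    then have "exp (\<Sum>j\<in>{1..m}. p j * (\<Sum>g\<in>G j. ln (\<nu> j g))) = exp (\<Sum>e\<in>E. ln (\<mu> e))"
      unfolding eq using ratio_pos[OF A dM] by (simp add: field_simps del: exp_inj_iff)
    then show ?thesis by simp
  qed
  \<comment> \<open>the gap in \<open>ln x \<le> x - 1\<close>, which vanishes only at \<open>1\<close>\<close>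
  define d where "d = (\<lambda>x::real. x - 1 - ln x)"
  have d0: "d x \<ge> 0" if "x > 0" for x using ln_le_minus_one[OF that] by (simp add: d_def)
  have d1: "x = 1" if "x > 0" "d x = 0" for x using ln_eq_minus_one[OF that(1)] that(2) by (simp add: d_def)
  have "(\<Sum>j\<in>{1..m}. \<Sum>g\<in>G j. \<Sum>e\<in>E. p j * w j g e * d (\<nu> j g / \<mu> e)) = 0"
  proof -
    have "p j * w j g e * d (\<nu> j g / \<mu> e) = (1 / \<mu> e) * (p j * (\<nu> j g * w j g e)) - p j * w j g e
        - ln (\<nu> j g) * (p j * w j g e) + ln (\<mu> e) * (p j * w j g e)"
      if "j \<in> {1..m}" "g \<in> G j" "e \<in> E" for j g e
      using \<mu>[OF that(3)] \<nu>[OF that(1,2)] by (simp add: d_def ln_div algebra_simps)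
    then have "(\<Sum>j\<in>{1..m}. \<Sum>g\<in>G j. \<Sum>e\<in>E. p j * w j g e * d (\<nu> j g / \<mu> e))
      = (\<Sum>j\<in>{1..m}. \<Sum>g\<in>G j. \<Sum>e\<in>E. (1 / \<mu> e) * (p j * (\<nu> j g * w j g e)))
      - (\<Sum>j\<in>{1..m}. \<Sum>g\<in>G j. \<Sum>e\<in>E. p j * w j g e)
      - (\<Sum>j\<in>{1..m}. \<Sum>g\<in>G j. \<Sum>e\<in>E. ln (\<nu> j g) * (p j * w j g e))
      + (\<Sum>j\<in>{1..m}. \<Sum>g\<in>G j. \<Sum>e\<in>E. ln (\<mu> e) * (p j * w j g e))"
      by (simp add: sum.distrib sum_subtractf)
    moreover have swap: "(\<Sum>j\<in>{1..m}. \<Sum>g\<in>G j. \<Sum>e\<in>E. k e * F j g e)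
        = (\<Sum>e\<in>E. k e * (\<Sum>j\<in>{1..m}. \<Sum>g\<in>G j. F j g e))" for k :: "'a \<Rightarrow> real" and F
    proof -
      have "(\<Sum>j\<in>{1..m}. \<Sum>g\<in>G j. \<Sum>e\<in>E. k e * F j g e) = (\<Sum>j\<in>{1..m}. \<Sum>e\<in>E. \<Sum>g\<in>G j. k e * F j g e)"
        by (intro sum.cong refl sum.swap)
      also have "\<dots> = (\<Sum>e\<in>E. \<Sum>j\<in>{1..m}. \<Sum>g\<in>G j. k e * F j g e)" by (rule sum.swap)
      finally show ?thesis by (simp add: sum_distrib_left)
    qed
    moreover have "(\<Sum>j\<in>{1..m}. \<Sum>g\<in>G j. \<Sum>e\<in>E. (1 / \<mu> e) * (p j * (\<nu> j g * w j g e))) = real (card E)"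
      unfolding swap using wM' \<mu> by (simp add: sum_distrib_left[symmetric] order_less_imp_not_eq2)
    moreover have "(\<Sum>j\<in>{1..m}. \<Sum>g\<in>G j. \<Sum>e\<in>E. p j * w j g e) = real (card E)"
      using swap[of "\<lambda>_. 1" "\<lambda>j g e. p j * w j g e"] wM by (simp add: sum_distrib_left[symmetric])
    moreover have "(\<Sum>j\<in>{1..m}. \<Sum>g\<in>G j. \<Sum>e\<in>E. ln (\<nu> j g) * (p j * w j g e))
        = (\<Sum>j\<in>{1..m}. p j * (\<Sum>g\<in>G j. ln (\<nu> j g)))"
      using w1 by (simp add: sum_distrib_left[symmetric] mult.commute sum_distrib_right[symmetric])
    moreover have "(\<Sum>j\<in>{1..m}. \<Sum>g\<in>G j. \<Sum>e\<in>E. ln (\<mu> e) * (p j * w j g e)) = (\<Sum>e\<in>E. ln (\<mu> e))"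
      unfolding swap using wM by (simp add: sum_distrib_left[symmetric])
    ultimately show ?thesis using logs by simp
  qed
  moreover have nn: "p j * w j g e * d (\<nu> j g / \<mu> e) \<ge> 0" if "j \<in> {1..m}" "g \<in> G j" "e \<in> E" for j g e
    using datumD(4)[OF that(1)] d0[of "\<nu> j g / \<mu> e"] \<mu>[OF that(3)] \<nu>[OF that(1,2)]
    by (simp add: w_def)
  ultimately have zero: "p j * w j g e * d (\<nu> j g / \<mu> e) = 0"
    if j: "j \<in> {1..m}" and g: "g \<in> G j" and e: "e \<in> E" for j g e
  proof -
    have "(\<Sum>g\<in>G j. \<Sum>e\<in>E. p j * w j g e * d (\<nu> j g / \<mu> e)) = 0"
      by (rule sum_nonneg_0[OF finite_atLeastAtMost _ \<open>(\<Sum>j\<in>{1..m}. \<Sum>g\<in>G j. \<Sum>e\<in>E. p j * w j g e * d (\<nu> j g / \<mu> e)) = 0\<close> j])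
        (use nn in \<open>blast intro: sum_nonneg\<close>)
    then have "(\<Sum>e\<in>E. p j * w j g e * d (\<nu> j g / \<mu> e)) = 0"
      by (rule sum_nonneg_0[OF finG[OF j] _ _ g, rotated]) (use nn j in \<open>blast intro: sum_nonneg\<close>)
    then show ?thesis
      by (rule sum_nonneg_0[OF ED(1) _ _ e, rotated]) (use nn j g in blast)
  qed
  have match: "\<nu> j g = \<mu> e" if j: "j \<in> {1..m}" and g: "g \<in> G j" and e: "e \<in> E" and ne: "inner (A j g) (B j e) \<noteq> 0" for j g e
  proof -
    have "d (\<nu> j g / \<mu> e) = 0" using zero[OF j g e] datumD(4)[OF j] ne by (simp add: w_def)
    then have "\<nu> j g / \<mu> e = 1" using d1[of "\<nu> j g / \<mu> e"] \<mu>[OF e] \<nu>[OF j g] by simp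
    then show ?thesis using \<mu>[OF e] by simp
  qed
  \<comment> \<open>The eigenspace of \<open>\<mu> e\<close> has defect \<open>0\<close>, so it is critical unless it is all of \<open>H\<close>.\<close>
  have const: "\<mu> e = \<mu> e'" if ee: "e \<in> E" "e' \<in> E" for e e'
  proof -
    define E1 where "E1 = {f\<in>E. \<mu> f = \<mu> e}"
    define E2 where "E2 = {f\<in>E. \<mu> f \<noteq> \<mu> e}"
    have EE: "E1 \<union> E2 = E" "E1 \<inter> E2 = {}" by (auto simp: E1_def E2_def)
    define V where "V = span E1"
    have V: "subspace V" "V \<subseteq> H" using span_mono[of E1 E] ED(7) EE(1) by (auto simp: V_def)
    have PV: "positive_form V (M A)" using positive_form_mono[OF PM V(2)] .
    have E1: "basis_wrt (M A) V E1"
      by (rule basis_wrtI[OF positive_formD(2)[OF PM]]) (use ED(1,5) EE in \<open>auto simp: V_def span_base\<close>)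
    have orth: "inner (A j x) (B j f) = 0" if j: "j \<in> {1..m}" and x: "x \<in> B j ` V" and f: "f \<in> E2" for j x f
    proof -
      have "inner (A j (B j v)) (B j f) = 0" if "v \<in> span E1" for v
        using that
      proof (induction rule: span_induct)
        case base
        show ?case
          by (auto simp: subspace_def linear_0[OF datumD(2)[OF j]] linear_0[OF inputD(3)[OF A j]]
              linear_add[OF datumD(2)[OF j]] linear_add[OF inputD(3)[OF A j]]
              linear_cmul[OF datumD(2)[OF j]] linear_cmul[OF inputD(3)[OF A j]] inner_add_left)
      next
        case (step v)
        have "inner (A j g) (B j v) * inner (A j g) (B j f) = 0" if "g \<in> G j" for g
        proof (rule ccontr)
          assume "inner (A j g) (B j v) * inner (A j g) (B j f) \<noteq> 0"
          then have "\<nu> j g = \<mu> v" "\<nu> j g = \<mu> f"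
            using match[OF j that] step f by (auto simp: E1_def E2_def)
          then show False using step f by (simp add: E1_def E2_def)
        qed
        then have "(\<Sum>g\<in>G j. inner (A j g) (B j v) * inner (A j g) (B j f)) = 0"
          by (intro sum.neutral ballI)
        then show ?case using expand(1)[OF j BH[OF j, of v] BH[OF j, of f]] step f
          by (simp add: E1_def E2_def)
      qed
      then show ?thesis using x by (auto simp: V_def)
    qed
    have "\<forall>j\<in>{1..m}. \<exists>F. basis_wrt (A j) (B j ` V) F" using image_basis(3)[OF A V] by blast
    then obtain F where F: "\<And>j. j \<in> {1..m} \<Longrightarrow> basis_wrt (A j) (B j ` V) (F j)" by metis
    have "real (dim V) + (\<Sum>j\<in>{1..m}. p j * (\<Sum>g\<in>F j. \<Sum>e\<in>E2. (inner (A j g) (B j e))\<^sup>2))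
      = (\<Sum>j\<in>{1..m}. p j * real (dim (B j ` V)))"
      by (rule defect_formula[OF _ EE(2) V E1 _ _ _ F]) (use iso EE(1) image_basis[OF A V] in auto)
    moreover have "(\<Sum>j\<in>{1..m}. p j * (\<Sum>g\<in>F j. \<Sum>e\<in>E2. (inner (A j g) (B j e))\<^sup>2)) = 0"
    proof (rule sum.neutral, rule ballI)
      fix j assume j: "j \<in> {1..m}"
      have "F j \<subseteq> B j ` V" using F[OF j] by (simp add: basis_wrt_def)
      then have "(\<Sum>g\<in>F j. \<Sum>e\<in>E2. (inner (A j g) (B j e))\<^sup>2) = 0"
        using orth[OF j] by (intro sum.neutral ballI) auto
      then show "p j * (\<Sum>g\<in>F j. \<Sum>e\<in>E2. (inner (A j g) (B j e))\<^sup>2) = 0" by simp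
    qed
    moreover have "V \<noteq> {0}" using ee(1) e0[OF ee(1)] span_base[of e E1] by (auto simp: V_def E1_def)
    ultimately have "V = H"
      using simple V by (auto simp: simple_def critical_subspace_def)
    then have "card E1 = card E" using ED(3) E1 by (simp add: basis_wrt_def)
    then have "E1 = E" using EE(1) ED(1) by (intro card_subset_eq) auto
    then have "e' \<in> E1" using ee(2) by simp
    then show ?thesis by (simp add: E1_def)
  qed
  have "\<exists>c>0. \<forall>e\<in>E. \<mu> e = c"
  proof (cases "E = {}")
    case True then show ?thesis by (intro exI[of _ 1]) simp
  next
    case False then show ?thesis using const \<mu> by blast
  qed
  then obtain c where c: "c > 0" "\<And>e. e \<in> E \<Longrightarrow> \<mu> e = c" by blast
  have \<nu>c: "\<nu> j g = c" if j: "j \<in> {1..m}" and g: "g \<in> G j" for j g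
  proof -
    have "\<exists>e\<in>E. w j g e \<noteq> 0"
    proof (rule ccontr)
      assume "\<not> ?thesis"
      then show False using w1[OF j g] by simp
    qed
    then show ?thesis using match[OF j g] c(2) by (auto simp: w_def)
  qed
  have "A' j x = c *\<^sub>R A j x" if j: "j \<in> {1..m}" and x: "x \<in> Hj j" for j x
  proof (rule eq_in_subspaceI[OF datumD(1)[OF j]])
    show "A' j x \<in> Hj j" "c *\<^sub>R A j x \<in> Hj j"
      using x inputD(2)[OF A j] inputD(2)[OF A' j] datumD(1)[OF j] by (auto intro: subspace_scale)
    show "inner (A' j x) v = inner (c *\<^sub>R A j x) v" if v: "v \<in> Hj j" for v
      using expand[OF j x v] \<nu>c[OF j] by (simp add: sum_distrib_left)
  qed
  then show ?thesis using c(1) by blast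
qed

section \<open>Existence for simple data\<close>

text \<open>
  The dimension condition for \<open>H\<close> itself and the scaling condition leave no room for a proper image, as all
  \<open>p j\<close> are positive.
\<close>

lemma feasible_surjective:
  assumes feas: "feasible m H Hj B p" and j: "j \<in> {1..m}"
  shows "B j ` H = Hj j"
proof (rule ccontr)
  assume ne: "B j ` H \<noteq> Hj j"
  have sub: "B i ` H \<subseteq> Hj i" if "i \<in> {1..m}" for i using datumD(3)[OF that] by blast
  have le: "p i * real (dim (B i ` H)) \<le> p i * real (dim (Hj i))" if "i \<in> {1..m}" for i
    using dim_subset[OF sub[OF that]] datumD(4)[OF that] by simp
  have "dim (B j ` H) \<noteq> dim (Hj j)"
    using ne subspace_dim_equal[OF linear_subspace_image[OF datumD(2)[OF j] subspace_H] datumD(1)[OF j] sub[OF j]]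
    by auto
  then have "p j * real (dim (B j ` H)) < p j * real (dim (Hj j))"
    using dim_subset[OF sub[OF j]] datumD(4)[OF j] by simp
  then have "(\<Sum>i\<in>{1..m}. p i * real (dim (B i ` H))) < (\<Sum>i\<in>{1..m}. p i * real (dim (Hj i)))"
    using le j by (intro sum_strict_mono_ex1) auto
  moreover have "real (dim H) \<le> (\<Sum>i\<in>{1..m}. p i * real (dim (B i ` H)))"
    "real (dim H) = (\<Sum>i\<in>{1..m}. p i * real (dim (Hj i)))"
    using feas subspace_H by (auto simp: feasible_def)
  ultimately show False by linarith
qed

text \<open>
  A null vector of \<open>M A\<close> is killed by every \<open>B\<^sub>j\<close>, and the line through it would violate the dimension condition.
\<close>

lemma feasible_M_positive:
  assumes feas: "feasible m H Hj B p" and A: "gaussian_input m Hj A"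
  shows "positive_form H (M A)"
  unfolding positive_form_def
proof (intro conjI M_symmetric[OF A] ballI impI)
  fix x assume x: "x \<in> H" "x \<noteq> 0"
  have nn: "0 \<le> p j * inner (A j (B j x)) (B j x)" if j: "j \<in> {1..m}" for j
    using positive_formD(5)[OF inputD(1)[OF A j] datumD(3)[OF j x(1)]] datumD(4)[OF j] by simp
  show "inner (M A x) x > 0"
  proof (rule ccontr)
    assume "\<not> ?thesis"
    then have 0: "(\<Sum>j\<in>{1..m}. p j * inner (A j (B j x)) (B j x)) = 0"
      using M_nonneg[OF A x(1)] inner_M[OF x(1)] by simp
    have B0: "B j x = 0" if j: "j \<in> {1..m}" for j
    proof -
      have "p j * inner (A j (B j x)) (B j x) = 0"
        using sum_nonneg_0[OF finite_atLeastAtMost nn 0 j] .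
      then show ?thesis
        using positive_formD(4)[OF inputD(1)[OF A j] datumD(3)[OF j x(1)]] datumD(4)[OF j] by fastforce
    qed
    have "real (dim (span {x})) \<le> (\<Sum>j\<in>{1..m}. p j * real (dim (B j ` span {x})))"
      using feas x(1) subspace_H span_minimal[of "{x}" H] by (auto simp: feasible_def)
    also have "\<dots> = 0"
    proof (rule sum.neutral, rule ballI)
      fix j assume j: "j \<in> {1..m}"
      have e: "B j ` span {x} = {0}" using linear_span_image[OF datumD(2)[OF j], of "{x}"] B0[OF j] by simp
      show "p j * real (dim (B j ` span {x})) = 0" unfolding e by simp
    qed
    finally show False using x(2) by (simp add: dim_span)
  qed
qed

text \<open>
  Records what the compactness argument uses of an orthonormal eigenbasis \<open>e\<close> of \<open>M A\<close> with increasing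
  eigenvalues \<open>\<mu>\<close>, the largest of which is \<open>1\<close>. The bound of \<open>M A\<close> by the inner product makes the entries of
  the \<open>A\<^sub>j\<close> bounded.
\<close>

definition normalised :: "(nat \<Rightarrow> 'b \<Rightarrow> 'b) \<Rightarrow> (nat \<Rightarrow> 'a) \<Rightarrow> (nat \<Rightarrow> real) \<Rightarrow> bool" where
  "normalised A e \<mu> \<longleftrightarrow> gaussian_input m Hj A \<and> (\<forall>i<dim H. e i \<in> H) \<and>
     (\<forall>i<dim H. \<forall>k<dim H. inner (e i) (e k) = (if i = k then 1 else 0)) \<and>
     (\<forall>i<dim H. inner (M A (e i)) (e i) = \<mu> i) \<and>
     0 < \<mu> 0 \<and> (\<forall>i k. i \<le> k \<longrightarrow> k < dim H \<longrightarrow> \<mu> i \<le> \<mu> k) \<and> \<mu> (dim H - 1) = 1 \<and>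
     det_on H (M A) = (\<Prod>i<dim H. \<mu> i) \<and> (\<forall>x\<in>H. inner (M A x) x \<le> inner x x)"

lemma ratio_scale:
  assumes feas: "feasible m H Hj B p" and A: "gaussian_input m Hj A" and c: "c > 0"
  shows "gaussian_input m Hj (\<lambda>j x. c *\<^sub>R A j x)"
    "x \<in> H \<Longrightarrow> M (\<lambda>j x. c *\<^sub>R A j x) x = c *\<^sub>R M A x"
    "ratio (\<lambda>j x. c *\<^sub>R A j x) = ratio A"
proof -
  show "gaussian_input m Hj (\<lambda>j x. c *\<^sub>R A j x)"
  proof (rule inputI)
    fix j assume j: "j \<in> {1..m}"
    note I = inputD(1,2,3)[OF A j]
    show "(\<lambda>x. c *\<^sub>R A j x) ` Hj j \<subseteq> Hj j" using I(2) datumD(1)[OF j] by (auto intro: subspace_scale)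
    show "positive_form (Hj j) (\<lambda>x. c *\<^sub>R A j x)"
      using I(1) c unfolding positive_form_def symmetric_form_def by (auto intro: linear_compose_scale_right)
  qed
  show Mc: "M (\<lambda>j x. c *\<^sub>R A j x) x = c *\<^sub>R M A x" if "x \<in> H" for x
    using M_in_H subspace_H
    by (intro eq_in_subspaceI[OF subspace_H])
      (auto simp: subspace_scale inner_M sum_distrib_left algebra_simps intro!: sum.cong)
  have pw: "(c ^ k) powr q = c powr (q * real k)" for k q
    using c by (simp add: powr_realpow[symmetric] powr_powr mult.commute)
  have "(\<Prod>j\<in>{1..m}. det_on (Hj j) (\<lambda>x. c *\<^sub>R A j x) powr p j)
      = (\<Prod>j\<in>{1..m}. c powr (p j * real (dim (Hj j))) * det_on (Hj j) (A j) powr p j)"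
  proof (rule prod.cong[OF refl])
    fix j assume j: "j \<in> {1..m}"
    show "det_on (Hj j) (\<lambda>x. c *\<^sub>R A j x) powr p j
      = c powr (p j * real (dim (Hj j))) * det_on (Hj j) (A j) powr p j"
      using c inputD(4)[OF A j]
      by (simp add: det_on_scale[OF datumD(1)[OF j] inputD(3,2)[OF A j]] powr_mult pw)
  qed
  also have "\<dots> = c powr real (dim H) * (\<Prod>j\<in>{1..m}. det_on (Hj j) (A j) powr p j)"
    using feas c by (simp add: feasible_def prod.distrib powr_sum)
  moreover have "det_on H (M (\<lambda>j x. c *\<^sub>R A j x)) = c powr real (dim H) * det_on H (M A)"
    using det_on_cong[OF subspace_H Mc] det_on_scale[OF subspace_H symmetric_formD(1)[OF M_symmetric[OF A]] M_image, of c] c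
    by (simp add: powr_realpow)
  ultimately show "ratio (\<lambda>j x. c *\<^sub>R A j x) = ratio A" using c by (simp add: ratio_def)
qed

lemma normalised_exists:
  assumes feas: "feasible m H Hj B p" and A: "gaussian_input m Hj A" and n: "dim H > 0"
  shows "\<exists>A' e \<mu>. normalised A' e \<mu> \<and> ratio A' = ratio A"
proof -
  note PM = feasible_M_positive[OF feas A]
  obtain E where E: "basis_wrt (\<lambda>x. x) H E"
    and EM: "\<And>x y. x \<in> E \<Longrightarrow> y \<in> E \<Longrightarrow> x \<noteq> y \<Longrightarrow> inner (M A x) y = 0"
    using simultaneous_diagonalisation[OF subspace_H positive_form_inner M_symmetric[OF A]] by blast
  note ED = basis_wrtD[OF subspace_H positive_form_inner E]
  define key where "key = (\<lambda>e. inner (M A e) e)"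
  obtain xs where xs: "set xs = E" "distinct xs" using finite_distinct_list[OF ED(1)] by blast
  define ys where "ys = sort_key key xs"
  have ys: "set ys = E" "distinct ys" "sorted (map key ys)" by (simp_all add: ys_def xs)
  have len: "length ys = dim H" using ys ED(3) distinct_card by fastforce
  have ysE: "ys ! i \<in> E" if "i < dim H" for i using that len ys(1) nth_mem by auto
  have keypos: "key e > 0" if "e \<in> E" for e
  proof -
    have "e \<noteq> 0" using ED(5)[OF that that] by auto
    then show ?thesis using positive_formD(4)[OF PM ED(4)[OF that]] by (simp add: key_def)
  qed
  define c where "c = 1 / key (ys ! (dim H - 1))"
  have c: "c > 0" using keypos[OF ysE[of "dim H - 1"]] n by (simp add: c_def)
  define A' where "A' = (\<lambda>j x. c *\<^sub>R A j x)"
  note sc = ratio_scale[OF feas A c, folded A'_def]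
  define \<mu> where "\<mu> = (\<lambda>i. c * key (ys ! i))"
  have mono: "key (ys ! i) \<le> key (ys ! k)" if "i \<le> k" "k < dim H" for i k
    using ys(3) that len sorted_nth_mono[of "map key ys" i k] by simp
  have Me: "inner (M A' e) f = (if e = f then c * key e else 0)" if "e \<in> E" "f \<in> E" for e f
    using sc(2)[OF ED(4)[OF that(1)]] EM[OF that] by (auto simp: key_def)
  have "det_on H (M A') = (\<Prod>e\<in>E. inner (M A' e) e)"
    using det_on_diagonal[OF subspace_H positive_form_inner _ symmetric_formD(1)[OF M_symmetric[OF sc(1)]] M_image E] Me
    by (simp add: det_on_id[OF subspace_H])
  also have "\<dots> = (\<Prod>i<dim H. inner (M A' (ys ! i)) (ys ! i))"
    using bij_betw_nth[OF ys(2), of "{..<dim H}" E] ys(1) len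
    by (intro prod.reindex_bij_betw[symmetric]) auto
  also have "\<dots> = (\<Prod>i<dim H. \<mu> i)" using Me ysE by (simp add: \<mu>_def)
  finally have det: "det_on H (M A') = (\<Prod>i<dim H. \<mu> i)" .
  have le: "inner (M A' x) x \<le> inner x x" if x: "x \<in> H" for x
  proof -
    note linM = symmetric_formD(1)[OF M_symmetric[OF sc(1)]]
    have "inner (M A' x) x = (\<Sum>e\<in>E. inner x e * inner (M A' e) x)"
      by (rule Parseval_wrt[OF subspace_H positive_form_inner E x linM])
    also have "\<dots> = (\<Sum>e\<in>E. (c * key e) * (inner x e)\<^sup>2)"
    proof (rule sum.cong[OF refl])
      fix e assume e: "e \<in> E"
      have "inner (M A' e) x = inner (M A' x) e"
        using symmetric_formD(2)[OF M_symmetric[OF sc(1)] ED(4)[OF e] x] .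
      also have "\<dots> = (\<Sum>f\<in>E. inner x f * inner (M A' f) e)"
        by (rule Parseval_wrt[OF subspace_H positive_form_inner E x linM])
      also have "\<dots> = (\<Sum>f\<in>E. if f = e then inner x e * (c * key e) else 0)"
        using Me e by (intro sum.cong) auto
      also have "\<dots> = inner x e * (c * key e)" using ED(1) e by simp
      finally show "inner x e * inner (M A' e) x = (c * key e) * (inner x e)\<^sup>2"
        by (simp add: power2_eq_square)
    qed
    also have "\<dots> \<le> (\<Sum>e\<in>E. (inner x e)\<^sup>2)"
    proof (rule sum_mono)
      fix e assume "e \<in> E"
      then obtain i where i: "i < dim H" "e = ys ! i" using ys(1) len by (metis in_set_conv_nth)
      have "key e \<le> key (ys ! (dim H - 1))" using mono[of i "dim H - 1"] i by simp
      then have "c * key e \<le> 1" using keypos[OF ysE[of "dim H - 1"]] n by (simp add: c_def)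
      then show "(c * key e) * (inner x e)\<^sup>2 \<le> (inner x e)\<^sup>2"
        using mult_right_mono[of "c * key e" 1 "(inner x e)\<^sup>2"] by simp
    qed
    also have "\<dots> = inner x x"
      using Parseval_wrt[OF subspace_H positive_form_inner E x linear_ident, of x]
      by (simp add: power2_eq_square inner_commute)
    finally show ?thesis .
  qed
  have "normalised A' (nth ys) \<mu>"
    unfolding normalised_def
  proof (intro conjI allI impI ballI sc(1) det le)
    show "ys ! i \<in> H" if "i < dim H" for i using ysE[OF that] ED(4) by blast
    show "inner (ys ! i) (ys ! k) = (if i = k then 1 else 0)" if "i < dim H" "k < dim H" for i k
      using ED(5)[OF ysE[OF that(1)] ysE[OF that(2)]] that ys(2) len by (simp add: nth_eq_iff_index_eq)
    show "inner (M A' (ys ! i)) (ys ! i) = \<mu> i" if "i < dim H" for i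
      using Me[OF ysE[OF that] ysE[OF that]] by (simp add: \<mu>_def)
    show "0 < \<mu> 0" using c keypos[OF ysE[OF n]] by (simp add: \<mu>_def)
    show "\<mu> i \<le> \<mu> k" if "i \<le> k" "k < dim H" for i k using mono[OF that] c by (simp add: \<mu>_def)
    show "\<mu> (dim H - 1) = 1" using keypos[OF ysE[of "dim H - 1"]] n by (simp add: \<mu>_def c_def)
  qed
  then show ?thesis using sc(3) by blast
qed

lemma normalised_form_bound:
  assumes norm: "normalised A e \<mu>" and j: "j \<in> {1..m}" and h: "h \<in> H"
  shows "inner (A j (B j h)) (B j h) \<le> inner (M A h) h / p j"
proof -
  have A: "gaussian_input m Hj A" using norm by (simp add: normalised_def)
  have "0 \<le> p i * inner (A i (B i h)) (B i h)" if i: "i \<in> {1..m}" for i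
    using positive_formD(5)[OF inputD(1)[OF A i] datumD(3)[OF i h]] datumD(4)[OF i] by simp
  then have "p j * inner (A j (B j h)) (B j h) \<le> inner (M A h) h"
    unfolding inner_M[OF h] using j by (intro member_le_sum) auto
  then show ?thesis using datumD(4)[OF j] by (simp add: field_simps)
qed

lemma normalised_entries_bounded:
  assumes feas: "feasible m H Hj B p" and norm: "\<And>k. normalised (A k) (e k) (\<mu> k)"
    and j: "j \<in> {1..m}" and x: "x \<in> Hj j" and y: "y \<in> Hj j"
  shows "bounded (range (\<lambda>k. inner (A k j x) y))"
proof -
  have "x \<in> B j ` H" "y \<in> B j ` H" using x y feasible_surjective[OF feas j] by simp_all
  then obtain h h' where h: "h \<in> H" "h' \<in> H" "B j h = x" "B j h' = y" by (elim imageE) simp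
  define C where "C = (inner h h / p j) * (inner h' h' / p j)"
  have "\<bar>inner (A k j x) y\<bar> \<le> sqrt C" for k
  proof -
    have A: "gaussian_input m Hj (A k)" and le: "\<And>v. v \<in> H \<Longrightarrow> inner (M (A k) v) v \<le> inner v v"
      using norm[of k] by (auto simp: normalised_def)
    note P = inputD(1)[OF A j]
    have b: "inner (A k j (B j v)) (B j v) \<le> inner v v / p j" if "v \<in> H" for v
      using normalised_form_bound[OF norm[of k] j that] divide_right_mono[OF le[OF that], of "p j"] datumD(4)[OF j]
      by linarith
    have "(inner (A k j x) y)\<^sup>2 \<le> inner (A k j x) x * inner (A k j y) y"
      by (rule form_Cauchy_Schwarz[OF datumD(1)[OF j] positive_formD(1)[OF P] positive_formD(5)[OF P] x y])
    also have "\<dots> \<le> C"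
      unfolding C_def using b[OF h(1)] b[OF h(2)] positive_formD(5)[OF P x] positive_formD(5)[OF P y]
        datumD(4)[OF j] h by (intro mult_mono) auto
    finally show ?thesis by (simp add: real_le_rsqrt)
  qed
  then show ?thesis by (auto simp: bounded_iff)
qed

text \<open>
  The squared volume of the family \<open>B\<^sub>j (e k i)\<close>, \<open>i \<in> I\<close>, converges to a positive limit. Once it is bounded below, the determinant
  of \<open>A\<^sub>j\<close> is controlled by the values of the form on this family, and these are at most \<open>\<mu> k i / p j\<close>.
\<close>

lemma normalised_det_bound:
  assumes norm: "\<And>k. normalised (A k) (e k) (\<mu> k)"
    and lim: "\<And>i. i < dim H \<Longrightarrow> (\<lambda>k. e k i) \<longlonglongrightarrow> f i" and f: "\<And>i. i < dim H \<Longrightarrow> f i \<in> H"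
    and j: "j \<in> {1..m}" and I: "I \<subseteq> {..<dim H}" "card I = dim (Hj j)"
    and inj: "inj_on (\<lambda>i. B j (f i)) I" and ind: "independent ((\<lambda>i. B j (f i)) ` I)"
  shows "\<exists>C>0. \<forall>\<^sub>F k in sequentially. det_on (Hj j) (A k j) \<le> C * (\<Prod>i\<in>I. \<mu> k i)"
proof -
  define d where "d = dim (Hj j)"
  have finI: "finite I" using I(1) finite_subset by blast
  obtain h where h: "bij_betw h {..<d} I"
    using ex_bij_betw_nat_finite[OF finI] I(2) by (auto simp: d_def lessThan_atLeast0)
  have hI: "h i \<in> I" "h i < dim H" if "i < d" for i
    using h that I(1) by (auto simp: bij_betw_def)
  obtain bs where bs: "orthonormal_basis_list (Hj j) bs"
    using orthonormal_basis_list_exists[OF datumD(1)[OF j]] by blast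
  define g where "g = (\<lambda>k. gram d (nth bs) (\<lambda>i. B j (e k (h i))))"
  define \<gamma> where "\<gamma> = gram d (nth bs) (\<lambda>i. B j (f (h i)))"
  have "\<gamma> \<noteq> 0"
    unfolding \<gamma>_def d_def
  proof (rule gram_basis_nonzero[OF datumD(1)[OF j] bs])
    show "B j (f (h i)) \<in> Hj j" if "i < dim (Hj j)" for i
      using hI(2)[of i] that f datumD(3)[OF j] by (simp add: d_def)
    show "inj_on (\<lambda>i. B j (f (h i))) {..<dim (Hj j)}"
      using comp_inj_on[of h "{..<d}" "\<lambda>i. B j (f i)"] h inj by (simp add: bij_betw_def comp_def d_def)
    have "(\<lambda>i. B j (f (h i))) ` {..<dim (Hj j)} = (\<lambda>i. B j (f i)) ` (h ` {..<d})"
      by (simp add: image_image d_def)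
    then show "independent ((\<lambda>i. B j (f (h i))) ` {..<dim (Hj j)})"
      using h ind by (simp add: bij_betw_def)
  qed
  have "bounded_linear (B j)" using datumD(2)[OF j] by (simp add: linear_conv_bounded_linear)
  then have "g \<longlonglongrightarrow> \<gamma>"
    unfolding g_def \<gamma>_def using lim hI(2)
    by (intro tendsto_gram tendsto_inner tendsto_const bounded_linear.tendsto[of "B j"]) auto
  then have "(\<lambda>k. (g k)\<^sup>2) \<longlonglongrightarrow> \<gamma>\<^sup>2" by (intro tendsto_power)
  then have ev: "\<forall>\<^sub>F k in sequentially. \<gamma>\<^sup>2 / 2 < (g k)\<^sup>2"
    using \<open>\<gamma> \<noteq> 0\<close> by (intro order_tendstoD(1)) auto
  define C where "C = fact d / p j ^ d / (\<gamma>\<^sup>2 / 2)"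
  have "C > 0" using \<open>\<gamma> \<noteq> 0\<close> datumD(4)[OF j] by (simp add: C_def)
  moreover have "det_on (Hj j) (A k j) \<le> C * (\<Prod>i\<in>I. \<mu> k i)" if k: "\<gamma>\<^sup>2 / 2 < (g k)\<^sup>2" for k
  proof -
    have A: "gaussian_input m Hj (A k)" and eH: "\<And>i. i < dim H \<Longrightarrow> e k i \<in> H"
      and Me: "\<And>i. i < dim H \<Longrightarrow> inner (M (A k) (e k i)) (e k i) = \<mu> k i"
      using norm[of k] by (auto simp: normalised_def)
    note D = inputD[OF A j]
    define y where "y = (\<lambda>i. B j (e k (h i)))"
    have y: "y i \<in> Hj j" if "i < d" for i using hI(2)[OF that] eH datumD(3)[OF j] by (simp add: y_def)
    have "det_on (Hj j) (A k j) * (\<gamma>\<^sup>2 / 2) \<le> det_on (Hj j) (A k j) * (g k)\<^sup>2"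
      using D(4) k by (intro mult_left_mono) auto
    also have "\<dots> = gram d y (\<lambda>i. A k j (y i))"
      using det_on_gram[OF datumD(1)[OF j] D(3,2) bs, of y] y by (simp add: g_def y_def d_def)
    also have "\<dots> \<le> fact d * (\<Prod>i<d. inner (A k j (y i)) (y i))"
      by (rule gram_le_diagonal[OF datumD(1)[OF j] positive_formD(1)[OF D(1)] positive_formD(5)[OF D(1)] y])
    also have "\<dots> \<le> fact d * (\<Prod>i<d. \<mu> k (h i) / p j)"
      using normalised_form_bound[OF norm[of k] j eH] Me hI(2) positive_formD(5)[OF D(1) y]
      by (intro mult_left_mono prod_mono) (auto simp: y_def)
    also have "(\<Prod>i<d. \<mu> k (h i) / p j) = (\<Prod>i\<in>I. \<mu> k i) / p j ^ d"
      using prod.reindex_bij_betw[OF h, of "\<mu> k"] by (simp add: prod_dividef)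
    finally have "det_on (Hj j) (A k j) \<le> fact d * ((\<Prod>i\<in>I. \<mu> k i) / p j ^ d) / (\<gamma>\<^sup>2 / 2)"
      using \<open>\<gamma> \<noteq> 0\<close> by (subst pos_le_divide_eq) auto
    also have "\<dots> = C * (\<Prod>i\<in>I. \<mu> k i)" by (simp add: C_def)
    finally show ?thesis .
  qed
  ultimately show ?thesis using ev by (intro exI[of _ C]) (auto elim: eventually_mono)
qed

text \<open>
  With the greedy index sets for the limit basis, \<open>i\<close> occurs with total exponent \<open>a i = \<Sum>j. p j [i \<in> I j]\<close>, and
  \<open>\<Sum>i<k. a i = \<Sum>j. p j dim (B\<^sub>j V\<^sub>k)\<close> for the flag \<open>V\<^sub>k\<close>. Feasibility and simplicity are exactly the
  hypotheses needed for summation by parts.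
\<close>

lemma normalised_ratio_bound:
  assumes feas: "feasible m H Hj B p" and simple: "simple m H B p" and n: "dim H > 0"
    and norm: "\<And>k. normalised (A k) (e k) (\<mu> k)"
    and lim: "\<And>i. i < dim H \<Longrightarrow> (\<lambda>k. e k i) \<longlonglongrightarrow> f i"
  shows "\<exists>K>0. \<exists>s>0. \<forall>\<^sub>F k in sequentially. ratio (A k) \<le> K * \<mu> k 0 powr s"
proof -
  define n where "n = dim H"
  have fH: "f i \<in> H" if "i < n" for i
  proof (rule closed_sequentially[OF closed_subspace[OF subspace_H]])
    show "e k i \<in> H" for k using norm[of k] that by (simp add: normalised_def n_def)
    show "(\<lambda>k. e k i) \<longlonglongrightarrow> f i" using lim that by (simp add: n_def)
  qed
  have fon: "inner (f i) (f l) = (if i = l then 1 else 0)" if "i < n" "l < n" for i l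
  proof -
    have "(\<lambda>k. inner (e k i) (e k l)) \<longlonglongrightarrow> inner (f i) (f l)"
      using lim that by (intro tendsto_inner) (auto simp: n_def)
    moreover have "inner (e k i) (e k l) = (if i = l then 1 else 0)" for k
      using norm[of k] that by (simp add: normalised_def n_def)
    ultimately have "(\<lambda>k::nat. if i = l then 1 else 0) \<longlonglongrightarrow> inner (f i) (f l)" by (simp only:)
    then show ?thesis by (simp only: LIMSEQ_const_iff)
  qed
  have finj: "inj_on f {..<n}"
  proof (rule inj_onI)
    fix i l assume "i \<in> {..<n}" "l \<in> {..<n}" "f i = f l"
    then show "i = l" using fon[of i l] fon[of i i] by (auto split: if_splits)
  qed
  have find: "independent (f ` {..<n})"
    by (rule orthonormal_independent[OF linear_ident]) (use fon finj in \<open>auto simp: inj_on_eq_iff\<close>)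
  define V where "V = (\<lambda>k. span (f ` {..<k}))"
  have V: "subspace (V k)" "V k \<subseteq> H" "dim (V k) = k" if "k \<le> n" for k
  proof -
    show "subspace (V k)" by (simp add: V_def)
    show "V k \<subseteq> H" unfolding V_def using fH that subspace_H by (intro span_minimal) auto
    have "f ` {..<k} \<subseteq> f ` {..<n}" using that by auto
    then have "independent (f ` {..<k})" using find independent_mono by blast
    then have "dim (V k) = card (f ` {..<k})" by (simp add: V_def dim_span dim_eq_card_independent)
    also have "\<dots> = k" using card_image[OF inj_on_subset[OF finj, of "{..<k}"]] that by simp
    finally show "dim (V k) = k" .
  qed
  have Vn: "V n = H"
    using subspace_dim_equal[OF V(1) subspace_H V(2), of n] V(3)[of n] by (simp add: n_def)
  define I where "I = (\<lambda>j. greedy (\<lambda>i. B j (f i)) n)"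
  have I: "I j \<subseteq> {..<n}" for j by (auto simp: I_def greedy_def)
  have cardI: "card ({..<k} \<inter> I j) = dim (B j ` V k)" if j: "j \<in> {1..m}" and k: "k \<le> n" for j k
  proof -
    have "{..<k} \<inter> I j = greedy (\<lambda>i. B j (f i)) k" using k by (auto simp: I_def greedy_def)
    moreover have "B j ` V k = span ((\<lambda>i. B j (f i)) ` {..<k})"
      using linear_span_image[OF datumD(2)[OF j], of "f ` {..<k}"] by (simp add: V_def image_image)
    ultimately show ?thesis using greedy(3) by (metis dim_span)
  qed
  define a where "a = (\<lambda>i. \<Sum>j\<in>{1..m}. p j * (if i \<in> I j then 1 else 0))"
  have asum: "(\<Sum>i<k. a i) = (\<Sum>j\<in>{1..m}. p j * real (dim (B j ` V k)))" if "k \<le> n" for k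
  proof -
    have "(\<Sum>i<k. a i) = (\<Sum>j\<in>{1..m}. \<Sum>i<k. p j * (if i \<in> I j then 1 else 0))"
      unfolding a_def by (rule sum.swap)
    also have "\<dots> = (\<Sum>j\<in>{1..m}. p j * real (dim (B j ` V k)))"
    proof (rule sum.cong[OF refl])
      fix j assume j: "j \<in> {1..m}"
      have "(\<Sum>i<k. if i \<in> I j then 1 else 0 :: real) = real (card ({..<k} \<inter> I j))"
        using sum.inter_restrict[of "{..<k}" "\<lambda>_. 1::real" "I j"] by simp
      then show "(\<Sum>i<k. p j * (if i \<in> I j then 1 else 0)) = p j * real (dim (B j ` V k))"
        using cardI[OF j that] by (simp add: sum_distrib_left[symmetric])
    qed
    finally show ?thesis .
  qed
  have "\<exists>s>0. \<forall>\<mu>. 0 < \<mu> 0 \<longrightarrow> (\<forall>i k. i \<le> k \<longrightarrow> k < n \<longrightarrow> \<mu> i \<le> \<mu> k) \<longrightarrow> \<mu> (n - 1) = 1 \<longrightarrow>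
    (\<Prod>i<n. \<mu> i powr (a i - 1)) \<le> \<mu> 0 powr s"
  proof (rule Abel_summation_bound)
    show "n > 0" using n by (simp add: n_def)
    show "(\<Sum>i<n. a i) = real n"
      using asum[of n, unfolded Vn] feas feasible_surjective[OF feas] by (simp add: feasible_def n_def)
    fix k assume k: "0 < k" "k < n"
    have Vk: "subspace (V k)" "V k \<subseteq> H" "dim (V k) = k" using V[of k] k by simp_all
    have "dim (V k) \<noteq> dim {0::'a}" "dim (V k) \<noteq> dim H" using Vk(3) k by (simp_all add: n_def)
    then have "V k \<noteq> {0}" "V k \<noteq> H" by metis+
    moreover have "\<not> critical_subspace m H B p (V k)" using simple by (simp add: simple_def)
    ultimately have "real (dim (V k)) \<noteq> (\<Sum>j\<in>{1..m}. p j * real (dim (B j ` V k)))"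
      using Vk unfolding critical_subspace_def by argo
    moreover have "real (dim (V k)) \<le> (\<Sum>j\<in>{1..m}. p j * real (dim (B j ` V k)))"
      using feas Vk(1,2) unfolding feasible_def by blast
    ultimately show "real k < (\<Sum>i<k. a i)" using asum[of k] V(3)[of k] k by simp
  qed
  then obtain s where s: "s > 0" "\<And>\<mu>. 0 < \<mu> 0 \<Longrightarrow> (\<forall>i k. i \<le> k \<longrightarrow> k < n \<longrightarrow> \<mu> i \<le> \<mu> k) \<Longrightarrow> \<mu> (n - 1) = 1 \<Longrightarrow>
    (\<Prod>i<n. \<mu> i powr (a i - 1)) \<le> \<mu> 0 powr s" by blast
  have "\<exists>C>0. \<forall>\<^sub>F k in sequentially. det_on (Hj j) (A k j) \<le> C * (\<Prod>i\<in>I j. \<mu> k i)" if j: "j \<in> {1..m}" for j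
  proof (rule normalised_det_bound[OF norm lim _ j])
    show "f i \<in> H" if "i < dim H" for i using fH that by (simp add: n_def)
    show "I j \<subseteq> {..<dim H}" using I by (simp add: n_def)
    show "card (I j) = dim (Hj j)"
      using cardI[OF j, of n] I[of j] feasible_surjective[OF feas j] by (simp add: Vn Int_absorb1)
    show "inj_on (\<lambda>i. B j (f i)) (I j)" "independent ((\<lambda>i. B j (f i)) ` I j)"
      unfolding I_def by (rule greedy)+
  qed
  then obtain C where C: "\<And>j. j \<in> {1..m} \<Longrightarrow> C j > 0"
    and Cev: "\<And>j. j \<in> {1..m} \<Longrightarrow> \<forall>\<^sub>F k in sequentially. det_on (Hj j) (A k j) \<le> C j * (\<Prod>i\<in>I j. \<mu> k i)"
    by metis
  define K where "K = (\<Prod>j\<in>{1..m}. C j powr p j)"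
  have K: "K > 0" unfolding K_def using C by (intro prod_pos) fastforce
  have "\<forall>\<^sub>F k in sequentially. \<forall>j\<in>{1..m}. det_on (Hj j) (A k j) \<le> C j * (\<Prod>i\<in>I j. \<mu> k i)"
    using Cev by (intro eventually_ball_finite) auto
  then have "\<forall>\<^sub>F k in sequentially. ratio (A k) \<le> K * \<mu> k 0 powr s"
  proof (rule eventually_mono)
    fix k assume det: "\<forall>j\<in>{1..m}. det_on (Hj j) (A k j) \<le> C j * (\<Prod>i\<in>I j. \<mu> k i)"
    have A: "gaussian_input m Hj (A k)" and \<mu>: "0 < \<mu> k 0" "\<forall>i l. i \<le> l \<longrightarrow> l < n \<longrightarrow> \<mu> k i \<le> \<mu> k l"
      "\<mu> k (n - 1) = 1" and detM: "det_on H (M (A k)) = (\<Prod>i<n. \<mu> k i)"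
      using norm[of k] by (auto simp: normalised_def n_def)
    have pos: "\<mu> k i > 0" if "i < n" for i using \<mu>(1,2) that by (meson le0 less_le_trans)
    have ne: "\<mu> k i \<noteq> 0" if "i < n" for i using pos[OF that] by simp
    have prodpos: "(\<Prod>i<n. \<mu> k i) > 0" using pos by (intro prod_pos) auto
    have "(\<Prod>j\<in>{1..m}. det_on (Hj j) (A k j) powr p j)
        \<le> (\<Prod>j\<in>{1..m}. C j powr p j * (\<Prod>i<n. \<mu> k i powr (p j * (if i \<in> I j then 1 else 0))))"
    proof (rule prod_mono)
      fix j assume j: "j \<in> {1..m}"
      have "det_on (Hj j) (A k j) powr p j \<le> (C j * (\<Prod>i\<in>I j. \<mu> k i)) powr p j"
        using det j inputD(4)[OF A j] datumD(4)[OF j] by (intro powr_mono2) auto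
      also have "\<dots> = C j powr p j * (\<Prod>i\<in>I j. \<mu> k i) powr p j"
        using C[OF j] pos I[of j] by (intro powr_mult)
      also have "(\<Prod>i\<in>I j. \<mu> k i) powr p j = (\<Prod>i\<in>I j. \<mu> k i powr p j)"
        by (rule prod_powr_distrib)
      also have "\<dots> = (\<Prod>i\<in>{..<n} \<inter> I j. \<mu> k i powr p j)"
        using I[of j] by (simp add: Int_absorb1)
      also have "\<dots> = (\<Prod>i<n. if i \<in> I j then \<mu> k i powr p j else 1)"
        by (rule prod.inter_restrict) simp
      also have "\<dots> = (\<Prod>i<n. \<mu> k i powr (p j * (if i \<in> I j then 1 else 0)))"
        using ne by (intro prod.cong) auto
      finally show "0 \<le> det_on (Hj j) (A k j) powr p j \<and> det_on (Hj j) (A k j) powr p j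
        \<le> C j powr p j * (\<Prod>i<n. \<mu> k i powr (p j * (if i \<in> I j then 1 else 0)))" by simp
    qed
    also have "\<dots> = K * (\<Prod>j\<in>{1..m}. \<Prod>i<n. \<mu> k i powr (p j * (if i \<in> I j then 1 else 0)))"
      by (simp only: prod.distrib K_def)
    also have "(\<Prod>j\<in>{1..m}. \<Prod>i<n. \<mu> k i powr (p j * (if i \<in> I j then 1 else 0)))
        = (\<Prod>i<n. \<Prod>j\<in>{1..m}. \<mu> k i powr (p j * (if i \<in> I j then 1 else 0)))"
      by (rule prod.swap)
    also have "\<dots> = (\<Prod>i<n. \<mu> k i powr a i)"
      using ne unfolding a_def by (intro prod.cong refl powr_sum[symmetric]) auto
    also have "\<dots> = (\<Prod>i<n. \<mu> k i * \<mu> k i powr (a i - 1))"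
      proof (rule prod.cong[OF refl])
      fix i assume "i \<in> {..<n}"
      then have "\<mu> k i > 0" using pos by simp
      then show "\<mu> k i powr a i = \<mu> k i * \<mu> k i powr (a i - 1)" by (simp add: powr_diff)
    qed
    also have "\<dots> = (\<Prod>i<n. \<mu> k i) * (\<Prod>i<n. \<mu> k i powr (a i - 1))"
      by (rule prod.distrib)
    finally have "(\<Prod>j\<in>{1..m}. det_on (Hj j) (A k j) powr p j)
      \<le> K * ((\<Prod>i<n. \<mu> k i) * (\<Prod>i<n. \<mu> k i powr (a i - 1)))" .
    then have "ratio (A k) \<le> K * (\<Prod>i<n. \<mu> k i powr (a i - 1))"
      unfolding ratio_def detM using prodpos by (simp add: field_simps)
    also have "\<dots> \<le> K * \<mu> k 0 powr s"
      using s(2)[OF \<mu>] K by (intro mult_left_mono) auto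
    finally show "ratio (A k) \<le> K * \<mu> k 0 powr s" .
  qed
  then show ?thesis using K s(1) by blast
qed

text \<open>
  As the ratios stay above \<open>c\<close>, the previous bound keeps the smallest eigenvalue above some \<open>\<delta> > 0\<close>, so the
  product of the \<open>(det A\<^sub>j) powr p j\<close> stays above \<open>c \<delta>^n\<close>. The entrywise limit is thus non-degenerate,
  and \<open>ratio\<close> is continuous there.
\<close>

lemma normalised_limit:
  assumes feas: "feasible m H Hj B p" and simple: "simple m H B p" and n: "dim H > 0"
    and norm: "\<And>k. normalised (A k) (e k) (\<mu> k)" and c: "c > 0" "\<And>k. c \<le> ratio (A k)"
  shows "\<exists>r T. strict_mono (r :: nat \<Rightarrow> nat) \<and> gaussian_input m Hj T \<and> (\<lambda>k. ratio (A (r k))) \<longlonglongrightarrow> ratio T"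
proof -
  have "bounded (range (\<lambda>k. e k i))" if "i \<in> {..<dim H}" for i
  proof -
    have "inner (e k i) (e k i) = 1" for k using norm[of k] that by (simp add: normalised_def)
    then have "norm (e k i) = 1" for k by (simp add: norm_eq_1)
    then show ?thesis by (auto simp: bounded_iff intro!: exI[of _ 1])
  qed
  then obtain r1 f where r1: "strict_mono r1" and f: "\<forall>i\<in>{..<dim H}. (\<lambda>k. e (r1 k) i) \<longlonglongrightarrow> f i"
    using bounded_family_subsequence[of "{..<dim H}" "\<lambda>i k. e k i"] by blast
  have "\<forall>j\<in>{1..m}. \<exists>bs. orthonormal_basis_list (Hj j) bs"
    using orthonormal_basis_list_exists datumD(1) by blast
  then obtain bs where bs: "\<And>j. j \<in> {1..m} \<Longrightarrow> orthonormal_basis_list (Hj j) (bs j)" by metis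
  define d where "d = (\<lambda>j. dim (Hj j))"
  have len: "length (bs j) = d j" if "j \<in> {1..m}" for j
    using bs[OF that] by (simp add: orthonormal_basis_list_def d_def)
  have bsH: "bs j ! l \<in> Hj j" if "j \<in> {1..m}" "l < d j" for j l
    using bs[OF that(1)] nth_mem[of l "bs j"] that len by (auto simp: orthonormal_basis_list_def)
  define J where "J = (SIGMA j:{1..m}. {..<d j} \<times> {..<d j})"
  define X where "X = (\<lambda>(j, l, l') k. inner (A (r1 k) j (bs j ! l)) (bs j ! l'))"
  have bX: "bounded (range (X q))" if "q \<in> J" for q
  proof -
    obtain j l l' where q: "q = (j, l, l')" "j \<in> {1..m}" "l < d j" "l' < d j"
      using \<open>q \<in> J\<close> by (auto simp: J_def)
    show ?thesis
      using normalised_entries_bounded[OF feas norm q(2) bsH[OF q(2,3)] bsH[OF q(2,4)], of "\<lambda>k. r1 k"]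
      by (simp add: X_def q(1))
  qed
  have "finite J" by (simp add: J_def)
  then obtain r2 a where r2: "strict_mono r2" and a: "\<forall>q\<in>J. (\<lambda>k. X q (r2 k)) \<longlonglongrightarrow> a q"
    using bounded_family_subsequence[of J X] bX by blast
  define r where "r = (\<lambda>k. r1 (r2 k))"
  have r: "strict_mono r" using strict_mono_o[OF r1 r2] by (simp add: r_def comp_def)
  note norm' = norm[of "r _"]
  have input: "gaussian_input m Hj (A (r k))" for k using norm' by (simp add: normalised_def)
  have lim_e: "(\<lambda>k. e (r k) i) \<longlonglongrightarrow> f i" if "i < dim H" for i
    using LIMSEQ_subseq_LIMSEQ[of "\<lambda>k. e (r1 k) i" "f i" r2] f r2 that by (simp add: r_def comp_def)
  have lim_a: "(\<lambda>k. inner (A (r k) j (bs j ! l)) (bs j ! l')) \<longlonglongrightarrow> a (j, l, l')"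
    if "j \<in> {1..m}" "l < d j" "l' < d j" for j l l'
  proof -
    have "(j, l, l') \<in> J" using that by (simp add: J_def)
    then have "(\<lambda>k. X (j, l, l') (r2 k)) \<longlonglongrightarrow> a (j, l, l')" using a by blast
    then show ?thesis by (simp add: X_def r_def)
  qed
  define T where "T = (\<lambda>j x. \<Sum>l<d j. \<Sum>l'<d j. (inner (bs j ! l) x * a (j, l, l')) *\<^sub>R bs j ! l')"
  have linT: "linear (T j)" for j
    unfolding T_def
    by (intro linear_compose_sum ballI linearI)
      (simp_all add: inner_add_right distrib_right scaleR_left_distrib mult.assoc)
  have imT: "T j ` Hj j \<subseteq> Hj j" if "j \<in> {1..m}" for j
    unfolding T_def using bsH[OF that] datumD(1)[OF that]
    by (auto intro!: subspace_sum subspace_scale)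
  have limT: "(\<lambda>k. inner (A (r k) j x) y) \<longlonglongrightarrow> inner (T j x) y"
    if j: "j \<in> {1..m}" and x: "x \<in> Hj j" and y: "y \<in> Hj j" for j x y
  proof -
    note ex = orthonormal_basis_list_expand[OF datumD(1)[OF j] bs[OF j]]
    have "inner (A (r k) j x) y
        = (\<Sum>l<d j. \<Sum>l'<d j. inner (bs j ! l) x * inner (A (r k) j (bs j ! l)) (bs j ! l') * inner (bs j ! l') y)"
      for k
    proof -
      have "inner v y = (\<Sum>l'<d j. inner v (bs j ! l') * inner (bs j ! l') y)" for v
      proof -
        have "inner v y = inner v (\<Sum>l'<d j. inner (bs j ! l') y *\<^sub>R bs j ! l')"
          using ex[OF y] len[OF j] by simp
        then show ?thesis by (simp add: inner_sum_right mult.commute)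
      qed
      note vy = this
      have "inner (A (r k) j x) y = inner (A (r k) j (\<Sum>l<d j. inner (bs j ! l) x *\<^sub>R bs j ! l)) y"
        using ex[OF x] len[OF j] by simp
      also have "\<dots> = (\<Sum>l<d j. inner (bs j ! l) x * inner (A (r k) j (bs j ! l)) y)"
        using inputD(3)[OF input j] by (simp add: linear_sum linear_cmul inner_sum_left)
      also have "\<dots> = (\<Sum>l<d j. \<Sum>l'<d j. inner (bs j ! l) x * inner (A (r k) j (bs j ! l)) (bs j ! l') * inner (bs j ! l') y)"
        by (subst vy) (simp add: sum_distrib_left mult.assoc)
      finally show ?thesis .
    qed
    moreover have "inner (T j x) y
        = (\<Sum>l<d j. \<Sum>l'<d j. inner (bs j ! l) x * a (j, l, l') * inner (bs j ! l') y)"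
      by (simp add: T_def inner_sum_left)
    moreover have "(\<lambda>k. \<Sum>l<d j. \<Sum>l'<d j. inner (bs j ! l) x * inner (A (r k) j (bs j ! l)) (bs j ! l') * inner (bs j ! l') y)
        \<longlonglongrightarrow> (\<Sum>l<d j. \<Sum>l'<d j. inner (bs j ! l) x * a (j, l, l') * inner (bs j ! l') y)"
      using lim_a[OF j] by (intro tendsto_sum tendsto_mult tendsto_const) auto
    ultimately show ?thesis by simp
  qed
  have symT: "symmetric_form (Hj j) (T j)" if j: "j \<in> {1..m}" for j
    unfolding symmetric_form_def
  proof (intro conjI linT ballI)
    fix x y assume xy: "x \<in> Hj j" "y \<in> Hj j"
    have "inner (A (r k) j x) y = inner (A (r k) j y) x" for k
      using positive_formD(3)[OF inputD(1)[OF input j] xy] .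
    then have "inner (T j x) y = inner (T j y) x"
      using LIMSEQ_unique[OF limT[OF j xy]] limT[OF j xy(2,1)] by simp
    then show "inner (T j x) y = inner x (T j y)" by (simp add: inner_commute)
  qed
  have nnT: "inner (T j x) x \<ge> 0" if j: "j \<in> {1..m}" and x: "x \<in> Hj j" for j x
    using LIMSEQ_le_const[OF limT[OF j x x], of 0] positive_formD(5)[OF inputD(1)[OF input j] x] by blast
  have limdet: "(\<lambda>k. det_on (Hj j) (A (r k) j)) \<longlonglongrightarrow> det_on (Hj j) (T j)" if j: "j \<in> {1..m}" for j
    by (rule tendsto_det_on[OF datumD(1)[OF j] inputD(3,2)[OF input j] linT imT[OF j] limT[OF j]])
  have limprod: "(\<lambda>k. \<Prod>j\<in>{1..m}. det_on (Hj j) (A (r k) j) powr p j)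
      \<longlonglongrightarrow> (\<Prod>j\<in>{1..m}. det_on (Hj j) (T j) powr p j)"
  proof (rule tendsto_prod)
    fix j assume j: "j \<in> {1..m}"
    show "(\<lambda>k. det_on (Hj j) (A (r k) j) powr p j) \<longlonglongrightarrow> det_on (Hj j) (T j) powr p j"
    proof (rule tendsto_powr'[OF limdet[OF j] tendsto_const])
      have "0 \<le> det_on (Hj j) (A (r k) j)" for k using inputD(4)[OF input j] by (rule less_imp_le)
      then show "det_on (Hj j) (T j) \<noteq> 0 \<or> 0 < p j \<and> (\<forall>\<^sub>F k in sequentially. 0 \<le> det_on (Hj j) (A (r k) j))"
        using datumD(4)[OF j] by simp
    qed
  qed
  obtain K s where K: "K > 0" and s: "s > 0"
    and bound: "\<forall>\<^sub>F k in sequentially. ratio (A (r k)) \<le> K * \<mu> (r k) 0 powr s"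
    using normalised_ratio_bound[OF feas simple n norm' lim_e] by blast
  define \<delta> where "\<delta> = (c / K) powr (1 / s)"
  have \<delta>: "\<delta> > 0" using c K by (simp add: \<delta>_def)
  have "\<forall>\<^sub>F k in sequentially. c * \<delta> ^ dim H \<le> (\<Prod>j\<in>{1..m}. det_on (Hj j) (A (r k) j) powr p j)"
    using bound
  proof (rule eventually_mono)
    fix k assume "ratio (A (r k)) \<le> K * \<mu> (r k) 0 powr s"
    then have "c \<le> K * \<mu> (r k) 0 powr s" using c(2)[of "r k"] by linarith
    then have "c / K \<le> \<mu> (r k) 0 powr s" using K by (simp add: field_simps)
    then have "\<delta> \<le> (\<mu> (r k) 0 powr s) powr (1 / s)"
      unfolding \<delta>_def using c K s by (intro powr_mono2) auto
    moreover have \<mu>: "0 < \<mu> (r k) 0" "\<forall>i l. i \<le> l \<longrightarrow> l < dim H \<longrightarrow> \<mu> (r k) i \<le> \<mu> (r k) l"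
      and detM: "det_on H (M (A (r k))) = (\<Prod>i<dim H. \<mu> (r k) i)"
      using norm[of "r k"] by (auto simp: normalised_def)
    ultimately have "\<delta> \<le> \<mu> (r k) 0" using s by (simp add: powr_powr)
    then have "\<delta> \<le> \<mu> (r k) i" if "i < dim H" for i using \<mu>(2) that by (meson le0 order_trans)
    then have "(\<Prod>i<dim H. \<delta>) \<le> det_on H (M (A (r k)))"
      unfolding detM using \<delta> by (intro prod_mono) auto
    then have le: "\<delta> ^ dim H \<le> det_on H (M (A (r k)))" by simp
    then have "det_on H (M (A (r k))) > 0" using \<delta> by (meson less_le_trans zero_less_power)
    then have "(\<Prod>j\<in>{1..m}. det_on (Hj j) (A (r k) j) powr p j) = ratio (A (r k)) * det_on H (M (A (r k)))"
      by (simp add: ratio_def)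
    moreover have "c * \<delta> ^ dim H \<le> ratio (A (r k)) * det_on H (M (A (r k)))"
      using c(2)[of "r k"] c(1) le \<delta> by (intro mult_mono) auto
    ultimately show "c * \<delta> ^ dim H \<le> (\<Prod>j\<in>{1..m}. det_on (Hj j) (A (r k) j) powr p j)" by simp
  qed
  then have "c * \<delta> ^ dim H \<le> (\<Prod>j\<in>{1..m}. det_on (Hj j) (T j) powr p j)"
    by (rule tendsto_lowerbound[OF limprod]) simp
  then have prodpos: "(\<Prod>j\<in>{1..m}. det_on (Hj j) (T j) powr p j) > 0"
    using c(1) \<delta> by (meson less_le_trans mult_pos_pos zero_less_power)
  have T: "gaussian_input m Hj T"
  proof (rule inputI)
    fix j assume j: "j \<in> {1..m}"
    show "T j ` Hj j \<subseteq> Hj j" by (rule imT[OF j])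
    have "det_on (Hj j) (T j) \<noteq> 0"
    proof
      assume "det_on (Hj j) (T j) = 0"
      then have "(\<Prod>j\<in>{1..m}. det_on (Hj j) (T j) powr p j) = 0"
        using j by (intro prod_zero) auto
      then show False using prodpos by linarith
    qed
    then show "positive_form (Hj j) (T j)"
      using det_on_nonneg_form(2)[OF datumD(1)[OF j] symT[OF j] imT[OF j] nnT[OF j]] by blast
  qed
  have "(\<lambda>k. inner (M (A (r k)) x) y) \<longlonglongrightarrow> inner (M T x) y" if "x \<in> H" "y \<in> H" for x y
    unfolding inner_M[OF that(2)] using limT datumD(3) that
    by (intro tendsto_sum tendsto_mult tendsto_const) auto
  then have "(\<lambda>k. det_on H (M (A (r k)))) \<longlonglongrightarrow> det_on H (M T)"
    by (intro tendsto_det_on subspace_H symmetric_formD(1)[OF M_symmetric] input T M_image)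
  moreover have "det_on H (M T) \<noteq> 0"
    using det_M(2)[OF T] feasible_M_positive[OF feas T] by simp
  ultimately have "(\<lambda>k. ratio (A (r k))) \<longlonglongrightarrow> ratio T"
    unfolding ratio_def using limprod by (intro tendsto_divide)
  then show ?thesis using r T by blast
qed

lemma identity_input: "gaussian_input m Hj (\<lambda>j x. x)"
  by (rule inputI) (auto simp: positive_form_inner)

text \<open>
  The zero space has no largest eigenvalue to normalise and is treated apart; there all
  spaces \<open>Hj j\<close> are zero and \<open>ratio\<close> is constantly \<open>1\<close>.
\<close>

lemma feasible_simple_imp_extremiser:
  assumes feas: "feasible m H Hj B p" and simple: "simple m H B p"
  shows "\<exists>A. gaussian_extremiser m H Hj B p A"
proof (cases "dim H = 0")
  case True
  have det1: "det_on S T = 1" if S: "subspace S" "dim S = 0" and T: "linear T" for S :: "'c::euclidean_space set" and T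
  proof -
    have "S \<subseteq> {0}" using S by simp
    then have "det_on S T = det_on S (\<lambda>x. x)" using linear_0[OF T] by (intro det_on_cong[OF S(1)]) auto
    then show ?thesis using det_on_id[OF S(1)] by simp
  qed
  have "dim (Hj j) = 0" if j: "j \<in> {1..m}" for j
  proof -
    have "(\<Sum>j\<in>{1..m}. p j * real (dim (Hj j))) = 0" using feas True by (simp add: feasible_def)
    then have "p j * real (dim (Hj j)) = 0"
      by (rule sum_nonneg_0[OF finite_atLeastAtMost _ _ j, rotated]) (use datumD(4) less_imp_le in \<open>auto intro!: mult_nonneg_nonneg\<close>)
    then show ?thesis using datumD(4)[OF j] by simp
  qed
  then have "ratio A = 1" "det_on H (M A) = 1" if A: "gaussian_input m Hj A" for A
  proof -
    show detM: "det_on H (M A) = 1" by (rule det1[OF subspace_H True symmetric_formD(1)[OF M_symmetric[OF A]]])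
    have "det_on (Hj j) (A j) = 1" if j: "j \<in> {1..m}" for j
      using det1[OF datumD(1)[OF j] _ inputD(3)[OF A j]] \<open>\<And>j. j \<in> {1..m} \<Longrightarrow> dim (Hj j) = 0\<close>[OF j] by blast
    then show "ratio A = 1" by (simp add: ratio_def detM)
  qed
  then show ?thesis using identity_input by (auto simp: extremiser_iff)
next
  case False
  then have n: "dim H > 0" by (rule neq0_conv[THEN iffD1])
  \<comment> \<open>Extended reals give the supremum before \<open>ratio\<close> is known to be bounded.\<close>
  define R where "R = (\<lambda>A. ereal (ratio A)) ` {A. gaussian_input m Hj A}"
  have "R \<noteq> {}" using identity_input by (auto simp: R_def)
  from Sup_countable_SUP[OF this] obtain g :: "nat \<Rightarrow> ereal"
    where g: "incseq g" "range g \<subseteq> R" "Sup R = (SUP k. g k)" by blast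
  have "\<forall>k. \<exists>A. gaussian_input m Hj A \<and> g k = ereal (ratio A)" using g(2) by (auto simp: R_def)
  then obtain A where A: "\<And>k. gaussian_input m Hj (A k)" "\<And>k. g k = ereal (ratio (A k))" by metis
  have "\<forall>k. \<exists>A' e \<mu>. normalised A' e \<mu> \<and> ratio A' = ratio (A k)"
    using normalised_exists[OF feas A(1) n] by blast
  then obtain A' e \<mu> where A': "\<And>k. normalised (A' k) (e k) (\<mu> k)" "\<And>k. ratio (A' k) = ratio (A k)" by metis
  define c where "c = ratio (A 0)"
  have "det_on H (M (A 0)) > 0" using det_M(2)[OF A(1)] feasible_M_positive[OF feas A(1)] by blast
  then have c: "c > 0" unfolding c_def by (rule ratio_pos[OF A(1)])
  have cA': "c \<le> ratio (A' k)" for k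
    using incseqD[OF g(1), of 0 k] by (simp add: A A' c_def)
  have "\<exists>r T. strict_mono (r :: nat \<Rightarrow> nat) \<and> gaussian_input m Hj T \<and> (\<lambda>k. ratio (A' (r k))) \<longlonglongrightarrow> ratio T"
    by (rule normalised_limit[OF feas simple n A'(1) c cA'])
  then obtain r :: "nat \<Rightarrow> nat" and T where r: "strict_mono r" and T: "gaussian_input m Hj T"
    and lim: "(\<lambda>k. ratio (A' (r k))) \<longlonglongrightarrow> ratio T" by (elim exE conjE) (rule that)
  have "g \<longlonglongrightarrow> Sup R" unfolding g(3) by (rule LIMSEQ_SUP[OF g(1)])
  then have "(g \<circ> r) \<longlonglongrightarrow> Sup R" using r by (rule LIMSEQ_subseq_LIMSEQ)
  moreover have "(g \<circ> r) \<longlonglongrightarrow> ereal (ratio T)"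
    using lim by (simp add: comp_def A A')
  ultimately have sup: "Sup R = ereal (ratio T)" by (rule LIMSEQ_unique)
  have "ratio A'' \<le> ratio T" if "gaussian_input m Hj A''" for A''
  proof -
    have "ereal (ratio A'') \<le> Sup R" using that by (intro Sup_upper) (auto simp: R_def)
    then show ?thesis by (simp add: sup)
  qed
  moreover have "det_on H (M A'') > 0" if "gaussian_input m Hj A''" for A''
    using det_M(2)[OF that] feasible_M_positive[OF feas that] by blast
  ultimately have "gaussian_extremiser m H Hj B p T" using T by (simp add: extremiser_iff)
  then show ?thesis by blast
qed

end

section \<open>The characterisation\<close>

theorem theorem1p20:
  fixes m :: nat
    and H :: "'a::euclidean_space set"
    and Hj :: "nat \<Rightarrow> 'b::euclidean_space set"
    and B :: "nat \<Rightarrow> 'a \<Rightarrow> 'b"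
    and p :: "nat \<Rightarrow> real"
  assumes "BL_datum m H Hj B p"
    and "\<forall>j\<in>{1..m}. p j > 0"
  shows "((\<exists>A. gaussian_extremiser m H Hj B p A) \<and>
          (\<forall>A A'. gaussian_extremiser m H Hj B p A \<and> gaussian_extremiser m H Hj B p A' \<longrightarrow>
             (\<exists>c>0. \<forall>j\<in>{1..m}. \<forall>x\<in>Hj j. A' j x = c *\<^sub>R A j x)))
         \<longleftrightarrow> feasible m H Hj B p \<and> simple m H B p"
proof -
  interpret positive_datum m H Hj B p
    using assms by unfold_locales
  show ?thesis
  proof (intro iffI conjI)
    assume L: "(\<exists>A. gaussian_extremiser m H Hj B p A) \<and>
          (\<forall>A A'. gaussian_extremiser m H Hj B p A \<and> gaussian_extremiser m H Hj B p A' \<longrightarrow>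
             (\<exists>c>0. \<forall>j\<in>{1..m}. \<forall>x\<in>Hj j. A' j x = c *\<^sub>R A j x))"
    then obtain A where A: "gaussian_extremiser m H Hj B p A" by blast
    show "feasible m H Hj B p" by (rule extremiser_imp_feasible[OF A])
    show "simple m H B p"
      unfolding simple_def
    proof
      assume "\<exists>V. critical_subspace m H B p V"
      then obtain V where "critical_subspace m H B p V" ..
      from critical_imp_not_unique[OF A this] L A show False by blast
    qed
  next
    assume R: "feasible m H Hj B p \<and> simple m H B p"
    then show "\<exists>A. gaussian_extremiser m H Hj B p A"
      using feasible_simple_imp_extremiser by blast
    show "\<forall>A A'. gaussian_extremiser m H Hj B p A \<and> gaussian_extremiser m H Hj B p A' \<longrightarrow>
             (\<exists>c>0. \<forall>j\<in>{1..m}. \<forall>x\<in>Hj j. A' j x = c *\<^sub>R A j x)"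
      using simple_imp_proportional R by blast
  qed
qed

end
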